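(* Let $n\ge 2$ be an integer, let $1\le p<\infty$ and let $q$ be defined by $\frac1q=\frac1p-\frac1n$ (with $\frac1q=0$ when $p=n$). For any $f\in W^{1,p}(\mathbb{R}^n)$, $$\Vert\nabla f\Vert_p\ \ge\ n\,\omega_n^{1/n}\Big(1-\frac1q\Big)\Vert f\Vert_{\infty,p}.$$ In particular, for $p=n$ we have $\Vert\nabla f\Vert_n\ge n\,\omega_n^{1/n}\,\Vert f\Vert_{\infty,n}$.
   Context: Functions are real-valued on $\mathbb{R}^n$. $W^{1,p}(\mathbb{R}^n)$ is the usual Sobolev space, $\nabla f$ the (weak) gradient, $\Vert\nabla f\Vert_p$ the $L_p(\mathbb{R}^n)$-norm of the Euclidean norm of $\nabla f$, $|\cdot|_n$ is $n$-dimensional Lebesgue measure, and $\omega_n$ is the Lebesgue measure of the Euclidean unit ball of $\mathbb{R}^n$. The decreasing rearrangement of $f$ is $f^*(t)=\inf\{\lambda>0 : |\{|f|>\lambda\}|_n\le t\}$, $t\ge 0$, and its Hardy transform is $f^{**}(t)=\frac1t\int_0^t f^*(s)\,ds$. For $1\le p<\infty$ set $$\Vert f\Vert_{\infty,p}=\left(\int_0^\infty \big(f^{**}(t)-f^*(t)\big)^p\,\frac{dt}{t^{p/n}}\right)^{1/p}.$$ *)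

theory Defs
  imports "HOL-Analysis.Analysis"
begin

text \<open>
  The space \<open>R^n\<close> is \<open>real ^ 'n\<close> with \<open>n = CARD('n)\<close>, and measurability is with respect
  to the completed Lebesgue measure. Quantities that may a priori be infinite (norms,
  rearrangements) take values in \<open>ennreal\<close>.
\<close>

text \<open>Meant for exponents \<open>a > 0\<close> only, so that \<open>0\<close> is mapped to \<open>0\<close> and \<open>\<infinity>\<close> to \<open>\<infinity>\<close>.\<close>

definition ennpowr :: "ennreal \<Rightarrow> real \<Rightarrow> ennreal" where
  "ennpowr x a = (if x = \<infinity> then \<infinity> else ennreal (enn2real x powr a))"

definition Lp_norm :: "real \<Rightarrow> (real ^ 'n \<Rightarrow> 'b::euclidean_space) \<Rightarrow> ennreal" where
  "Lp_norm p f = ennpowr (\<integral>\<^sup>+ x. ennpowr (ennreal (norm (f x))) p \<partial>lebesgue) (1 / p)"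

definition Lp_space :: "real \<Rightarrow> (real ^ 'n \<Rightarrow> 'b::euclidean_space) set" where
  "Lp_space p = {f. f \<in> borel_measurable lebesgue \<and> Lp_norm p f < \<infinity>}"

definition locally_integrable :: "(real ^ 'n \<Rightarrow> 'b::euclidean_space) \<Rightarrow> bool" where
  "locally_integrable f \<longleftrightarrow> (\<forall>K. compact K \<longrightarrow> set_integrable lebesgue K f)"

definition partial_deriv :: "'n \<Rightarrow> (real ^ 'n \<Rightarrow> real) \<Rightarrow> real ^ 'n \<Rightarrow> real" where
  "partial_deriv i f x = frechet_derivative f (at x) (axis i 1)"

primrec Ck :: "nat \<Rightarrow> (real ^ 'n \<Rightarrow> real) \<Rightarrow> bool" where
  "Ck 0 f \<longleftrightarrow> continuous_on UNIV f"
| "Ck (Suc k) f \<longleftrightarrow> (\<forall>x. f differentiable (at x)) \<and> (\<forall>i. Ck k (partial_deriv i f))"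

text \<open>The space of \<open>C\<^sup>\<infinity>\<close> functions with compact support.\<close>

definition test_function :: "(real ^ 'n \<Rightarrow> real) \<Rightarrow> bool" where
  "test_function \<phi> \<longleftrightarrow> (\<forall>k. Ck k \<phi>) \<and> compact (closure {x. \<phi> x \<noteq> 0})"

text \<open>
  Functions are not identified up to null sets here, so the weak gradient is a relation;
  it determines \<open>g\<close> almost everywhere.
\<close>

definition has_weak_gradient :: "(real ^ 'n \<Rightarrow> real) \<Rightarrow> (real ^ 'n \<Rightarrow> real ^ 'n) \<Rightarrow> bool" where
  "has_weak_gradient f g \<longleftrightarrow>
     locally_integrable f \<and> locally_integrable g \<and>
     (\<forall>\<phi> i. test_function \<phi> \<longrightarrow>
        (LINT x|lebesgue. f x * partial_deriv i \<phi> x) = - (LINT x|lebesgue. g x $ i * \<phi> x))"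

definition sobolev_W1 :: "real \<Rightarrow> (real ^ 'n \<Rightarrow> real) set" where
  "sobolev_W1 p = {f. f \<in> Lp_space p \<and> (\<exists>g \<in> Lp_space p. has_weak_gradient f g)}"

text \<open>The infimum over the empty set is \<open>\<infinity>\<close>.\<close>

definition decr_rearr :: "(real ^ 'n \<Rightarrow> real) \<Rightarrow> real \<Rightarrow> ennreal" where
  "decr_rearr f t =
     Inf {ennreal l | l. l > 0 \<and> emeasure lebesgue {x. \<bar>f x\<bar> > l} \<le> ennreal t}"

definition hardy_rearr :: "(real ^ 'n \<Rightarrow> real) \<Rightarrow> real \<Rightarrow> ennreal" where
  "hardy_rearr f t = (\<integral>\<^sup>+ s \<in> {0..t}. decr_rearr f s \<partial>lborel) / ennreal t"

text \<open>
  The truncated subtraction of \<open>ennreal\<close> is harmless: \<open>decr_rearr f\<close> is nonincreasing, hence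
  \<open>decr_rearr f t \<le> hardy_rearr f t\<close> for \<open>t > 0\<close>, and both are finite for \<open>f\<close> in some \<open>L\<^sub>p\<close>
  with \<open>1 \<le> p < \<infinity>\<close>.
\<close>

definition norm_inf_p :: "real \<Rightarrow> (real ^ 'n \<Rightarrow> real) \<Rightarrow> ennreal" where
  "norm_inf_p p f =
     ennpowr (\<integral>\<^sup>+ t \<in> {0<..}. ennpowr (hardy_rearr f t - decr_rearr f t) p
                / ennreal (t powr (p / real CARD('n))) \<partial>lborel) (1 / p)"

definition omega :: "'n::finite itself \<Rightarrow> real" where
  "omega _ = measure lebesgue (ball (0 :: real ^ 'n) 1)"

end

theory Submission
  imports Defs
begin

text \<open>
  The coarea formula is avoided. If \<open>u\<close> is Lipschitz and differentiable, the supremum of \<open>\<bar>u\<bar>\<close> over balls of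
  radius \<open>h\<close> has the superlevel sets \<open>{\<bar>u\<bar> > \<lambda>} + B\<^sub>h\<close>, so that the Brunn-Minkowski inequality (proved for
  unions of boxes as by Hadwiger and Ohmann) bounds the growth of their measure \<open>\<mu>(\<lambda>)\<close> from below. Letting
  \<open>h \<rightarrow> 0\<close> one gets
  \<open>n \<omega>\<^sub>n\<^bsup>1/n\<^esup> \<integral> \<phi>(\<lambda>) \<mu>(\<lambda>)\<^bsup>1 - 1/n\<^esup> d\<lambda> \<le> \<integral> \<phi>(\<bar>u\<bar>) \<bar>\<nabla>u\<bar> dx\<close>. Mollification and Fatou's lemma extend this to Sobolev
  functions and to all Borel functions \<open>\<phi> \<ge> 0\<close>.

  Since \<open>t (f\<^sup>*\<^sup>*(t) - f\<^sup>*(t))\<close> is the integral of \<open>\<mu>\<close> over \<open>\<lambda> > f\<^sup>*(t)\<close>, the choice \<open>\<phi> = \<mu>\<^bsup>1/n\<^esup>\<close> on that range bounds it by an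
  integral of \<open>s\<^bsup>1/n\<^esup> \<bar>\<nabla>f\<bar>\<close> over \<open>{s \<le> t}\<close>, where \<open>s(x) = \<mu>(\<bar>f(x)\<bar>)\<close>. Off the plateaus of \<open>f\<close> the function \<open>s\<close> transports
  Lebesgue measure to at most Lebesgue measure, and the claim becomes Hardy's inequality with its best
  constant.
\<close>

text \<open>The constant is a product of two sharp constants. The factor n omega^(1/n) is the
  coefficient of h in (m^(1/n) + h omega^(1/n))^n, the Brunn-Minkowski bound for an enlarged set of
  measure m. The factor K = 1 - 1/q comes from Hardy's inequality: Hoelder with the weight s^(-1/q)
  yields K^(1-p), the outer integral in t one more 1/K, and the p-th root turns K^(-p) into 1/K.

  Two obstacles shape the proof. In the limit of the mollified functions, Fatou's lemma helps
  directly only on the side of the level sets. On the gradient side an upper bound is required; it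
  comes from Fatou for the difference to a majorant whose integrals do not exceed the one of the
  limit. Secondly, a plateau of f sends a set of positive measure to a single value of s. Almost
  every level is free of plateaus, so cutting the function of the level down to such levels costs
  nothing; but the result is merely Borel, which is why continuous functions do not suffice in the
  level set inequality.\<close>

section \<open>The Brunn-Minkowski inequality\<close>

text \<open>The Minkowski sum, spelled as in \<open>open_sums\<close> and
  \<open>bounded_sums\<close>.\<close>

abbreviation msum :: "'a::euclidean_space set \<Rightarrow> 'a set \<Rightarrow> 'a set" where
  "msum A B \<equiv> (\<Union>x\<in>A. \<Union>y\<in>B. {x + y})"

text \<open>The sets of the Hadwiger-Ohmann argument. Excluding empty boxes makes the cardinality a
  faithful induction measure and gives every nonempty family positive volume; open boxes remain open
  boxes when cut by an open half-space.\<close>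

definition box_family :: "'a::euclidean_space set set \<Rightarrow> bool" where
  "box_family F \<longleftrightarrow> finite F \<and> (\<forall>X\<in>F. X \<noteq> {} \<and> (\<exists>a b. X = box a b)) \<and> disjoint F"

lemma box_Int_halfspace:
  fixes a b :: "'a::euclidean_space"
  assumes i: "i \<in> Basis"
  shows "box a b \<inter> {x. x \<bullet> i < t} = box a (b + (min (b \<bullet> i) t - b \<bullet> i) *\<^sub>R i)"
    and "box a b \<inter> {x. t < x \<bullet> i} = box (a + (max (a \<bullet> i) t - a \<bullet> i) *\<^sub>R i) b"
  using i by (auto simp: mem_box inner_add_left inner_Basis split: if_splits)

text \<open>A box that misses \<open>H\<close> becomes empty and is removed, hence the strict
  decrease in the last claim. The induction in \<open>brunn_minkowski_box_family\<close> lives on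
  it.\<close>

lemma box_family_cut:
  fixes F :: "'a::euclidean_space set set"
  assumes F: "box_family F" and i: "i \<in> Basis"
    and H: "H = {x. x \<bullet> i < t} \<or> H = {x. t < x \<bullet> i}"
  shows "box_family ((\<lambda>X. X \<inter> H) ` F - {{}})"
    and "\<Union>((\<lambda>X. X \<inter> H) ` F - {{}}) = \<Union>F \<inter> H"
    and "card ((\<lambda>X. X \<inter> H) ` F - {{}}) \<le> card F"
    and "X \<in> F \<Longrightarrow> X \<inter> H = {} \<Longrightarrow> card ((\<lambda>X. X \<inter> H) ` F - {{}}) < card F"
proof -
  have fin: "finite F" using F by (simp add: box_family_def)
  have "\<exists>a b. X \<inter> H = box a b" if X: "X \<in> F" for X
  proof -
    from F X obtain a b where "X = box a b" unfolding box_family_def by blast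
    then show ?thesis using H box_Int_halfspace[OF i, of a b t] by metis
  qed
  moreover have "disjoint ((\<lambda>X. X \<inter> H) ` F - {{}})"
    using F unfolding box_family_def pairwise_def disjnt_def by blast
  ultimately show "box_family ((\<lambda>X. X \<inter> H) ` F - {{}})"
    unfolding box_family_def using fin by blast
  show "\<Union>((\<lambda>X. X \<inter> H) ` F - {{}}) = \<Union>F \<inter> H" by auto
  show "card ((\<lambda>X. X \<inter> H) ` F - {{}}) \<le> card F"
    by (meson Diff_subset card_image_le card_mono fin finite_imageI order_trans)
  assume X: "X \<in> F" "X \<inter> H = {}"
  then have "(\<lambda>X. X \<inter> H) ` F - {{}} \<subseteq> (\<lambda>X. X \<inter> H) ` (F - {X})" by auto
  then have "card ((\<lambda>X. X \<inter> H) ` F - {{}}) \<le> card (F - {X})"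
    by (meson card_image_le card_mono fin finite_Diff finite_imageI order_trans)
  also have "\<dots> < card F" using X fin by (meson card_Diff1_less)
  finally show "card ((\<lambda>X. X \<inter> H) ` F - {{}}) < card F" .
qed

lemma box_family_open: "box_family F \<Longrightarrow> open (\<Union>F)"
  unfolding box_family_def by (metis open_Union open_box)

lemma box_family_bounded: "box_family F \<Longrightarrow> bounded (\<Union>F)"
  unfolding box_family_def by (metis bounded_Union bounded_box)

lemma open_bounded_fmeasurable:
  "open S \<Longrightarrow> bounded S \<Longrightarrow> S \<in> fmeasurable (lborel :: 'a::euclidean_space measure)"
  by (metis bounded_subset_cbox_symmetric borel_open fmeasurableI2 fmeasurable_cbox sets_lborel)

lemma box_family_measure_pos:
  fixes F :: "'a::euclidean_space set set"
  assumes "box_family F" "F \<noteq> {}" shows "0 < measure lborel (\<Union>F)"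
proof -
  obtain X where "X \<in> F" using assms by auto
  then obtain a b where ab: "X = box a b" "box a b \<noteq> {}" using assms unfolding box_family_def by blast
  then have "0 < measure lborel (box a b)"
    by (auto simp: box_ne_empty measure_lborel_box_eq less_imp_le inner_diff_left intro!: prod_pos)
  also have "\<dots> \<le> measure lborel (\<Union>F)"
    by (rule measure_mono_fmeasurable)
       (use \<open>X \<in> F\<close> ab assms in \<open>auto intro!: open_bounded_fmeasurable box_family_open box_family_bounded\<close>)
  finally show ?thesis .
qed

text \<open>Needed for the intermediate value theorem, which cuts a family in a prescribed volume
  ratio.\<close>

lemma measure_box_family_cut_continuous:
  fixes F :: "'a::euclidean_space set set"
  assumes F: "box_family F" and i: "i \<in> Basis"
  shows "continuous_on UNIV (\<lambda>t. measure lborel (\<Union>F \<inter> {x. x \<bullet> i < t}))"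
proof -
  have "measure lborel (\<Union>F \<inter> {x. x \<bullet> i < t}) = (\<Sum>X\<in>F. measure lborel (X \<inter> {x. x \<bullet> i < t}))" for t
  proof -
    have eq: "\<Union>F \<inter> {x. x \<bullet> i < t} = (\<Union>X\<in>F. X \<inter> {x. x \<bullet> i < t})" by auto
    show ?thesis unfolding eq
    proof (rule measure_finite_Union)
      show "finite F" using F by (simp add: box_family_def)
      have op: "open (X \<inter> {x. x \<bullet> i < t}) \<and> bounded (X \<inter> {x. x \<bullet> i < t})" if XF: "X \<in> F" for X
      proof -
        from XF F obtain a b where X: "X = box a b" unfolding box_family_def by blast
        show ?thesis unfolding X
          by (intro conjI open_Int open_box open_halfspace_component_lt bounded_Int disjI1 bounded_box)
      qed
      then show "(\<lambda>X. X \<inter> {x. x \<bullet> i < t}) ` F \<subseteq> sets lborel" by (auto intro: borel_open)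
      show "disjoint_family_on (\<lambda>X. X \<inter> {x. x \<bullet> i < t}) F"
        using F unfolding box_family_def pairwise_def disjnt_def disjoint_family_on_def by blast
      show "emeasure lborel (X \<inter> {x. x \<bullet> i < t}) \<noteq> \<infinity>" if "X \<in> F" for X
        using fmeasurableD2[OF open_bounded_fmeasurable] op[OF that] by auto
    qed
  qed
  moreover have "continuous_on UNIV (\<lambda>t. measure lborel (X \<inter> {x. x \<bullet> i < t}))" if X: "X \<in> F" for X
  proof -
    obtain a b where ab: "X = box a b" "box a b \<noteq> {}" using F X unfolding box_family_def by blast
    \<comment> \<open>The moving upper face is clamped to the box from both sides: no side length
      gets negative, so the product formula also covers the empty and the full cut.\<close>
    define d where "d = (\<lambda>t. b + (max (a \<bullet> i) (min (b \<bullet> i) t) - b \<bullet> i) *\<^sub>R i)"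
    have "X \<inter> {x. x \<bullet> i < t} = box a (d t)" for t
      using i ab by (auto simp: d_def mem_box inner_add_left inner_Basis box_ne_empty split: if_splits)
         (smt (verit, best))+
    moreover have "measure lborel (box a (d t)) = (\<Prod>j\<in>Basis. (d t - a) \<bullet> j)" for t
    proof -
      have "\<forall>j\<in>Basis. a \<bullet> j \<le> d t \<bullet> j"
        using i ab by (auto simp: d_def inner_add_left inner_Basis box_ne_empty less_imp_le)
      then show ?thesis by (simp add: measure_lborel_box_eq)
    qed
    ultimately show ?thesis unfolding d_def by (auto intro!: continuous_intros)
  qed
  ultimately show ?thesis by (auto intro!: continuous_intros)
qed

text \<open>The hyperplane is negligible, so open half-spaces lose nothing.\<close>

lemma measure_split_hyperplane:
  fixes A :: "'a::euclidean_space set"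
  assumes A: "open A" "bounded A" and i: "i \<in> Basis"
  shows "measure lborel A = measure lborel (A \<inter> {x. x \<bullet> i < t}) + measure lborel (A \<inter> {x. t < x \<bullet> i})"
proof -
  have N: "{x. x \<bullet> i = t} \<in> null_sets lborel"
  proof -
    have "{x::'a. x \<bullet> i = t} \<in> null_sets lebesgue"
      using negligible_standard_hyperplane[OF i, of t] by (simp add: negligible_iff_null_sets)
    moreover have "closed {x::'a. x \<bullet> i = t}" by (simp add: closed_hyperplane inner_commute[of _ i])
    ultimately show ?thesis by (simp add: null_sets_def)
  qed
  have "A - {x. x \<bullet> i = t} = (A \<inter> {x. x \<bullet> i < t}) \<union> (A \<inter> {x. t < x \<bullet> i})" by auto
  moreover have "measure lborel (A - {x. x \<bullet> i = t}) = measure lborel A"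
    using A N by (intro measure_Diff_null_set) (auto)
  moreover have "measure lborel ((A \<inter> {x. x \<bullet> i < t}) \<union> (A \<inter> {x. t < x \<bullet> i}))
      = measure lborel (A \<inter> {x. x \<bullet> i < t}) + measure lborel (A \<inter> {x. t < x \<bullet> i})"
  proof (rule measure_Un_AE)
    show "A \<inter> {x. x \<bullet> i < t} \<in> fmeasurable lborel" "A \<inter> {x. t < x \<bullet> i} \<in> fmeasurable lborel"
      using A by (auto intro!: open_bounded_fmeasurable open_Int open_halfspace_component_lt open_halfspace_component_gt bounded_Int)
  qed auto
  ultimately show ?thesis by simp
qed

section \<open>Minkowski sums of boxes\<close>

lemma box_subset_msum:
  fixes a b c d :: "'a::euclidean_space"
  assumes "box a b \<noteq> {}" "box c d \<noteq> {}"
  shows "box (a + c) (b + d) \<subseteq> msum (box a b) (box c d)"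
proof
  fix z assume z: "z \<in> box (a + c) (b + d)"
  \<comment> \<open>The relative position of \<open>z\<close> along axis \<open>j\<close>. Placing
    \<open>x\<close> and \<open>z - x\<close> at this same relative position in their boxes splits
    \<open>z\<close> into a sum.\<close>
  define s where "s = (\<lambda>j. (z \<bullet> j - (a + c) \<bullet> j) / ((b - a) \<bullet> j + (d - c) \<bullet> j))"
  define x where "x = (\<Sum>j\<in>Basis. (a \<bullet> j + s j * ((b - a) \<bullet> j)) *\<^sub>R j)"
  have pos: "0 < (b - a) \<bullet> j" "0 < (d - c) \<bullet> j" if "j \<in> Basis" for j
    using assms that by (auto simp: box_ne_empty inner_diff_left)
  have s: "0 < s j" "s j < 1" if j: "j \<in> Basis" for j
    using z pos[OF j] j by (auto simp: s_def mem_box inner_add_left inner_diff_left divide_simps)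
  have xj: "x \<bullet> j = a \<bullet> j + s j * ((b - a) \<bullet> j)" if "j \<in> Basis" for j
    using that by (simp add: x_def)
  have yj: "(z - x) \<bullet> j = c \<bullet> j + s j * ((d - c) \<bullet> j)" if j: "j \<in> Basis" for j
  proof -
    have "s j * ((b - a) \<bullet> j + (d - c) \<bullet> j) = z \<bullet> j - (a + c) \<bullet> j"
      using pos[OF j] by (simp add: s_def)
    then show ?thesis using xj[OF j] by (simp add: inner_diff_left inner_add_left algebra_simps)
  qed
  have "x \<in> box a b"
    using s pos by (auto simp: mem_box xj) (smt (verit) inner_diff_left mult_less_cancel_right2)
  moreover have "z - x \<in> box c d"
    using s pos by (auto simp: mem_box yj simp del: inner_diff_left) (smt (verit) inner_diff_left mult_less_cancel_right2)
  ultimately show "z \<in> msum (box a b) (box c d)" by force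
qed

text \<open>After division by the root of the product of all \<open>u j + v j\<close>, the
  arithmetic-geometric mean inequality bounds the two roots by the averages of
  \<open>u j / (u j + v j)\<close> and of \<open>v j / (u j + v j)\<close>, and these averages add
  up to 1.\<close>

lemma brunn_minkowski_box:
  fixes a b c d :: "'a::euclidean_space"
  assumes "box a b \<noteq> {}" "box c d \<noteq> {}"
  shows "(root DIM('a) (measure lborel (box a b)) + root DIM('a) (measure lborel (box c d))) ^ DIM('a)
      \<le> measure lborel (box (a + c) (b + d))"
proof -
  define u v where "u = (\<lambda>j. (b - a) \<bullet> j)" and "v = (\<lambda>j. (d - c) \<bullet> j)"
  have pos: "0 < u j" "0 < v j" if "j \<in> Basis" for j
    using assms that by (auto simp: box_ne_empty inner_diff_left u_def v_def)
  let ?n = "DIM('a)"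
  have m: "measure lborel (box a b) = prod u Basis" "measure lborel (box c d) = prod v Basis"
     "measure lborel (box (a + c) (b + d)) = (\<Prod>j\<in>Basis. u j + v j)"
    using assms by (auto simp: measure_lborel_box_eq box_ne_empty less_imp_le add_mono u_def v_def
        inner_add_left inner_diff_left algebra_simps intro!: prod.cong)
  define P where "P = (\<Prod>j\<in>Basis. u j + v j)"
  have P: "0 < P" unfolding P_def using pos by (intro prod_pos) (auto intro: add_pos_pos)
  have amgm: "root ?n (prod w Basis) \<le> (\<Sum>j\<in>Basis. w j / (u j + v j)) / ?n * root ?n P"
    if w: "\<And>j. j \<in> Basis \<Longrightarrow> 0 < w j" for w :: "'a \<Rightarrow> real"
  proof -
    have "(\<Prod>j\<in>Basis. w j / (u j + v j)) powr (1 / ?n) \<le> (\<Sum>j\<in>Basis. w j / (u j + v j) / ?n)"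
      by (rule arith_geom_mean) (use w pos in \<open>auto intro!: divide_nonneg_nonneg add_nonneg_nonneg intro: less_imp_le\<close>)
    also have "(\<Prod>j\<in>Basis. w j / (u j + v j)) = prod w Basis / P"
      by (simp add: P_def prod_dividef)
    also have "(prod w Basis / P) powr (1 / ?n) = root ?n (prod w Basis / P)"
    proof -
      have "0 < prod w Basis / P" using w P by (simp add: prod_pos)
      then show ?thesis by (simp add: root_powr_inverse)
    qed
    also have "\<dots> = root ?n (prod w Basis) / root ?n P" by (simp add: real_root_divide)
    finally show ?thesis using P by (simp add: field_simps sum_divide_distrib)
  qed
  have "root ?n (prod u Basis) + root ?n (prod v Basis)
      \<le> (\<Sum>j\<in>Basis. u j / (u j + v j)) / ?n * root ?n P + (\<Sum>j\<in>Basis. v j / (u j + v j)) / ?n * root ?n P"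
    using pos by (intro add_mono amgm) auto
  also have "\<dots> = (\<Sum>j\<in>Basis. u j / (u j + v j) + v j / (u j + v j)) / ?n * root ?n P"
    by (simp add: sum.distrib algebra_simps add_divide_distrib)
  also have "(\<Sum>j\<in>Basis. u j / (u j + v j) + v j / (u j + v j)) = (\<Sum>j\<in>(Basis::'a set). 1)"
  proof (rule sum.cong)
    fix j :: 'a assume "j \<in> Basis"
    then show "u j / (u j + v j) + v j / (u j + v j) = 1" using pos[of j] by (simp add: add_divide_distrib[symmetric])
  qed simp
  finally have "root ?n (prod u Basis) + root ?n (prod v Basis) \<le> root ?n P" by simp
  then have "(root ?n (prod u Basis) + root ?n (prod v Basis)) ^ ?n \<le> root ?n P ^ ?n"
    using pos by (intro power_mono add_nonneg_nonneg real_root_ge_zero prod_nonneg) (auto intro: less_imp_le)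
  then show ?thesis using P by (simp add: m P_def[symmetric])
qed

lemma msum_commute: "msum A B = msum B A"
  by (auto simp: add.commute)

lemma msum_mono: "A \<subseteq> A' \<Longrightarrow> B \<subseteq> B' \<Longrightarrow> msum A B \<subseteq> msum A' B'"
  by blast

text \<open>Sums of points from the lower parts have \<open>i\<close>-th coordinate below
  \<open>s + t\<close>, those from the upper parts above it, so the two partial sums are
  disjoint.\<close>

lemma measure_msum_cut:
  fixes A B :: "'a::euclidean_space set"
  assumes A: "open A" "bounded A" and B: "open B" "bounded B" and i: "i \<in> Basis"
  shows "measure lborel (msum (A \<inter> {x. x \<bullet> i < s}) (B \<inter> {x. x \<bullet> i < t}))
       + measure lborel (msum (A \<inter> {x. s < x \<bullet> i}) (B \<inter> {x. t < x \<bullet> i})) \<le> measure lborel (msum A B)"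
proof -
  let ?L = "msum (A \<inter> {x. x \<bullet> i < s}) (B \<inter> {x. x \<bullet> i < t})"
  let ?R = "msum (A \<inter> {x. s < x \<bullet> i}) (B \<inter> {x. t < x \<bullet> i})"
  have op: "open (A \<inter> {x. x \<bullet> i < s})" "open (A \<inter> {x. s < x \<bullet> i})"
    using A by (auto intro!: open_Int open_halfspace_component_lt open_halfspace_component_gt)
  have f: "?L \<in> fmeasurable lborel" "?R \<in> fmeasurable lborel" "msum A B \<in> fmeasurable lborel"
    using A B op by (intro open_bounded_fmeasurable open_sums bounded_sums bounded_Int; simp)+
  have "measure lborel ?L + measure lborel ?R = measure lborel (?L \<union> ?R)"
  proof (rule measure_Un_AE[symmetric])
    have "x \<notin> ?L" if "x \<in> ?R" for x
    proof -
      have "s + t < x \<bullet> i" using that by (force simp: inner_add_left)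
      then show ?thesis by (force simp: inner_add_left)
    qed
    then show "AE x in lborel. x \<notin> ?L \<or> x \<notin> ?R" by (intro AE_I2) blast
  qed (use f in auto)
  also have "\<dots> \<le> measure lborel (msum A B)"
    by (rule measure_mono_fmeasurable) (use f fmeasurable.Un[OF f(1,2)] in \<open>auto dest: fmeasurableD\<close>)
  finally show ?thesis .
qed

text \<open>Disjoint boxes have disjoint projections to some axis. The upper end of the lower
  projection serves as the cut; as the boxes are open, neither of them meets it.\<close>

lemma separate_boxes:
  fixes X Y :: "'a::euclidean_space set"
  assumes "X = box a b" "Y = box c d" "X \<noteq> {}" "Y \<noteq> {}" "X \<inter> Y = {}"
  obtains i t where "i \<in> Basis"
    "(X \<subseteq> {x. x \<bullet> i < t} \<and> Y \<subseteq> {x. t < x \<bullet> i}) \<or> (Y \<subseteq> {x. x \<bullet> i < t} \<and> X \<subseteq> {x. t < x \<bullet> i})"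
proof -
  obtain i where i: "i \<in> Basis" "b\<bullet>i \<le> c\<bullet>i \<or> d\<bullet>i \<le> a\<bullet>i"
  proof -
    have "\<forall>i\<in>Basis. a \<bullet> i < b \<bullet> i" "\<forall>i\<in>Basis. c \<bullet> i < d \<bullet> i"
      using assms box_ne_empty(2)[of a b] box_ne_empty(2)[of c d] by blast+
    moreover obtain i where "i \<in> Basis" "b\<bullet>i \<le> a\<bullet>i \<or> d\<bullet>i \<le> c\<bullet>i \<or> b\<bullet>i \<le> c\<bullet>i \<or> d\<bullet>i \<le> a\<bullet>i"
      using assms disjoint_interval(4)[of a b c d] by blast
    ultimately show ?thesis using that by (meson linorder_not_le)
  qed
  have le: "(box a b \<subseteq> {x. x \<bullet> i < t}) \<and> (box c d \<subseteq> {x. t < x \<bullet> i})" if "b \<bullet> i \<le> t" "t \<le> c \<bullet> i" for a b c d :: 'a and t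
  proof -
    have "x \<bullet> i < t" if "x \<in> box a b" for x using that i(1) \<open>b \<bullet> i \<le> t\<close> unfolding mem_box by fastforce
    moreover have "t < x \<bullet> i" if "x \<in> box c d" for x using that i(1) \<open>t \<le> c \<bullet> i\<close> unfolding mem_box by fastforce
    ultimately show ?thesis by blast
  qed
  from i(2) show ?thesis
  proof
    assume "b \<bullet> i \<le> c \<bullet> i"
    then show ?thesis using le[of b "b \<bullet> i" c a d] i(1) assms by (intro that[of i "b \<bullet> i"]) simp_all
  next
    assume "d \<bullet> i \<le> a \<bullet> i"
    then show ?thesis using le[of d "d \<bullet> i" a c b] i(1) assms by (intro that[of i "d \<bullet> i"]) simp_all
  qed
qed

text \<open>The Hadwiger-Ohmann induction: a hyperplane between two boxes of one family leaves fewer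
  of its boxes on each side, a parallel one cuts the other family in the same volume ratio, and
  owing to the equal ratios the two bounds from the induction add up without loss.\<close>

theorem brunn_minkowski_box_family:
  fixes F G :: "'a::euclidean_space set set"
  assumes "box_family F" "box_family G" "F \<noteq> {}" "G \<noteq> {}"
  shows "(root DIM('a) (measure lborel (\<Union>F)) + root DIM('a) (measure lborel (\<Union>G))) ^ DIM('a)
      \<le> measure lborel (msum (\<Union>F) (\<Union>G))"
  using assms
proof (induction "card F + card G" arbitrary: F G rule: less_induct)
  case less
  let ?n = "DIM('a)"
  define m :: "'a set \<Rightarrow> real" where "m = measure lborel"
  define r where "r = root ?n"
  have rp: "r x ^ ?n = x" if "0 \<le> x" for x using that by (simp add: r_def real_root_pow_pos2)
  \<comment> \<open>Stated for arbitrary \<open>F\<close> and \<open>G\<close>, so that it also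
    applies with the roles exchanged when \<open>G\<close> is the family to be split.\<close>
  have key: "(r (m (\<Union>F)) + r (m (\<Union>G))) ^ ?n \<le> m (msum (\<Union>F) (\<Union>G))"
    if IH: "\<And>F' G'. card F' + card G' < card F + card G \<Longrightarrow> box_family F' \<Longrightarrow> box_family G' \<Longrightarrow> F' \<noteq> {} \<Longrightarrow> G' \<noteq> {}
        \<Longrightarrow> (r (m (\<Union>F')) + r (m (\<Union>G'))) ^ ?n \<le> m (msum (\<Union>F') (\<Union>G'))"
    and F: "box_family F" and G: "box_family G" and ne: "F \<noteq> {}" "G \<noteq> {}" and two: "1 < card F" for F G :: "'a set set"
  proof -
    have "finite F" using F by (simp add: box_family_def)
    then obtain X Y where XY: "X \<in> F" "Y \<in> F" "X \<noteq> Y"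
      using two by (metis card_le_Suc0_iff_eq One_nat_def leD)
    have ex: "\<exists>a b. Z = box a b" "Z \<noteq> {}" if "Z \<in> F" for Z
      using F that unfolding box_family_def by blast+
    have disj: "X \<inter> Y = {}" using F XY unfolding box_family_def pairwise_def disjnt_def by blast
    from ex(1)[OF XY(1)] ex(1)[OF XY(2)] obtain a b c d where "X = box a b" "Y = box c d" by blast
    from separate_boxes[OF this ex(2)[OF XY(1)] ex(2)[OF XY(2)] disj]
    obtain i s where i: "i \<in> Basis" and
      "(X \<subseteq> {x. x \<bullet> i < s} \<and> Y \<subseteq> {x. s < x \<bullet> i}) \<or> (Y \<subseteq> {x. x \<bullet> i < s} \<and> X \<subseteq> {x. s < x \<bullet> i})" by metis
    then obtain X' Y' where X': "X' \<in> F" "X' \<subseteq> {x. x \<bullet> i < s}" and Y': "Y' \<in> F" "Y' \<subseteq> {x. s < x \<bullet> i}"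
      using XY by blast
    define L where "L = (\<lambda>t. {x::'a. x \<bullet> i < t})"
    define R where "R = (\<lambda>t. {x::'a. t < x \<bullet> i})"
    define cut where "cut = (\<lambda>F H. (\<lambda>X::'a set. X \<inter> H) ` F - {{}})"
    have Un_cut: "\<Union>(cut F H) = \<Union>F \<inter> H" for F H unfolding cut_def by auto
    have cutL: "box_family (cut F (L t))" "card (cut F (L t)) \<le> card F"
          "X \<in> F \<Longrightarrow> X \<inter> L t = {} \<Longrightarrow> card (cut F (L t)) < card F" if "box_family F" for F t X
      using box_family_cut[OF that i, of "L t" t] unfolding cut_def L_def by blast+
    have cutR: "box_family (cut F (R t))" "card (cut F (R t)) \<le> card F"
          "X \<in> F \<Longrightarrow> X \<inter> R t = {} \<Longrightarrow> card (cut F (R t)) < card F" if "box_family F" for F t X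
      using box_family_cut[OF that i, of "R t" t] unfolding cut_def R_def by blast+
    have split: "m (\<Union>F) = m (\<Union>F \<inter> L t) + m (\<Union>F \<inter> R t)" if "box_family F" for F t
      unfolding m_def L_def R_def
      using that by (intro measure_split_hyperplane box_family_open box_family_bounded i)
    have FL: "cut F (L s) \<noteq> {}" "card (cut F (L s)) < card F"
    proof -
      have "X' \<inter> L s \<in> cut F (L s)" using X' ex unfolding cut_def L_def by (auto simp: Int_absorb2)
      then show "cut F (L s) \<noteq> {}" by blast
      show "card (cut F (L s)) < card F" using Y' F by (intro cutL(3)[of F Y']) (auto simp: L_def)
    qed
    have FR: "cut F (R s) \<noteq> {}" "card (cut F (R s)) < card F"
    proof -
      have "Y' \<inter> R s \<in> cut F (R s)" using Y' ex unfolding cut_def R_def by (auto simp: Int_absorb2)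
      then show "cut F (R s) \<noteq> {}" by blast
      show "card (cut F (R s)) < card F" using X' F by (intro cutR(3)[of F X']) (auto simp: R_def)
    qed
    define u v where "u = m (\<Union>F \<inter> L s)" and "v = m (\<Union>F \<inter> R s)"
    have uv: "0 < u" "0 < v"
      unfolding u_def v_def m_def Un_cut[symmetric]
      using FL FR F by (auto intro!: box_family_measure_pos cutL cutR)
    have mF: "m (\<Union>F) = u + v" unfolding u_def v_def using split[OF F] .
    define w where "w = m (\<Union>G)"
    have w: "0 < w" unfolding w_def m_def by (rule box_family_measure_pos[OF G ne(2)])
    have "bounded (\<Union>G)" by (rule box_family_bounded[OF G])
    then obtain M where M: "\<And>x. x \<in> \<Union>G \<Longrightarrow> norm x \<le> M" unfolding bounded_iff by blast
    have Mi: "-M - 1 < x \<bullet> i" "x \<bullet> i < M + 1" if "x \<in> \<Union>G" for x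
      using M[OF that] Basis_le_norm[OF i, of x] by linarith+
    have e: "\<Union>G \<inter> L (-M - 1) = {}" "\<Union>G \<inter> L (M + 1) = \<Union>G"
      using Mi unfolding L_def by fastforce+
    \<comment> \<open>At \<open>- M - 1\<close> and \<open>M + 1\<close> the hyperplane has passed
      all of \<open>\<Union>G\<close> on one side or the other; the cut then has measure 0 or
      \<open>w\<close>.\<close>
    have "\<exists>t\<ge>-M - 1. t \<le> M + 1 \<and> m (\<Union>G \<inter> L t) = u / (u + v) * w"
    proof (rule IVT')
      show "m (\<Union>G \<inter> L (- M - 1)) \<le> u / (u + v) * w" using e uv w by (simp add: m_def)
      have "u / (u + v) * w \<le> 1 * w" using uv w by (intro mult_right_mono) auto
      then show "u / (u + v) * w \<le> m (\<Union>G \<inter> L (M + 1))" unfolding e by (simp add: w_def)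
      obtain Z where "Z \<in> G" using ne(2) by blast
      moreover from this obtain x where "x \<in> Z" using G unfolding box_family_def by blast
      ultimately have "x \<in> \<Union>G" by blast
      from Mi[OF this] show "- M - 1 \<le> M + 1" by linarith
      show "continuous_on {- M - 1..M + 1} (\<lambda>t. m (\<Union>G \<inter> L t))"
        unfolding m_def L_def by (rule continuous_on_subset[OF measure_box_family_cut_continuous[OF G i]]) simp
    qed
    then obtain t where GL: "m (\<Union>G \<inter> L t) = u / (u + v) * w" by blast
    have GR: "m (\<Union>G \<inter> R t) = v / (u + v) * w"
    proof -
      have "w = u / (u + v) * w + m (\<Union>G \<inter> R t)" using split[OF G, of t] GL by (simp add: w_def)
      moreover have "u / (u + v) + v / (u + v) = 1" using uv by (simp add: add_divide_distrib[symmetric])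
      then have "u / (u + v) * w + v / (u + v) * w = w" by (metis distrib_right mult_1)
      ultimately show ?thesis by linarith
    qed
    \<comment> \<open>The induction hypothesis demands nonempty families. This is where the positive
      measure of both parts is used.\<close>
    have neL: "cut G (L t) \<noteq> {}"
    proof
      assume "cut G (L t) = {}"
      then have "m (\<Union>G \<inter> L t) = 0" using Un_cut[of G "L t"] by (simp add: m_def)
      then show False using GL uv w by simp
    qed
    have neR: "cut G (R t) \<noteq> {}"
    proof
      assume "cut G (R t) = {}"
      then have "m (\<Union>G \<inter> R t) = 0" using Un_cut[of G "R t"] by (simp add: m_def)
      then show False using GR uv w by simp
    qed
    \<comment> \<open>Both parts and the whole have the same quotient of volumes. The bound for a
      part of volume \<open>x\<close> is therefore \<open>x * k ^ ?n\<close>, which is additive in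
      \<open>x\<close>.\<close>
    define k where "k = 1 + r (w / (u + v))"
    have scale: "(r x + r (x / (u + v) * w)) ^ ?n = x * k ^ ?n" if "0 < x" for x
    proof -
      have "r (x / (u + v) * w) = r x * r (w / (u + v))"
        unfolding r_def real_root_mult[symmetric] by (simp add: field_simps)
      then have "r x + r (x / (u + v) * w) = r x * k" by (simp add: k_def algebra_simps)
      then show ?thesis using that by (simp add: power_mult_distrib rp)
    qed
    have L: "u * k ^ ?n \<le> m (msum (\<Union>F \<inter> L s) (\<Union>G \<inter> L t))"
    proof -
      have "(r (m (\<Union>(cut F (L s)))) + r (m (\<Union>(cut G (L t))))) ^ ?n
           \<le> m (msum (\<Union>(cut F (L s))) (\<Union>(cut G (L t))))"
        using FL neL cutL(1)[OF F] cutL(1,2)[OF G] by (intro IH) (auto intro: add_less_le_mono)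
      then show ?thesis unfolding Un_cut GL using scale[OF uv(1)] by (simp add: u_def)
    qed
    have R: "v * k ^ ?n \<le> m (msum (\<Union>F \<inter> R s) (\<Union>G \<inter> R t))"
    proof -
      have "(r (m (\<Union>(cut F (R s)))) + r (m (\<Union>(cut G (R t))))) ^ ?n
           \<le> m (msum (\<Union>(cut F (R s))) (\<Union>(cut G (R t))))"
        using FR neR cutR(1)[OF F] cutR(1,2)[OF G] by (intro IH) (auto intro: add_less_le_mono)
      then show ?thesis unfolding Un_cut GR using scale[OF uv(2)] by (simp add: v_def)
    qed
    have "(r (u + v) + r ((u + v) / (u + v) * w)) ^ ?n = (u + v) * k ^ ?n"
      using uv by (intro scale) simp
    then have "(r (m (\<Union>F)) + r (m (\<Union>G))) ^ ?n = u * k ^ ?n + v * k ^ ?n"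
      using uv by (simp add: mF w_def[symmetric] algebra_simps)
    also have "\<dots> \<le> m (msum (\<Union>F \<inter> L s) (\<Union>G \<inter> L t)) + m (msum (\<Union>F \<inter> R s) (\<Union>G \<inter> R t))"
      using L R by linarith
    also have "\<dots> \<le> m (msum (\<Union>F) (\<Union>G))"
      unfolding m_def L_def R_def using F G
      by (intro measure_msum_cut box_family_open box_family_bounded i)
    finally show ?thesis .
  qed
  have IH: "(r (m (\<Union>F')) + r (m (\<Union>G'))) ^ ?n \<le> m (msum (\<Union>F') (\<Union>G'))"
    if "card F' + card G' < card F + card G" "box_family F'" "box_family G'" "F' \<noteq> {}" "G' \<noteq> {}" for F' G'
    unfolding r_def m_def using less.hyps[OF that] .
  have "0 < card F" "0 < card G"
    using less.prems by (auto simp: box_family_def card_gt_0_iff)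
  then consider "1 < card F" | "1 < card G" | "card F = 1" "card G = 1" by linarith
  then show ?case
  proof cases
    case 1
    from key[OF _ less.prems this] IH show ?thesis unfolding r_def m_def by blast
  next
    case 2
    have IH': "(r (m (\<Union>F')) + r (m (\<Union>G'))) ^ ?n \<le> m (msum (\<Union>F') (\<Union>G'))"
      if "card F' + card G' < card G + card F" "box_family F'" "box_family G'" "F' \<noteq> {}" "G' \<noteq> {}" for F' G'
      using IH[of F' G'] that by (simp add: add.commute)
    from key[OF IH' less.prems(2,1,4,3) 2] show ?thesis
      unfolding r_def m_def msum_commute[of "\<Union>G"] by (simp add: add.commute)
  next
    case 3
    then obtain X Y where FG: "F = {X}" "G = {Y}" by (metis card_1_singletonE)
    have "X \<noteq> {} \<and> (\<exists>a b. X = box a b)" "Y \<noteq> {} \<and> (\<exists>a b. Y = box a b)"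
      using less.prems(1,2) unfolding box_family_def FG by simp_all
    then obtain a b c d where XY: "X = box a b" "Y = box c d" "box a b \<noteq> {}" "box c d \<noteq> {}"
      by metis
    have "(root ?n (m X) + root ?n (m Y)) ^ ?n \<le> m (box (a + c) (b + d))"
      unfolding XY m_def by (rule brunn_minkowski_box) (use XY in auto)
    also have "\<dots> \<le> m (msum X Y)"
      unfolding m_def
    proof (rule measure_mono_fmeasurable)
      show "box (a + c) (b + d) \<subseteq> msum X Y" unfolding XY by (rule box_subset_msum) (use XY in auto)
      show "msum X Y \<in> fmeasurable lborel"
        unfolding XY by (intro open_bounded_fmeasurable open_sums bounded_sums disjI1 open_box bounded_box)
    qed simp
    finally show ?thesis by (simp add: FG m_def)
  qed
qed

section \<open>From families of boxes to open sets\<close>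

lemma open_box_family_approx:
  fixes S :: "'a::euclidean_space set"
  assumes S: "open S" and c: "c < emeasure lborel S"
  obtains F where "box_family F" "\<Union>F \<subseteq> S" "c < emeasure lborel (\<Union>F)"
proof -
  \<comment> \<open>Bounded pieces of \<open>S\<close>, since the covering lemma works inside a
    fixed box.\<close>
  define T where "T = (\<lambda>k::nat. S \<inter> box (- real k *\<^sub>R One) (real k *\<^sub>R One))"
  have "incseq T"
    unfolding incseq_def T_def
  proof (intro allI impI Int_mono order_refl)
    fix m n :: nat assume "m \<le> n"
    then show "box (- real m *\<^sub>R One) (real m *\<^sub>R One) \<subseteq> (box (- real n *\<^sub>R One) (real n *\<^sub>R One) :: 'a set)"
      by (intro subset_box_imp) auto
  qed
  moreover have "(\<Union>k. T k) = S"
  proof -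
    have "x \<in> (\<Union>k::nat. box (- (real k *\<^sub>R One)) (real k *\<^sub>R One))" for x :: 'a
      by (subst UN_box_eq_UNIV) simp
    then show ?thesis unfolding T_def by auto
  qed
  moreover have "range T \<subseteq> sets lborel" using S by (auto simp: T_def intro!: borel_open)
  ultimately have "(SUP k. emeasure lborel (T k)) = emeasure lborel S"
    using SUP_emeasure_incseq by metis
  then obtain k where k: "c < emeasure lborel (T k)" using c by (metis less_SUP_iff)
  have Tne: "T k \<noteq> {}" using k by auto
  have Top: "open (T k)" using S by (auto simp: T_def)
  obtain D where D: "countable D" "\<And>K. K \<in> D \<Longrightarrow> interior K \<noteq> {} \<and> (\<exists>c d. K = cbox c d)"
    "pairwise (\<lambda>A B. interior A \<inter> interior B = {}) D"
    "\<And>K. K \<in> D \<Longrightarrow> \<exists>x \<in> T k \<inter> K. K \<subseteq> (if x \<in> T k then T k else UNIV)" "T k \<subseteq> \<Union>D"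
  \<comment> \<open>With this gauge every cube, being attached to a point of \<open>T k\<close>, has
    to stay inside \<open>T k\<close>.\<close>
  proof (rule covering_lemma[of "T k" "- real k *\<^sub>R One" "real k *\<^sub>R One" "\<lambda>x. if x \<in> T k then T k else UNIV"])
    show "T k \<subseteq> cbox (- real k *\<^sub>R One) (real k *\<^sub>R One)" unfolding T_def using box_subset_cbox by blast
    show "box (- real k *\<^sub>R One) (real k *\<^sub>R One) \<noteq> ({}::'a set)" using Tne unfolding T_def by blast
    show "gauge (\<lambda>x. if x \<in> T k then T k else UNIV)" using Top by (auto simp: gauge_def)
  qed blast
  have DT: "K \<subseteq> T k" if "K \<in> D" for K using D(4)[OF that] by auto
  have Dne: "D \<noteq> {}" using D(5) Tne by auto
  define e where "e = (\<lambda>i. interior (from_nat_into D i))"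
  have e_in: "from_nat_into D i \<in> D" for i using Dne by (rule from_nat_into)
  define U where "U = (\<lambda>m. \<Union>i\<le>m. e i)"
  have Us: "range U \<subseteq> sets lborel" unfolding U_def e_def by (auto intro!: borel_open)
  have "incseq U" unfolding incseq_def U_def by force
  have null: "K - interior K \<in> null_sets lborel" if KD: "K \<in> D" for K
  proof -
    obtain c d where K: "K = cbox c d" using D(2)[OF KD] by blast
    have "emeasure lborel (cbox c d - box c d) = 0"
      using box_subset_cbox[of c d] by (subst emeasure_Diff) (auto simp: emeasure_lborel_box_eq emeasure_lborel_cbox_eq)
    then show ?thesis unfolding K interior_cbox by (intro null_setsI) auto
  qed
  \<comment> \<open>Passing from the cubes to their interiors loses only countably many
    boundaries.\<close>
  have "(\<Union>K\<in>D. K - interior K) \<in> null_sets lborel"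
    by (rule null_sets_UN') (use D(1) null in auto)
  moreover have "T k \<subseteq> (\<Union>m. U m) \<union> (\<Union>K\<in>D. K - interior K)"
  proof
    fix x assume "x \<in> T k"
    then obtain K where K: "K \<in> D" "x \<in> K" using D(5) by blast
    then obtain i where "K = from_nat_into D i" using D(1) by (metis from_nat_into_surj)
    then show "x \<in> (\<Union>m. U m) \<union> (\<Union>K\<in>D. K - interior K)" using K unfolding U_def e_def by blast
  qed
  ultimately have "emeasure lborel (T k) \<le> emeasure lborel (\<Union>m. U m)"
    using Us by (metis (no_types, lifting) emeasure_Un_null_set emeasure_mono null_setsD2 sets.Un sets.countable_UN)
  also have "\<dots> = (SUP m. emeasure lborel (U m))"
    using SUP_emeasure_incseq[OF Us \<open>incseq U\<close>] by simp
  finally obtain m where m: "c < emeasure lborel (U m)" using k by (metis less_SUP_iff order_less_le_trans)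
  define F where "F = e ` {..m}"
  have F: "\<Union>F = U m" by (simp add: F_def U_def)
  have "box_family F"
    unfolding box_family_def
  proof (intro conjI ballI)
    show "finite F" by (simp add: F_def)
    show "disjoint F"
    proof (rule pairwiseI)
      fix X Y assume "X \<in> F" "Y \<in> F" "X \<noteq> Y"
      moreover from this obtain i j where "X = e i" "Y = e j" by (auto simp: F_def)
      ultimately show "disjnt X Y"
        using pairwiseD[OF D(3) e_in[of i] e_in[of j]] unfolding e_def disjnt_def by metis
    qed
  next
    fix X assume "X \<in> F"
    then obtain i where X: "X = e i" by (auto simp: F_def)
    show "X \<noteq> {}" using D(2)[OF e_in[of i]] X by (simp add: e_def)
    obtain c d where "from_nat_into D i = cbox c d" using D(2)[OF e_in[of i]] by blast
    then show "\<exists>a b. X = box a b" unfolding X e_def by (metis interior_cbox)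
  qed
  moreover have "\<Union>F \<subseteq> S"
  proof -
    have "e i \<subseteq> T k" for i using DT[OF e_in[of i]] interior_subset[of "from_nat_into D i"] unfolding e_def by blast
    then show ?thesis unfolding F_def T_def by blast
  qed
  ultimately show ?thesis using that m F by simp
qed

theorem brunn_minkowski_open:
  fixes A B :: "'a::euclidean_space set"
  assumes A: "open A" "emeasure lborel A < \<infinity>" "emeasure lborel A \<noteq> 0"
    and B: "open B" "emeasure lborel B < \<infinity>" "emeasure lborel B \<noteq> 0"
  shows "ennreal ((root DIM('a) (measure lborel A) + root DIM('a) (measure lborel B)) ^ DIM('a))
      \<le> emeasure lborel (msum A B)"
proof (cases "emeasure lborel (msum A B) = \<infinity>")
  case False
  let ?n = "DIM('a)" and ?m = "measure (lborel :: 'a measure)"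
  have fin: "msum A B \<in> fmeasurable lborel"
    using False A by (auto simp: fmeasurable_def less_top intro!: borel_open open_sums)
  have pos: "0 < ?m A" "0 < ?m B" using A B by (auto simp: measure_def enn2real_positive_iff less_top zero_less_iff_neq_zero)
  have "(root ?n (?m A) + root ?n (?m B)) ^ ?n \<le> ?m (msum A B)"
  \<comment> \<open>Both measures are approximated up to a factor \<open>z < 1\<close>. The left
    side is homogeneous of degree 1 in the two measures, so it is merely multiplied by
    \<open>z\<close>.\<close>
  proof (rule field_le_mult_one_interval)
    fix z :: real assume z: "0 < z" "z < 1"
    have app: "\<exists>F. box_family F \<and> \<Union>F \<subseteq> S \<and> z * ?m S < ?m (\<Union>F)"
      if S: "open S" "emeasure lborel S < \<infinity>" "0 < ?m S" for S :: "'a set"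
    proof -
      have "ennreal (z * ?m S) < emeasure lborel S"
        using that z by (subst emeasure_eq_ennreal_measure) (auto intro!: ennreal_lessI)
      then obtain F where F: "box_family F" "\<Union>F \<subseteq> S" "ennreal (z * ?m S) < emeasure lborel (\<Union>F)"
        using open_box_family_approx[OF S(1)] by metis
      have "emeasure lborel (\<Union>F) = ennreal (?m (\<Union>F))"
        using F(1) by (intro emeasure_eq_measure2 open_bounded_fmeasurable box_family_open box_family_bounded)
      then have "z * ?m S < ?m (\<Union>F)" using F(3) z that by (simp add: ennreal_less_iff)
      then show ?thesis using F by blast
    qed
    obtain F where F: "box_family F" "\<Union>F \<subseteq> A" "z * ?m A < ?m (\<Union>F)" using app[of A] A pos by blast
    obtain G where G: "box_family G" "\<Union>G \<subseteq> B" "z * ?m B < ?m (\<Union>G)" using app[of B] B pos by blast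
    have zp: "0 < z * ?m A" "0 < z * ?m B" using z pos by auto
    have ne: "F \<noteq> {}" "G \<noteq> {}" using F(3) G(3) zp by auto
    have "z * (root ?n (?m A) + root ?n (?m B)) ^ ?n = (root ?n z * (root ?n (?m A) + root ?n (?m B))) ^ ?n"
      using z by (simp add: power_mult_distrib real_root_pow_pos2)
    also have "\<dots> = (root ?n (z * ?m A) + root ?n (z * ?m B)) ^ ?n"
      by (simp add: real_root_mult distrib_left)
    also have "\<dots> \<le> (root ?n (?m (\<Union>F)) + root ?n (?m (\<Union>G))) ^ ?n"
      using F G zp by (intro power_mono add_mono add_nonneg_nonneg) auto
    also have "\<dots> \<le> ?m (msum (\<Union>F) (\<Union>G))"
      by (rule brunn_minkowski_box_family) (use F G ne in auto)
    also have "\<dots> \<le> ?m (msum A B)"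
    proof (rule measure_mono_fmeasurable[OF msum_mono[OF F(2) G(2)] _ fin])
      show "msum (\<Union>F) (\<Union>G) \<in> sets lborel"
        using box_family_open[OF F(1)] open_sums[of "\<Union>F" "\<Union>G"] by (auto intro: borel_open)
    qed
    finally show "z * (root ?n (?m A) + root ?n (?m B)) ^ ?n \<le> ?m (msum A B)" .
  qed
  then show ?thesis using emeasure_eq_measure2[OF fin] by (simp add: ennreal_leI)
qed simp

text \<open>The binomial expansion up to first order in \<open>b\<close>. When \<open>b\<close> is
  proportional to the radius of the enlarging ball, its factor \<open>n\<close> becomes the one in
  \<open>iso_const\<close>.\<close>

lemma power_add_ge:
  fixes a b :: real assumes "0 \<le> a" "0 \<le> b" shows "a ^ n + real n * a ^ (n - 1) * b \<le> (a + b) ^ n"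
proof (induction n)
  case (Suc n)
  have "a ^ Suc n + real (Suc n) * a ^ n * b \<le> (a ^ n + real n * a ^ (n - 1) * b) * (a + b)"
  proof (cases n)
    case (Suc m)
    have "0 \<le> real (Suc m) * a ^ m * b * b" using assms by simp
    then show ?thesis by (simp add: Suc algebra_simps)
  qed (use assms in simp)
  also have "\<dots> \<le> (a + b) ^ n * (a + b)" using Suc assms by (intro mult_right_mono) auto
  finally show ?case by (simp add: mult.commute)
qed simp

text \<open>The sharp isoperimetric constant n omega^(1/n): the surface area of a ball divided by
  the power 1 - 1/n of its volume.\<close>

definition iso_const :: "'a::euclidean_space itself \<Rightarrow> real" where
  "iso_const _ = DIM('a) * measure lborel (ball (0::'a) 1) powr (1 / DIM('a))"

text \<open>Brunn-Minkowski with a ball of radius \<open>h\<close>, reduced to first order in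
  \<open>h\<close>. This is the isoperimetric inequality before any limit: no perimeter has to be
  defined, and the bound is valid for every \<open>h\<close>.\<close>

theorem emeasure_enlarge_ge:
  fixes A :: "'a::euclidean_space set"
  assumes A: "open A" "emeasure lborel A < \<infinity>" and h: "0 < h"
  shows "emeasure lborel A + ennreal (h * iso_const TYPE('a) * measure lborel A powr (1 - 1 / DIM('a)))
      \<le> emeasure lborel (msum A (ball 0 h))"
proof (cases "emeasure lborel A = 0")
  case True
  then show ?thesis by (simp add: measure_def)
next
  case False
  let ?n = "DIM('a)" and ?m = "measure (lborel :: 'a measure)"
  have pA: "0 < ?m A" using A False by (auto simp: measure_def enn2real_positive_iff less_top zero_less_iff_neq_zero)
  have b: "emeasure lborel (ball (0::'a) r) = ennreal (unit_ball_vol ?n * r ^ ?n)" if "0 < r" for r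
    using emeasure_ball[of r "0::'a"] that by simp
  have mb: "?m (ball 0 r) = unit_ball_vol ?n * r ^ ?n" if "0 < r" for r
    using b[OF that] that by (simp add: measure_def)
  define w where "w = ?m (ball (0::'a) 1)"
  have w: "0 < w" "?m (ball 0 h) = w * h ^ ?n" using mb[of 1] mb[OF h] by (auto simp: w_def)
  have rw: "root ?n (?m (ball 0 h)) = h * root ?n w"
    unfolding w(2) using h by (simp add: real_root_mult real_root_power_cancel mult.commute)
  have 1: "?m A = root ?n (?m A) ^ ?n" using pA by (simp add: real_root_pow_pos2)
  have 2: "?m A powr (1 - 1 / ?n) = root ?n (?m A) ^ (?n - 1)"
    using pA by (simp add: root_powr_inverse powr_realpow[symmetric] powr_powr of_nat_diff field_simps Suc_leI)
  have "?m A + h * iso_const TYPE('a) * ?m A powr (1 - 1 / ?n)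
     = root ?n (?m A) ^ ?n + real ?n * root ?n (?m A) ^ (?n - 1) * (h * root ?n w)"
    unfolding 2 iso_const_def w_def[symmetric] using 1 w(1) by (simp add: root_powr_inverse)
  also have "\<dots> \<le> (root ?n (?m A) + root ?n (?m (ball 0 h))) ^ ?n"
    unfolding rw by (rule power_add_ge) (use pA h w in auto)
  finally have "ennreal (?m A + h * iso_const TYPE('a) * ?m A powr (1 - 1 / ?n))
      \<le> ennreal ((root ?n (?m A) + root ?n (?m (ball 0 h))) ^ ?n)" by (rule ennreal_leI)
  also have "\<dots> \<le> emeasure lborel (msum A (ball 0 h))"
  proof (rule brunn_minkowski_open)
    have "0 < unit_ball_vol (real ?n)" by simp
    then show "emeasure lborel (ball (0::'a) h) \<noteq> 0" using h by (simp add: b zero_less_mult_iff del: unit_ball_vol_pos)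
    show "emeasure lborel (ball (0::'a) h) < \<infinity>" using h by (simp add: b)
  qed (use A False in auto)
  finally have "ennreal (?m A + h * iso_const TYPE('a) * ?m A powr (1 - 1 / ?n)) \<le> emeasure lborel (msum A (ball 0 h))" .
  moreover have "emeasure lborel A = ennreal (?m A)" using A by (intro emeasure_eq_ennreal_measure) auto
  ultimately show ?thesis using h by (simp add: ennreal_plus[symmetric] iso_const_def del: ennreal_plus)
qed

section \<open>Level sets of Lipschitz functions\<close>

lemma ennreal_le_of_all_eps:
  fixes b g :: real and L :: ennreal
  assumes "\<And>e. 0 < e \<Longrightarrow> L \<le> ennreal ((b + e) * (g + e))"
  shows "L \<le> ennreal (b * g)"
proof (rule LIMSEQ_le_const)
  have "(\<lambda>k. (b + 1 / real (Suc k)) * (g + 1 / real (Suc k))) \<longlonglongrightarrow> (b + 0) * (g + 0)"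
    by (intro tendsto_intros LIMSEQ_inverse_real_of_nat[unfolded inverse_eq_divide])
  then show "(\<lambda>k. ennreal ((b + 1 / real (Suc k)) * (g + 1 / real (Suc k)))) \<longlonglongrightarrow> ennreal (b * g)"
    by (intro tendsto_ennrealI) simp
  show "\<exists>N. \<forall>k\<ge>N. L \<le> ennreal ((b + 1 / real (Suc k)) * (g + 1 / real (Suc k)))"
    using assms by auto
qed

text \<open>Fubini on the region \<open>E h\<close> between the graph of |u| and that of its
  supremum over balls of radius \<open>h\<close>. The slice at level \<open>l\<close> is what the
  superlevel set gains by enlargement, hence at least \<open>h\<close> times the isoperimetric
  bound; the fibre over \<open>x\<close> has length at most \<open>h * norm (G x)\<close> up to
  o(h). Dividing by \<open>h\<close>, the reverse Fatou lemma concludes.\<close>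

theorem lipschitz_level_sets_le_gradient:
  fixes u :: "'a::euclidean_space \<Rightarrow> real" and G :: "'a \<Rightarrow> 'a" and \<phi> :: "real \<Rightarrow> real"
  assumes lip: "\<And>x y. \<bar>u x - u y\<bar> \<le> M * dist x y" and M: "0 < M"
    and der: "\<And>x. (u has_derivative (\<lambda>v. G x \<bullet> v)) (at x)"
    and G[measurable]: "G \<in> borel_measurable borel"
    and fin: "\<And>a. 0 < a \<Longrightarrow> emeasure lborel {x. a < \<bar>u x\<bar>} < \<infinity>"
    and \<phi>: "continuous_on UNIV \<phi>" "\<And>l. 0 \<le> \<phi> l" "\<And>l. \<phi> l \<le> 1" "\<And>l. l \<le> a \<Longrightarrow> \<phi> l = 0"
    and a: "0 < a"
  shows "(\<integral>\<^sup>+ l. ennreal (\<phi> l * (iso_const TYPE('a) * measure lborel {x. l < \<bar>u x\<bar>} powr (1 - 1 / DIM('a)))) \<partial>lborel)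
     \<le> (\<integral>\<^sup>+ x. ennreal (\<phi> \<bar>u x\<bar> * norm (G x)) \<partial>lborel)"
    (is "?I \<le> ?R")
proof -
  have ucont: "continuous_on UNIV u"
    using der by (meson continuous_at_imp_continuous_on has_derivative_continuous)
  have [measurable]: "u \<in> borel_measurable borel" using ucont by (rule borel_measurable_continuous_onI)
  have [measurable]: "\<phi> \<in> borel_measurable borel" using \<phi>(1) by (rule borel_measurable_continuous_onI)
  define A where "A = (\<lambda>l. {x. l < \<bar>u x\<bar>})"
  have Aop: "open (A l)" for l
    unfolding A_def by (intro open_Collect_less continuous_intros ucont)
  define E where "E = (\<lambda>h. {(x, l). \<bar>u x\<bar> \<le> l \<and> (\<exists>z\<in>ball x h. l < \<bar>u z\<bar>)})"
  have E[measurable]: "E h \<in> sets (borel \<Otimes>\<^sub>M borel)" for h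
  proof -
    \<comment> \<open>A closed set intersected with an open union: measurable, although the union
      over \<open>z\<close> is uncountable.\<close>
    have "E h = {p. \<bar>u (fst p)\<bar> \<le> snd p} \<inter> (\<Union>z. ball z h \<times> {..<\<bar>u z\<bar>})"
      unfolding E_def by (auto simp: dist_commute)
    moreover have "closed {p :: 'a \<times> real. \<bar>u (fst p)\<bar> \<le> snd p}"
      by (intro closed_Collect_le continuous_intros continuous_on_compose2[OF ucont]) auto
    moreover have "open (\<Union>z. ball z h \<times> {..<\<bar>u z\<bar>})"
      by (intro open_UN ballI open_Times open_ball open_lessThan)
    ultimately show ?thesis unfolding borel_prod by (simp add: borel_closed borel_open sets.Int)
  qed
  have Eslice: "{x. (x, l) \<in> E h} = msum (A l) (ball 0 h) - A l" for h l
  proof -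
    have "(\<exists>z\<in>ball x h. l < \<bar>u z\<bar>) \<longleftrightarrow> x \<in> msum (A l) (ball 0 h)" for x
    proof
      assume "\<exists>z\<in>ball x h. l < \<bar>u z\<bar>"
      then obtain z where "z \<in> ball x h" "l < \<bar>u z\<bar>" by blast
      then have "z \<in> A l" "x - z \<in> ball 0 h" "x = z + (x - z)" by (auto simp: A_def dist_norm norm_minus_commute)
      then show "x \<in> msum (A l) (ball 0 h)" by blast
    next
      assume "x \<in> msum (A l) (ball 0 h)"
      then show "\<exists>z\<in>ball x h. l < \<bar>u z\<bar>" by (auto simp: A_def dist_norm norm_minus_commute)
    qed
    then show ?thesis unfolding E_def A_def by (auto simp: not_less)
  qed
  define F where "F = (\<lambda>h x. (\<integral>\<^sup>+ l. ennreal (\<phi> l / h) * indicator (E h) (x, l) \<partial>lborel))"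
  have [measurable]: "F h \<in> borel_measurable borel" for h
    unfolding F_def by measurable
  have lower: "?I \<le> (\<integral>\<^sup>+ x. F h x \<partial>lborel)" if h: "0 < h" for h
  proof -
    have "(\<integral>\<^sup>+ x. F h x \<partial>lborel) = (\<integral>\<^sup>+ l. \<integral>\<^sup>+ x. ennreal (\<phi> l / h) * indicator (E h) (x, l) \<partial>lborel \<partial>lborel)"
      unfolding F_def by (rule lborel_pair.Fubini'[symmetric]) measurable
    also have "\<dots> = (\<integral>\<^sup>+ l. ennreal (\<phi> l / h) * emeasure lborel {x. (x, l) \<in> E h} \<partial>lborel)"
    proof (rule nn_integral_cong)
      fix l :: real
      have "{x. (x, l) \<in> E h} \<in> sets lborel"
        unfolding Eslice using Aop[of l] by (intro sets.Diff) (auto intro!: borel_open open_sums)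
      moreover have "indicator (E h) (x, l) = (indicator {x. (x, l) \<in> E h} x :: ennreal)" for x
        by (auto simp: indicator_def)
      ultimately show "(\<integral>\<^sup>+ x. ennreal (\<phi> l / h) * indicator (E h) (x, l) \<partial>lborel) = ennreal (\<phi> l / h) * emeasure lborel {x. (x, l) \<in> E h}"
        by (simp add: nn_integral_cmult_indicator)
    qed
    finally have eq: "(\<integral>\<^sup>+ x. F h x \<partial>lborel) = \<dots>" .
    show ?thesis unfolding eq
    proof (rule nn_integral_mono)
      fix l :: real
      show "ennreal (\<phi> l * (iso_const TYPE('a) * measure lborel {x. l < \<bar>u x\<bar>} powr (1 - 1 / DIM('a))))
          \<le> ennreal (\<phi> l / h) * emeasure lborel {x. (x, l) \<in> E h}"
      proof (cases "l \<le> a")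
        case False
        define K where "K = iso_const TYPE('a) * measure lborel (A l) powr (1 - 1 / DIM('a))"
        have K: "0 \<le> K" by (simp add: K_def iso_const_def)
        have Afin: "emeasure lborel (A l) < \<infinity>" using fin[of l] False a by (simp add: A_def)
        have sub: "A l \<subseteq> msum (A l) (ball 0 h)" using h by force
        have ms: "msum (A l) (ball 0 h) \<in> sets lborel" "A l \<in> sets lborel"
          using Aop[of l] by (auto intro!: borel_open open_sums)
        have "emeasure lborel (A l) + ennreal (h * K) \<le> emeasure lborel (msum (A l) (ball 0 h))"
          using emeasure_enlarge_ge[OF Aop Afin h] by (simp add: K_def mult.assoc)
        also have "\<dots> = emeasure lborel (A l \<union> (msum (A l) (ball 0 h) - A l))"
          using sub by (simp add: Un_absorb1)
        also have "\<dots> = emeasure lborel (A l) + emeasure lborel {x. (x, l) \<in> E h}"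
          unfolding Eslice by (rule plus_emeasure[symmetric]) (use ms in auto)
        finally have "ennreal (h * K) \<le> emeasure lborel {x. (x, l) \<in> E h}"
          using Afin by (auto simp: ennreal_add_left_cancel_le)
        then have "ennreal (\<phi> l / h) * ennreal (h * K) \<le> ennreal (\<phi> l / h) * emeasure lborel {x. (x, l) \<in> E h}"
          by (rule mult_left_mono) simp
        moreover have "ennreal (\<phi> l / h) * ennreal (h * K) = ennreal (\<phi> l * K)"
          using h K \<phi>(2)[of l] by (simp add: ennreal_mult''[symmetric])
        ultimately show ?thesis by (simp add: K_def A_def)
      qed (simp add: \<phi>(4))
    qed
  qed
  \<comment> \<open>One estimate for two uses: the crude slope \<open>s = M\<close> yields the
    dominating function, the slope \<open>s = norm (G x) + e\<close> the limit.\<close>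
  have upper: "F h x \<le> ennreal (b * s)"
    if h: "0 < h" and b: "0 \<le> b" "\<And>l. \<bar>u x\<bar> \<le> l \<Longrightarrow> l \<le> \<bar>u x\<bar> + h * s \<Longrightarrow> \<phi> l \<le> b"
      and s: "0 \<le> s" "\<And>z. z \<in> ball x h \<Longrightarrow> \<bar>u z\<bar> \<le> \<bar>u x\<bar> + h * s" for h x b s
  proof -
    have "F h x \<le> (\<integral>\<^sup>+ l. ennreal (b / h) * indicator {\<bar>u x\<bar>..\<bar>u x\<bar> + h * s} l \<partial>lborel)"
      unfolding F_def
    proof (rule nn_integral_mono)
      fix l :: real
      show "ennreal (\<phi> l / h) * indicator (E h) (x, l) \<le> ennreal (b / h) * indicator {\<bar>u x\<bar>..\<bar>u x\<bar> + h * s} l"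
      proof (cases "(x, l) \<in> E h")
        case True
        then obtain z where "\<bar>u x\<bar> \<le> l" "z \<in> ball x h" "l < \<bar>u z\<bar>" unfolding E_def by auto
        then have "\<bar>u x\<bar> \<le> l" "l \<le> \<bar>u x\<bar> + h * s" using s(2)[of z] by auto
        then show ?thesis using b(2)[of l] h True by (auto intro!: ennreal_leI divide_right_mono)
      qed simp
    qed
    also have "\<dots> = ennreal (b / h) * ennreal (h * s)"
      using h s by (subst nn_integral_cmult_indicator) auto
    also have "\<dots> = ennreal (b * s)" using h s b by (simp add: ennreal_mult''[symmetric])
    finally show ?thesis .
  qed
  have lip': "\<bar>u z\<bar> \<le> \<bar>u x\<bar> + h * M" if "z \<in> ball x h" for x z h
  proof -
    have "\<bar>u z - u x\<bar> \<le> M * h"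
      using lip[of z x] that M by (smt (verit) dist_commute mem_ball mult_left_mono)
    then show ?thesis by (simp add: mult.commute)
  qed
  \<comment> \<open>For radii up to \<open>\<delta>\<close> the function |u| grows by at most
    \<open>a / 2\<close>. So where |u x| is at most \<open>a / 2\<close> only levels up to
    \<open>a\<close> occur, and there \<open>\<phi>\<close> vanishes.\<close>
  define \<delta> where "\<delta> = a / (2 * M)"
  have \<delta>: "0 < \<delta>" using a M by (simp add: \<delta>_def)
  define hh where "hh = (\<lambda>k::nat. \<delta> / real (Suc k))"
  have hh: "0 < hh k" "hh k \<le> \<delta>" for k using \<delta> by (auto simp: hh_def divide_simps mult_le_cancel_left1)
  have hh0: "hh \<longlonglongrightarrow> 0"
    unfolding hh_def using tendsto_mult[OF tendsto_const[of \<delta>] LIMSEQ_inverse_real_of_nat] by (simp add: divide_inverse)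
  have dom: "F (hh k) x \<le> ennreal M * indicator (A (a / 2)) x" for k x
  proof (cases "a / 2 < \<bar>u x\<bar>")
    case True
    have "F (hh k) x \<le> ennreal (1 * M)"
      by (rule upper) (use hh \<phi> M lip' in auto)
    then show ?thesis using True by (simp add: A_def)
  next
    case False
    have "hh k * M \<le> a / 2" using hh(2)[of k] M by (simp add: \<delta>_def field_simps)
    then have "F (hh k) x \<le> ennreal (0 * M)"
      by (intro upper hh \<phi>(4)[THEN eq_refl]) (use False M lip' in auto)
    then show ?thesis by simp
  qed
  \<comment> \<open>On small balls differentiability gives the slope \<open>norm (G x) + e\<close>,
    and continuity of \<open>\<phi>\<close> gives \<open>\<phi> \<bar>u x\<bar> + e\<close> as a
    bound on the levels that are met.\<close>
  have lims: "limsup (\<lambda>k. F (hh k) x) \<le> ennreal (\<phi> \<bar>u x\<bar> * norm (G x))" for x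
  proof (rule ennreal_le_of_all_eps)
    fix e :: real assume e: "0 < e"
    define s where "s = norm (G x) + e"
    have s: "0 < s" using e by (simp add: s_def add_nonneg_pos)
    obtain d1 where d1: "0 < d1" "\<And>z. norm (z - x) < d1 \<Longrightarrow> norm (u z - u x - G x \<bullet> (z - x)) \<le> e * norm (z - x)"
      using der[of x] e unfolding has_derivative_at_alt by blast
    have "isCont \<phi> \<bar>u x\<bar>" using \<phi>(1) by (simp add: continuous_on_eq_continuous_at)
    then obtain d2 where d2: "0 < d2" "\<And>l. dist l \<bar>u x\<bar> < d2 \<Longrightarrow> dist (\<phi> l) (\<phi> \<bar>u x\<bar>) < e"
      using e unfolding continuous_at_eps_delta by blast
    have "eventually (\<lambda>k. hh k < min d1 (d2 / s)) sequentially"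
      using hh0 d1(1) d2(1) s by (intro order_tendstoD) auto
    then have "eventually (\<lambda>k. F (hh k) x \<le> ennreal ((\<phi> \<bar>u x\<bar> + e) * (norm (G x) + e))) sequentially"
    proof eventually_elim
      case (elim k)
      then have k: "hh k < d1" "hh k * s < d2" using s by (auto simp: pos_less_divide_eq)
      have "F (hh k) x \<le> ennreal ((\<phi> \<bar>u x\<bar> + e) * s)"
      proof (rule upper)
        show "0 \<le> \<phi> \<bar>u x\<bar> + e" using \<phi>(2)[of "\<bar>u x\<bar>"] e by simp
        fix l assume "\<bar>u x\<bar> \<le> l" "l \<le> \<bar>u x\<bar> + hh k * s"
        then have "dist l \<bar>u x\<bar> < d2" using k by (simp add: dist_real_def)
        from d2(2)[OF this] show "\<phi> l \<le> \<phi> \<bar>u x\<bar> + e" by (simp add: dist_real_def)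
      next
        fix z assume z: "z \<in> ball x (hh k)"
        then have nz: "norm (z - x) < hh k" by (simp add: dist_norm norm_minus_commute)
        have "\<bar>u z - u x\<bar> \<le> \<bar>G x \<bullet> (z - x)\<bar> + e * norm (z - x)"
          using d1(2)[of z] nz k by (auto simp: real_norm_def)
        also have "\<dots> \<le> norm (G x) * norm (z - x) + e * norm (z - x)"
          using Cauchy_Schwarz_ineq2[of "G x" "z - x"] by simp
        also have "\<dots> = s * norm (z - x)" by (simp add: s_def algebra_simps)
        also have "\<dots> \<le> s * hh k" using nz s by (intro mult_left_mono) auto
        finally show "\<bar>u z\<bar> \<le> \<bar>u x\<bar> + hh k * s" by (simp add: mult.commute)
      qed (use hh s in auto)
      then show ?case by (simp add: s_def)
    qed
    then show "limsup (\<lambda>k. F (hh k) x) \<le> ennreal ((\<phi> \<bar>u x\<bar> + e) * (norm (G x) + e))"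
      by (rule Limsup_bounded)
  qed
  have "?I \<le> limsup (\<lambda>k. \<integral>\<^sup>+ x. F (hh k) x \<partial>lborel)"
    by (rule le_Limsup) (auto intro!: always_eventually lower hh)
  \<comment> \<open>The vanishing of \<open>\<phi>\<close> up to \<open>a\<close> pays off here: the
    dominating function is carried by \<open>A (a / 2)\<close>, a set of finite measure.\<close>
  also have "\<dots> \<le> (\<integral>\<^sup>+ x. limsup (\<lambda>k. F (hh k) x) \<partial>lborel)"
  proof (rule nn_integral_limsup)
    show "(\<lambda>x. ennreal M * indicator (A (a / 2)) x) \<in> borel_measurable lborel"
      using Aop[of "a / 2"] by (auto intro!: borel_measurable_times_ennreal borel_measurable_indicator borel_open)
    have "(\<integral>\<^sup>+ x. ennreal M * indicator (A (a / 2)) x \<partial>lborel) = ennreal M * emeasure lborel (A (a / 2))"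
      using Aop[of "a / 2"] by (intro nn_integral_cmult_indicator) (auto intro: borel_open)
    also have "\<dots> < \<infinity>" using fin[of "a / 2"] a by (simp add: A_def ennreal_mult_less_top)
    finally show "(\<integral>\<^sup>+ x. ennreal M * indicator (A (a / 2)) x \<partial>lborel) < \<infinity>" .
  qed (use dom in auto)
  also have "\<dots> \<le> ?R" by (rule nn_integral_mono) (rule lims)
  finally show ?thesis .
qed

section \<open>Smooth kernels\<close>

lemma Ck_mono: "Ck (Suc k) f \<Longrightarrow> Ck k f"
proof (induction k arbitrary: f)
  case 0
  then show ?case by (auto intro: continuous_at_imp_continuous_on differentiable_imp_continuous_within)
qed auto

lemma partial_deriv_eqI:
  "(f has_derivative f') (at x) \<Longrightarrow> partial_deriv i f x = f' (axis i 1)"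
  unfolding partial_deriv_def using frechet_derivative_at by metis

lemma partial_deriv_add:
  "f differentiable (at x) \<Longrightarrow> g differentiable (at x) \<Longrightarrow>
   partial_deriv i (\<lambda>x. f x + g x) x = partial_deriv i f x + partial_deriv i g x"
  unfolding partial_deriv_def[of i f] partial_deriv_def[of i g]
  by (rule partial_deriv_eqI) (intro has_derivative_add; simp add: frechet_derivative_works[symmetric])

lemma partial_deriv_mult:
  "f differentiable (at x) \<Longrightarrow> g differentiable (at x) \<Longrightarrow>
   partial_deriv i (\<lambda>x. f x * g x) x = f x * partial_deriv i g x + partial_deriv i f x * g x"
  unfolding partial_deriv_def[of i f] partial_deriv_def[of i g]
  by (rule partial_deriv_eqI) (intro has_derivative_mult; simp add: frechet_derivative_works[symmetric])

lemma Ck_add: "Ck k f \<Longrightarrow> Ck k g \<Longrightarrow> Ck k (\<lambda>x. f x + g x)"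
proof (induction k arbitrary: f g)
  case (Suc k)
  have "partial_deriv i (\<lambda>x. f x + g x) = (\<lambda>x. partial_deriv i f x + partial_deriv i g x)" for i
    using Suc.prems by (intro ext partial_deriv_add) auto
  then show ?case using Suc by (auto intro: differentiable_add)
qed (auto intro: continuous_on_add)

lemma Ck_mult: "Ck k f \<Longrightarrow> Ck k g \<Longrightarrow> Ck k (\<lambda>x. f x * g x)"
proof (induction k arbitrary: f g)
  case (Suc k)
  have "partial_deriv i (\<lambda>x. f x * g x) = (\<lambda>x. f x * partial_deriv i g x + partial_deriv i f x * g x)" for i
    using Suc.prems by (intro ext partial_deriv_mult) auto
  moreover have "Ck k (\<lambda>x. f x * partial_deriv i g x + partial_deriv i f x * g x)" for i
    using Suc.prems Ck_mono[OF Suc.prems(1)] Ck_mono[OF Suc.prems(2)] by (intro Ck_add Suc.IH) auto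
  ultimately show ?case using Suc.prems by (auto intro: differentiable_mult)
qed (auto intro: continuous_on_mult)

lemma Ck_const: "Ck k (\<lambda>x. c)"
proof (induction k arbitrary: c)
  case (Suc k)
  have "partial_deriv i (\<lambda>x. c) = (\<lambda>x. 0)" for i :: 'a
    by (intro ext partial_deriv_eqI[OF has_derivative_const, THEN trans]) simp
  then show ?case using Suc by simp
qed simp

lemma Ck_coordinate: "Ck k (\<lambda>x. x $ j)"
proof (cases k)
  case (Suc m)
  have d: "((\<lambda>x. x $ j) has_derivative (\<lambda>x. x $ j)) (at x)" for x :: "real ^ 'a"
    by (intro bounded_linear_imp_has_derivative bounded_linear_vec_nth)
  have "partial_deriv i (\<lambda>x. x $ j) = (\<lambda>x. axis i 1 $ j)" for i
    by (intro ext partial_deriv_eqI[OF d])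
  then show ?thesis using d Ck_const[of m] unfolding Suc by (auto simp: differentiable_def)
qed (auto intro: continuous_intros)

lemma Ck_sum: "finite I \<Longrightarrow> (\<And>i. i \<in> I \<Longrightarrow> Ck k (f i)) \<Longrightarrow> Ck k (\<lambda>x. \<Sum>i\<in>I. f i x)"
  by (induction I rule: finite_induct) (auto intro: Ck_add Ck_const)

text \<open>The family is closed under differentiation, up to linear combinations.\<close>

definition bump :: "nat \<Rightarrow> real \<Rightarrow> real" where
  "bump m t = (if t \<le> 0 then 0 else exp (- 1 / t) / t ^ m)"

lemma bump_nonneg: "0 \<le> bump m t" and bump_pos: "0 < t \<Longrightarrow> 0 < bump m t" and bump_zero: "t \<le> 0 \<Longrightarrow> bump m t = 0"
  by (auto simp: bump_def)

text \<open>The term of degree \<open>m + 2\<close> in the series of \<open>exp (1 / t)\<close>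
  bounds \<open>exp (- 1 / t)\<close> by a multiple of \<open>t ^ (m + 2)\<close>. After division by
  \<open>t ^ m\<close> a square is left, enough for a vanishing derivative at 0.\<close>

lemma bump_le_square: "bump m t \<le> fact (m + 2) * t\<^sup>2"
proof (cases "t \<le> 0")
  case False
  define n where "n = m + 2"
  have "(\<Sum>k\<in>{n}. inverse (fact k) * (1 / t) ^ k) \<le> exp (1 / t)"
    unfolding exp_def using False sum_le_suminf[OF summable_exp[of "1 / t"], of "{n}"] by (simp add: divide_inverse mult.commute)
  then have "fact n * (inverse (fact n) * (1 / t) ^ n) \<le> fact n * exp (1 / t)" by (intro mult_left_mono) auto
  then have "(1 / t) ^ n \<le> fact n * exp (1 / t)" by (simp add: mult.assoc[symmetric] del: fact_Suc)
  then have "exp (- 1 / t) \<le> fact n * t ^ n"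
    using False by (simp add: exp_minus field_simps power_one_over)
  also have "\<dots> = fact n * t\<^sup>2 * t ^ m" by (simp add: n_def power_add power2_eq_square mult_ac)
  finally show ?thesis using False by (simp add: bump_def n_def pos_divide_le_eq del: fact_Suc)
qed (simp add: bump_def)

lemma bump_has_derivative:
  "(bump m has_real_derivative bump (m + 2) t - real m * bump (m + 1) t) (at t)"
proof -
  consider "t < 0" | "t = 0" | "0 < t" by linarith
  then show ?thesis
  proof cases
    case 1
    have "((\<lambda>t. 0) has_real_derivative bump (m + 2) t - real m * bump (m + 1) t) (at t)"
      using 1 by (simp add: bump_def)
    then show ?thesis
      by (rule has_field_derivative_transform_within_open[of _ _ _ "{..<0}"]) (use 1 in \<open>auto simp: bump_def\<close>)
  next
    case 2
    have "((\<lambda>h. (bump m (0 + h) - bump m 0) / h) \<longlongrightarrow> 0) (at 0)"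
    proof (rule Lim_null_comparison)
      show "\<forall>\<^sub>F h in at 0. norm ((bump m (0 + h) - bump m 0) / h) \<le> fact (m + 2) * \<bar>h\<bar>"
      proof (rule eventually_at_topological[THEN iffD2, OF exI[of _ UNIV]], safe)
        fix h :: real assume "h \<noteq> 0"
        have "\<bar>bump m h\<bar> \<le> fact (m + 2) * \<bar>h\<bar> * \<bar>h\<bar>"
          using bump_le_square[of m h] bump_nonneg[of m h] by (simp add: power2_eq_square mult.assoc abs_mult_self_eq)
        then show "norm ((bump m (0 + h) - bump m 0) / h) \<le> fact (m + 2) * \<bar>h\<bar>"
          using \<open>h \<noteq> 0\<close> by (simp add: bump_zero pos_divide_le_eq del: fact_Suc)
      qed auto
      show "((\<lambda>h. fact (m + 2) * \<bar>h\<bar>) \<longlongrightarrow> (0::real)) (at 0)"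
        by (intro tendsto_eq_intros) auto
    qed
    then show ?thesis by (simp add: 2 DERIV_def bump_zero)
  next
    case 3
    have "((\<lambda>t. exp (- 1 / t) / t ^ m) has_real_derivative bump (m + 2) t - real m * bump (m + 1) t) (at t)"
    proof (cases m)
      case 0
      then show ?thesis using 3 by (auto intro!: derivative_eq_intros simp: bump_def power2_eq_square)
    next
      case (Suc k)
      then show ?thesis using 3
        by (auto intro!: derivative_eq_intros simp: bump_def power2_eq_square divide_simps) (cases k; simp add: algebra_simps)
    qed
    then show ?thesis
      by (rule has_field_derivative_transform_within_open[of _ _ _ "{0<..}"]) (use 3 in \<open>auto simp: bump_def\<close>)
  qed
qed

text \<open>The induction treats all \<open>m\<close> at once, because differentiation raises
  \<open>m\<close> by 1 and by 2.\<close>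

lemma Ck_bump:
  assumes "\<And>k. Ck k \<rho>"
  shows "Ck k (\<lambda>x. bump m (\<rho> x))"
proof (induction k arbitrary: m)
  case 0
  have "continuous_on UNIV (bump m)"
    using bump_has_derivative by (meson DERIV_isCont continuous_at_imp_continuous_on)
  then show ?case using assms[of 0] by (auto intro: continuous_on_compose2)
next
  case (Suc k)
  have dr: "\<rho> differentiable (at x)" for x using assms[of 1] by simp
  have d: "((\<lambda>x. bump m (\<rho> x)) has_derivative
        (\<lambda>v. (bump (m + 2) (\<rho> x) - real m * bump (m + 1) (\<rho> x)) * frechet_derivative \<rho> (at x) v)) (at x)" for x
    using has_derivative_compose[OF dr[of x, unfolded frechet_derivative_works] bump_has_derivative[of m "\<rho> x", unfolded has_field_derivative_def]] .
  have "partial_deriv i (\<lambda>x. bump m (\<rho> x))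
      = (\<lambda>x. (bump (m + 2) (\<rho> x) + (- real m) * bump (m + 1) (\<rho> x)) * partial_deriv i \<rho> x)" for i
    using partial_deriv_eqI[OF d] by (auto simp: partial_deriv_def)
  moreover have "Ck k (\<lambda>x. (bump (m + 2) (\<rho> x) + (- real m) * bump (m + 1) (\<rho> x)) * partial_deriv i \<rho> x)" for i
    using assms[of "Suc k"] by (intro Ck_mult Ck_add Suc.IH Ck_const) auto
  ultimately show ?case using d by (auto simp: differentiable_def)
qed

text \<open>\<open>d\<close> bounds the radius of the support and \<open>\<kappa>'\<close> is the
  gradient. Smoothness of higher order is supplied separately by \<open>mollifier_exists\<close>; it
  serves to use the translates of the kernel as test functions in the definition of the weak
  gradient.\<close>

locale mollifier =
  fixes d :: real and \<kappa> :: "'a::euclidean_space \<Rightarrow> real" and \<kappa>' :: "'a \<Rightarrow> 'a"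
  assumes kernel_nonneg: "0 \<le> \<kappa> z"
    and kernel_zero: "d \<le> norm z \<Longrightarrow> \<kappa> z = 0"
    and kernel'_zero: "d \<le> norm z \<Longrightarrow> \<kappa>' z = 0"
    and kernel'_continuous: "continuous_on UNIV \<kappa>'"
    and kernel_derivative: "(\<kappa> has_derivative (\<lambda>v. \<kappa>' z \<bullet> v)) (at z)"
    and kernel_integral: "(\<integral>\<^sup>+ z. ennreal (\<kappa> z) \<partial>lborel) = 1"

lemma mollifier_exists:
  fixes d :: real
  assumes d: "0 < d"
  shows "\<exists>(\<kappa> :: real ^ 'n \<Rightarrow> real) \<kappa>'. mollifier d \<kappa> \<kappa>' \<and> (\<forall>x. test_function (\<lambda>y. \<kappa> (x - y)))"
proof -
  \<comment> \<open>A polynomial, positive exactly in the open ball of radius \<open>d\<close>; its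
    composition with \<open>bump 0\<close> is smooth and vanishes outside this ball.\<close>
  define \<rho> where "\<rho> = (\<lambda>z :: real ^ 'n. d\<^sup>2 - z \<bullet> z)"
  have bc: "continuous_on UNIV (bump m)" for m
    using bump_has_derivative by (meson DERIV_isCont continuous_at_imp_continuous_on)
  have rc: "continuous_on UNIV \<rho>" unfolding \<rho>_def by (intro continuous_intros)
  have c: "continuous_on UNIV (\<lambda>z. bump m (\<rho> z))" for m
    by (rule continuous_on_compose2[OF bc rc]) simp
  have rz: "\<rho> z \<le> 0 \<longleftrightarrow> d \<le> norm z" for z
    unfolding \<rho>_def power2_norm_eq_inner[symmetric] using d by (simp add: abs_le_square_iff[symmetric])
  define I where "I = (\<integral>\<^sup>+ z. ennreal (bump 0 (\<rho> z)) \<partial>lborel)"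
  have "I \<le> (\<integral>\<^sup>+ z. indicator (cball (0::real^'n) d) z \<partial>lborel)"
    unfolding I_def
  proof (rule nn_integral_mono)
    fix z :: "real ^ 'n"
    show "ennreal (bump 0 (\<rho> z)) \<le> indicator (cball 0 d) z"
      using rz[of z] by (cases "d \<le> norm z") (auto simp: bump_zero bump_def)
  qed
  also have "\<dots> < \<infinity>" using emeasure_lborel_cball_finite[of "0::real^'n" d] by simp
  finally have Ifin: "I < \<infinity>" .
  have "I \<noteq> 0"
  proof
    have m: "(\<lambda>z. ennreal (bump 0 (\<rho> z))) \<in> borel_measurable lborel"
      using borel_measurable_continuous_onI[OF c] by measurable
    assume "I = 0"
    then have "AE z in lborel. ennreal (bump 0 (\<rho> z)) = 0"
      unfolding I_def using nn_integral_0_iff_AE[OF m] by blast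
    then have "AE z :: real ^ 'n in lborel. z \<notin> ball 0 d"
    proof eventually_elim
      case (elim z)
      then have "bump 0 (\<rho> z) \<le> 0" by (simp only: ennreal_eq_0_iff)
      then have "\<rho> z \<le> 0" using bump_pos[of "\<rho> z" 0] by (meson not_le)
      then show ?case using rz[of z] by simp
    qed
    then have "emeasure lborel (ball (0::real^'n) d) = 0"
      by (subst (asm) AE_iff_measurable[of "ball 0 d"]) auto
    moreover have "0 < unit_ball_vol (real DIM(real^'n))" by simp
    ultimately show False using d emeasure_ball[of d "0::real^'n"] by simp
  qed
  define C where "C = enn2real I"
  have C: "0 < C" "I = ennreal C" using \<open>I \<noteq> 0\<close> Ifin
    by (auto simp: C_def enn2real_positive_iff less_top zero_less_iff_neq_zero)
  define \<kappa> where "\<kappa> = (\<lambda>z. bump 0 (\<rho> z) / C)"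
  \<comment> \<open>By \<open>bump_has_derivative\<close> with \<open>m = 0\<close> the derivative
    of \<open>bump 0\<close> is \<open>bump 2\<close>; the factor \<open>- 2\<close> and the vector
    \<open>z\<close> come from the gradient of \<open>\<rho>\<close>.\<close>
  define \<kappa>' where "\<kappa>' = (\<lambda>z. (- 2 * bump 2 (\<rho> z) / C) *\<^sub>R z)"
  have "mollifier d \<kappa> \<kappa>'"
  proof
    fix z :: "real ^ 'n"
    show "0 \<le> \<kappa> z" using C by (simp add: \<kappa>_def bump_nonneg)
    show "\<kappa> z = 0" if "d \<le> norm z" using that by (simp add: \<kappa>_def bump_zero rz)
    show "\<kappa>' z = 0" if "d \<le> norm z" using that by (simp add: \<kappa>'_def bump_zero rz)
    show "continuous_on UNIV \<kappa>'" unfolding \<kappa>'_def using C by (intro continuous_intros c) auto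
    have dr: "(\<rho> has_derivative (\<lambda>v. - 2 * (z \<bullet> v))) (at z)"
      unfolding \<rho>_def by (auto intro!: derivative_eq_intros simp: inner_commute)
    have "((\<lambda>z. bump 0 (\<rho> z)) has_derivative (\<lambda>v. bump 2 (\<rho> z) * (- 2 * (z \<bullet> v)))) (at z)"
      using has_derivative_compose[OF dr bump_has_derivative[of 0 "\<rho> z", unfolded has_field_derivative_def]] by (simp add: numeral_2_eq_2)
    then have "((\<lambda>z. bump 0 (\<rho> z) / C) has_derivative (\<lambda>v. bump 2 (\<rho> z) * (- 2 * (z \<bullet> v)) / C)) (at z)"
      by (rule bounded_linear.has_derivative[OF bounded_linear_divide])
    then show "(\<kappa> has_derivative (\<lambda>v. \<kappa>' z \<bullet> v)) (at z)"
      unfolding \<kappa>_def \<kappa>'_def by (simp add: algebra_simps)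
    have "(\<integral>\<^sup>+ z. ennreal (\<kappa> z) \<partial>lborel) = (\<integral>\<^sup>+ z. ennreal (bump 0 (\<rho> z)) / ennreal C \<partial>lborel)"
      unfolding \<kappa>_def using C by (intro nn_integral_cong) (simp add: divide_ennreal bump_nonneg)
    also have "\<dots> = I / ennreal C"
      unfolding I_def using borel_measurable_continuous_onI[OF c] by (intro nn_integral_divide) measurable
    finally show "(\<integral>\<^sup>+ z. ennreal (\<kappa> z) \<partial>lborel) = 1" using C by (simp add: divide_ennreal)
  qed
  moreover have "test_function (\<lambda>y. \<kappa> (x - y))" for x
  proof -
    \<comment> \<open>Sums and products only, to match \<open>Ck_add\<close>, \<open>Ck_sum\<close>
      and \<open>Ck_mult\<close>.\<close>
    have "\<rho> (x - y) = d\<^sup>2 + (\<Sum>j\<in>UNIV. (-1) * ((x $ j + (-1) * y $ j) * (x $ j + (-1) * y $ j)))" for y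
      by (simp add: \<rho>_def inner_vec_def sum_negf)
    moreover have "Ck k (\<lambda>y. d\<^sup>2 + (\<Sum>j\<in>UNIV. (-1) * ((x $ j + (-1) * y $ j) * (x $ j + (-1) * y $ j))))" for k
      by (intro Ck_add Ck_const Ck_sum Ck_mult Ck_coordinate) simp
    ultimately have "Ck k (\<lambda>y. \<rho> (x - y))" for k by presburger
    then have "Ck k (\<lambda>y. bump 0 (\<rho> (x - y)) * (1 / C))" for k by (intro Ck_mult Ck_const Ck_bump)
    then have "Ck k (\<lambda>y. \<kappa> (x - y))" for k by (simp add: \<kappa>_def)
    moreover have "{y. \<kappa> (x - y) \<noteq> 0} \<subseteq> cball x d"
    proof clarify
      fix y assume "\<kappa> (x - y) \<noteq> 0"
      then have "\<not> \<rho> (x - y) \<le> 0" by (auto simp: \<kappa>_def bump_zero)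
      then show "y \<in> cball x d" by (simp add: rz dist_norm)
    qed
    then have "bounded {y. \<kappa> (x - y) \<noteq> 0}" using bounded_cball bounded_subset by blast
    ultimately show ?thesis unfolding test_function_def by simp
  qed
  ultimately show ?thesis by blast
qed

section \<open>Mollification\<close>

text \<open>Convexity: the power function lies above its tangent at \<open>m\<close>. It is Young's
  inequality for \<open>x / m\<close> and 1.\<close>

lemma powr_ge_tangent:
  fixes x m p :: real
  assumes p: "1 \<le> p" and x: "0 \<le> x" and m: "0 < m"
  shows "p * m powr (p - 1) * x \<le> x powr p + (p - 1) * m powr p"
proof (cases "p = 1")
  case True
  then show ?thesis using x m by simp
next
  case False
  then have p1: "1 < p" using p by simp
  have y: "x / m \<le> (x / m) powr p / p + (p - 1) / p"
    using Youngs_inequality[of p "p / (p - 1)" "x / m" 1] p1 x m by (simp add: field_simps)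
  have "p * m powr p * (x / m) \<le> p * m powr p * ((x / m) powr p / p + (p - 1) / p)"
    by (rule mult_left_mono[OF y]) (use p1 in auto)
  also have "\<dots> = m powr p * (x / m) powr p + (p - 1) * m powr p"
    using p1 by (simp add: field_simps)
  also have "m powr p * (x / m) powr p = x powr p"
    using x m by (simp add: powr_divide)
  also have "p * m powr p * (x / m) = p * m powr (p - 1) * x"
    using m by (simp add: powr_diff)
  finally show ?thesis .
qed

text \<open>Jensen's inequality for a weight of total mass \<open>W\<close>, obtained by integrating
  the tangent inequality at the weighted mean \<open>I / W\<close>. It is applied to the kernel,
  with \<open>W = 1\<close>, and again as Hoelder's inequality in the Hardy estimate.\<close>

lemma jensen_ennpowr:
  fixes F w :: "'a \<Rightarrow> real"
  assumes [measurable]: "F \<in> borel_measurable M" "w \<in> borel_measurable M"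
    and F: "\<And>x. 0 \<le> F x" and w: "\<And>x. 0 \<le> w x" and p: "1 \<le> p"
    and W: "(\<integral>\<^sup>+ x. ennreal (w x) \<partial>M) = ennreal W" "0 \<le> W"
  shows "ennpowr (\<integral>\<^sup>+ x. ennreal (F x * w x) \<partial>M) p
     \<le> ennreal (W powr (p - 1)) * (\<integral>\<^sup>+ x. ennreal (F x powr p * w x) \<partial>M)"
    (is "ennpowr ?I p \<le> _ * ?J")
proof (cases "W = 0")
  case True
  then have "AE x in M. ennreal (w x) = 0" using W by (simp add: nn_integral_0_iff_AE)
  then have "AE x in M. ennreal (F x * w x) = 0"
    by eventually_elim (metis ennreal_eq_0_iff ennreal_0 mult_eq_0_iff order_antisym w)
  then have "?I = 0" by (simp add: nn_integral_0_iff_AE)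
  then show ?thesis by (simp add: ennpowr_def)
next
  case False
  then have Wp: "0 < W" using W by simp
  show ?thesis
  proof (cases "?J = \<infinity>")
    case True
    then show ?thesis using Wp by (simp add: ennreal_mult_eq_top_iff)
  next
    case False
    have tangent: "ennreal (p * m powr (p - 1)) * ?I \<le> ?J + ennreal ((p - 1) * m powr p * W)" if m: "0 < m" for m
    proof -
      have "ennreal (p * m powr (p - 1)) * ?I = (\<integral>\<^sup>+ x. ennreal (p * m powr (p - 1) * F x * w x) \<partial>M)"
        using p F w by (subst nn_integral_cmult[symmetric]) (auto simp: ennreal_mult''[symmetric] mult.assoc)
      also have "\<dots> \<le> (\<integral>\<^sup>+ x. ennreal (F x powr p * w x) + ennreal ((p - 1) * m powr p) * ennreal (w x) \<partial>M)"
      proof (rule nn_integral_mono)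
        fix x
        have "p * m powr (p - 1) * F x * w x \<le> (F x powr p + (p - 1) * m powr p) * w x"
          by (rule mult_right_mono[OF powr_ge_tangent]) (use p F w m in auto)
        then have "ennreal (p * m powr (p - 1) * F x * w x) \<le> ennreal (F x powr p * w x + ((p - 1) * m powr p) * w x)"
          by (intro ennreal_leI) (simp add: distrib_right)
        then show "ennreal (p * m powr (p - 1) * F x * w x) \<le> ennreal (F x powr p * w x) + ennreal ((p - 1) * m powr p) * ennreal (w x)"
          using p w[of x] by (simp add: ennreal_mult[symmetric] ennreal_plus)
      qed
      also have "\<dots> = ?J + ennreal ((p - 1) * m powr p) * ennreal W"
        by (subst nn_integral_add) (auto simp: nn_integral_cmult W(1))
      finally show ?thesis using p W by (simp add: ennreal_mult)
    qed
    \<comment> \<open>The tangent at 1 shows that the mean is finite, before it can serve as the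
      point of tangency.\<close>
    have fin: "?I < \<infinity>"
    proof -
      have "ennreal p * ?I < \<infinity>"
        using tangent[of 1] False by (simp add: less_top[symmetric]) (metis ennreal_add_eq_top ennreal_neq_top neq_top_trans)
      then show ?thesis using p by (auto simp: ennreal_mult_less_top)
    qed
    define I J where "I = enn2real ?I" and "J = enn2real ?J"
    have IJ: "?I = ennreal I" "?J = ennreal J" "0 \<le> I" "0 \<le> J"
      using fin False by (auto simp: I_def J_def less_top)
    have "I powr p \<le> W powr (p - 1) * J"
    proof (cases "I = 0")
      case True
      then show ?thesis using IJ by simp
    next
      case False
      define m where "m = I / W"
      have m: "0 < m" using False IJ Wp by (simp add: m_def)
      have "ennreal (p * m powr (p - 1) * I) \<le> ennreal (J + (p - 1) * m powr p * W)"
        using tangent[OF m] IJ p Wp unfolding IJ(1,2)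
        by (simp add: ennreal_mult''[symmetric] ennreal_plus[symmetric] del: ennreal_plus)
      then have le: "p * m powr (p - 1) * I \<le> J + (p - 1) * m powr p * W"
        using IJ p Wp by (subst (asm) ennreal_le_iff) auto
      have "m powr (p - 1) * I = m powr p * W"
        using m Wp False IJ(3) by (simp add: m_def powr_diff)
      then have "p * m powr (p - 1) * I = p * (m powr p * W)" by (simp add: mult.assoc)
      moreover have "(p - 1) * m powr p * W = p * (m powr p * W) - m powr p * W" by (simp add: algebra_simps)
      ultimately have "m powr p * W \<le> J" using le by linarith
      then have "W powr (p - 1) * (m powr p * W) \<le> W powr (p - 1) * J"
        by (rule mult_left_mono) simp
      moreover have "W powr (p - 1) * (m powr p * W) = I powr p"
        using Wp IJ(3) by (simp add: m_def powr_divide powr_diff)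
      ultimately show ?thesis by simp
    qed
    then show ?thesis using IJ unfolding IJ(1,2) by (simp add: ennpowr_def ennreal_mult''[symmetric] ennreal_leI)
  qed
qed

lemma lborel_reflect_translate:
  fixes f :: "'a::euclidean_space \<Rightarrow> ennreal" and g :: "'a \<Rightarrow> 'b::{banach,second_countable_topology}"
  shows "f \<in> borel_measurable borel \<Longrightarrow> (\<integral>\<^sup>+ y. f (x - y) \<partial>lborel) = (\<integral>\<^sup>+ y. f y \<partial>lborel)"
    and "f \<in> borel_measurable borel \<Longrightarrow> (\<integral>\<^sup>+ y. f (y - x) \<partial>lborel) = (\<integral>\<^sup>+ y. f y \<partial>lborel)"
    and "g \<in> borel_measurable borel \<Longrightarrow> (\<integral> y. g (x - y) \<partial>lborel) = (\<integral> y. g y \<partial>lborel)"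
proof -
  have 1: "(lborel :: 'a measure) = distr lborel borel (\<lambda>y. x - y)"
    using lborel_affine[of "-1" x] by (simp add: density_1)
  have 2: "(lborel :: 'a measure) = distr lborel borel (\<lambda>y. y - x)"
    using lborel_affine[of 1 "- x"] by (simp add: density_1)
  show "(\<integral>\<^sup>+ y. f (x - y) \<partial>lborel) = (\<integral>\<^sup>+ y. f y \<partial>lborel)" if [measurable]: "f \<in> borel_measurable borel"
    by (subst (2) 1) (simp add: nn_integral_distr)
  show "(\<integral>\<^sup>+ y. f (y - x) \<partial>lborel) = (\<integral>\<^sup>+ y. f y \<partial>lborel)" if [measurable]: "f \<in> borel_measurable borel"
    by (subst (2) 2) (simp add: nn_integral_distr)
  show "(\<integral> y. g (x - y) \<partial>lborel) = (\<integral> y. g y \<partial>lborel)" if [measurable]: "g \<in> borel_measurable borel"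
    by (subst (2) 1) (simp add: integral_distr)
qed

lemma le_one_plus_powr: fixes x p :: real assumes "1 \<le> p" "0 \<le> x" shows "x \<le> 1 + x powr p"
proof (cases "x \<le> 1")
  case False
  then have "x powr 1 \<le> x powr p" using assms by (intro powr_mono) auto
  then show ?thesis using False by simp
next
  case True
  then show ?thesis by (simp add: add_increasing2)
qed

text \<open>By |f| \<le> 1 + |f|^p the bound is the volume of the ball plus the integral of |f|^p.
  That it does not depend on the center makes mollified functions bounded and Lipschitz on the whole
  space.\<close>

lemma Lp_imp_uniformly_locally_integrable:
  fixes f :: "'a::euclidean_space \<Rightarrow> 'b::euclidean_space"
  assumes [measurable]: "f \<in> borel_measurable borel" and p: "1 \<le> p"
    and f: "(\<integral>\<^sup>+ x. ennreal (norm (f x) powr p) \<partial>lborel) < \<infinity>"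
  shows "\<exists>B\<ge>0. \<forall>x. (\<integral>\<^sup>+ y. ennreal (norm (f y)) * indicator (cball x r) y \<partial>lborel) \<le> ennreal B"
proof -
  define N where "N = (\<integral>\<^sup>+ x. ennreal (norm (f x) powr p) \<partial>lborel)"
  define V where "V = emeasure lborel (cball (0::'a) r)"
  have "V + N < \<infinity>" using f emeasure_lborel_cball_finite[of "0::'a" r] by (simp add: N_def V_def)
  then have e: "ennreal (enn2real (V + N)) = V + N" by (simp add: less_top)
  have "(\<integral>\<^sup>+ y. ennreal (norm (f y)) * indicator (cball x r) y \<partial>lborel) \<le> V + N" for x
  proof -
    have "(\<integral>\<^sup>+ y. ennreal (norm (f y)) * indicator (cball x r) y \<partial>lborel)
        \<le> (\<integral>\<^sup>+ y. indicator (cball x r) y + ennreal (norm (f y) powr p) \<partial>lborel)"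
    proof (rule nn_integral_mono)
      fix y
      have "ennreal (norm (f y)) \<le> ennreal (1 + norm (f y) powr p)"
        by (rule ennreal_leI[OF le_one_plus_powr]) (use p in auto)
      then show "ennreal (norm (f y)) * indicator (cball x r) y \<le> indicator (cball x r) y + ennreal (norm (f y) powr p)"
        by (auto split: split_indicator)
    qed
    also have "\<dots> = emeasure lborel (cball x r) + N"
      by (subst nn_integral_add) (auto simp: N_def intro!: borel_measurable_indicator)
    also have "emeasure lborel (cball x r) = V"
    proof -
      have "indicator (cball 0 r) (x - y) = (indicator (cball x r) y :: ennreal)" for y
        by (simp add: indicator_def dist_norm norm_minus_commute)
      then have "emeasure lborel (cball x r) = (\<integral>\<^sup>+ y. indicator (cball 0 r) (x - y) \<partial>lborel)"
        by simp
      also have "\<dots> = V" unfolding V_def using lborel_reflect_translate(1)[of "indicator (cball 0 r)" x, OF borel_measurable_indicator] by simp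
      finally show ?thesis .
    qed
    finally show ?thesis .
  qed
  then show ?thesis using e by (intro exI[of _ "enn2real (V + N)"]) simp
qed

text \<open>For integrals of \<open>f\<close> against a kernel that is bounded by \<open>C\<close>
  and lives near \<open>x\<close>: values, differences and linearization errors of mollified
  functions all have this form.\<close>

lemma integrable_dominated_local:
  fixes f :: "'a::euclidean_space \<Rightarrow> 'b::euclidean_space" and H :: "'a \<Rightarrow> 'c::euclidean_space"
  assumes [measurable]: "f \<in> borel_measurable borel" "H \<in> borel_measurable borel"
    and B: "(\<integral>\<^sup>+ y. ennreal (norm (f y)) * indicator (cball x r) y \<partial>lborel) \<le> ennreal B" "0 \<le> B"
    and H: "\<And>y. norm (H y) \<le> C * (norm (f y) * indicator (cball x r) y)" and C: "0 \<le> C"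
  shows "integrable lborel H" "norm (\<integral> y. H y \<partial>lborel) \<le> C * B"
proof -
  have [measurable]: "cball x r \<in> sets borel" by simp
  have "(\<integral>\<^sup>+ y. ennreal (norm (H y)) \<partial>lborel)
      \<le> (\<integral>\<^sup>+ y. ennreal C * (ennreal (norm (f y)) * indicator (cball x r) y) \<partial>lborel)"
  proof (rule nn_integral_mono)
    fix y
    have "ennreal (norm (H y)) \<le> ennreal (C * (norm (f y) * indicator (cball x r) y))"
      by (rule ennreal_leI[OF H])
    also have "\<dots> = ennreal C * (ennreal (norm (f y)) * indicator (cball x r) y)"
      using C by (simp add: ennreal_mult split: split_indicator)
    finally show "ennreal (norm (H y)) \<le> ennreal C * (ennreal (norm (f y)) * indicator (cball x r) y)" .
  qed
  also have "\<dots> = ennreal C * (\<integral>\<^sup>+ y. ennreal (norm (f y)) * indicator (cball x r) y \<partial>lborel)"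
    by (intro nn_integral_cmult) measurable
  also have "\<dots> \<le> ennreal C * ennreal B" by (intro mult_left_mono B) simp
  also have "\<dots> = ennreal (C * B)" using C B by (simp add: ennreal_mult)
  finally have le: "(\<integral>\<^sup>+ y. ennreal (norm (H y)) \<partial>lborel) \<le> ennreal (C * B)" .
  then have "(\<integral>\<^sup>+ y. ennreal (norm (H y)) \<partial>lborel) < \<infinity>" by (auto simp: less_top[symmetric] top_unique)
  then show i: "integrable lborel H" by (intro integrableI_bounded) auto
  have "ennreal (norm (\<integral> y. H y \<partial>lborel)) \<le> ennreal (C * B)"
    using integral_norm_bound_ennreal[OF i] le by (rule order_trans)
  then show "norm (\<integral> y. H y \<partial>lborel) \<le> C * B" using B C by (simp add: ennreal_le_iff)
qed

section \<open>Convolution with a mollifier\<close>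

definition mollify :: "('a::euclidean_space \<Rightarrow> real) \<Rightarrow> ('a \<Rightarrow> 'b::euclidean_space) \<Rightarrow> 'a \<Rightarrow> 'b" where
  "mollify \<kappa> f x = (\<integral> y. \<kappa> (x - y) *\<^sub>R f y \<partial>lborel)"

context mollifier
begin

lemma kernel_continuous: "continuous_on UNIV \<kappa>"
  using kernel_derivative by (meson continuous_at_imp_continuous_on has_derivative_continuous)

lemma kernel_measurable[measurable]: "\<kappa> \<in> borel_measurable borel"
  using kernel_continuous by (rule borel_measurable_continuous_onI)

lemma kernel'_measurable[measurable]: "\<kappa>' \<in> borel_measurable borel"
  using kernel'_continuous by (rule borel_measurable_continuous_onI)

lemma kernel'_uniformly_continuous:
  assumes e: "0 < e"
  shows "\<exists>\<delta>>0. \<delta> \<le> 1 \<and> (\<forall>z w. dist z w < \<delta> \<longrightarrow> norm (\<kappa>' z - \<kappa>' w) \<le> e)"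
proof -
  \<comment> \<open>Two points at distance below 1 either both lie in this ball or both have norm at
    least \<open>d\<close>, where \<open>\<kappa>'\<close> vanishes.\<close>
  have "uniformly_continuous_on (cball 0 (d + 2)) \<kappa>'"
    by (intro compact_uniformly_continuous continuous_on_subset[OF kernel'_continuous]) auto
  then obtain \<delta> where \<delta>: "0 < \<delta>" "\<And>z w. z \<in> cball 0 (d + 2) \<Longrightarrow> w \<in> cball 0 (d + 2) \<Longrightarrow> dist z w < \<delta> \<Longrightarrow> dist (\<kappa>' z) (\<kappa>' w) < e"
    using e unfolding uniformly_continuous_on_def by metis
  have "norm (\<kappa>' z - \<kappa>' w) \<le> e" if zw: "dist z w < min \<delta> 1" for z w
  proof (cases "z \<in> cball 0 (d + 2) \<and> w \<in> cball 0 (d + 2)")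
    case True
    then show ?thesis using \<delta>(2)[of z w] zw by (simp add: dist_norm)
  next
    case False
    have "norm z \<le> norm w + norm (z - w)" "norm w \<le> norm z + norm (z - w)"
      using norm_triangle_ineq[of w "z - w"] norm_triangle_ineq[of z "w - z"] by (auto simp: norm_minus_commute)
    then have "d \<le> norm z" "d \<le> norm w" using False zw by (auto simp: dist_norm)
    then show ?thesis using e by (simp add: kernel'_zero)
  qed
  then show ?thesis using \<delta>(1) by (intro exI[of _ "min \<delta> 1"]) auto
qed

lemma kernel_bounds: "\<exists>C>0. (\<forall>z. \<kappa> z \<le> C) \<and> (\<forall>z. norm (\<kappa>' z) \<le> C)"
proof -
  have b: "bounded (\<kappa> ` cball 0 d)" "bounded (\<kappa>' ` cball 0 d)"
    by (intro compact_imp_bounded compact_continuous_image compact_cball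
        continuous_on_subset[OF kernel_continuous] continuous_on_subset[OF kernel'_continuous] subset_UNIV)+
  obtain C1 where C1: "\<And>z. z \<in> cball 0 d \<Longrightarrow> norm (\<kappa> z) \<le> C1"
    using b(1) unfolding bounded_iff by blast
  obtain C2 where C2: "\<And>z. z \<in> cball 0 d \<Longrightarrow> norm (\<kappa>' z) \<le> C2"
    using b(2) unfolding bounded_iff by blast
  have "\<kappa> z \<le> max 1 (max C1 C2)" for z
    using C1[of z] kernel_zero[of z] by (cases "d \<le> norm z") auto
  moreover have "norm (\<kappa>' z) \<le> max 1 (max C1 C2)" for z
    using C2[of z] kernel'_zero[of z] by (cases "d \<le> norm z") auto
  ultimately show ?thesis by (intro exI[of _ "max 1 (max C1 C2)"]) auto
qed

lemma kernel_linearization: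
  assumes "\<And>w. dist w z < \<delta> \<Longrightarrow> norm (\<kappa>' w - \<kappa>' z) \<le> e" and v: "norm v < \<delta>" and e: "0 \<le> e"
  shows "\<bar>\<kappa> (z + v) - \<kappa> z - \<kappa>' z \<bullet> v\<bar> \<le> e * norm v"
proof -
  have "norm (\<kappa> (z + v) - \<kappa> z - \<kappa>' z \<bullet> (z + v - z)) \<le> norm (z + v - z) * e"
  proof (rule differentiable_bound_linearization[of z "z + v" "ball z \<delta>" \<kappa> "\<lambda>w v. \<kappa>' w \<bullet> v" z e])
    show "z + t *\<^sub>R (z + v - z) \<in> ball z \<delta>" if "t \<in> {0..1}" for t
    proof -
      have "norm (t *\<^sub>R v) \<le> 1 * norm v" unfolding norm_scaleR using that by (intro mult_right_mono) auto
      then show ?thesis using v by (simp add: dist_norm)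
    qed
    show "(\<kappa> has_derivative (\<bullet>) (\<kappa>' x)) (at x within ball z \<delta>)" for x
      using kernel_derivative by (rule has_derivative_at_withinI)
    fix x assume "x \<in> ball z \<delta>"
    then have *: "norm (\<kappa>' x - \<kappa>' z) \<le> e" using assms(1) by (simp add: dist_commute)
    show "onorm ((\<bullet>) (\<kappa>' x) - (\<bullet>) (\<kappa>' z)) \<le> e"
    proof (rule onorm_bound[OF e])
      fix v
      have "\<bar>(\<kappa>' x - \<kappa>' z) \<bullet> v\<bar> \<le> norm (\<kappa>' x - \<kappa>' z) * norm v" by (rule Cauchy_Schwarz_ineq2)
      also have "\<dots> \<le> e * norm v" using * by (rule mult_right_mono) simp
      finally show "norm (((\<bullet>) (\<kappa>' x) - (\<bullet>) (\<kappa>' z)) v) \<le> e * norm v"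
        by (simp add: inner_diff_left)
    qed
  next
    show "z \<in> ball z \<delta>" using v by (simp) (meson norm_ge_zero order_le_less_trans)
  qed
  then show ?thesis by (simp add: mult.commute)
qed

lemma kernel_lipschitz:
  assumes C: "\<And>z. norm (\<kappa>' z) \<le> C" shows "\<bar>\<kappa> z - \<kappa> w\<bar> \<le> C * norm (z - w)"
proof -
  have "norm (\<kappa> z - \<kappa> w) \<le> C * norm (z - w)"
  proof (rule differentiable_bound[of UNIV \<kappa> "\<lambda>w v. \<kappa>' w \<bullet> v" C])
    show "onorm ((\<bullet>) (\<kappa>' x)) \<le> C" for x
      using C[of x] order_trans[OF norm_ge_zero C[of x]]
      by (intro onorm_bound) (auto intro!: order_trans[OF Cauchy_Schwarz_ineq2] mult_right_mono)
  qed (use kernel_derivative in auto)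
  then show ?thesis by simp
qed

text \<open>The radius \<open>d + 1\<close> in place of \<open>d\<close> leaves room to move the
  center by up to 1, so that one ball serves \<open>x\<close> and a nearby point alike.\<close>

context
  fixes f :: "'a \<Rightarrow> 'b::euclidean_space" and B :: real
  assumes f[measurable]: "f \<in> borel_measurable borel"
    and B: "0 \<le> B" "\<And>x. (\<integral>\<^sup>+ y. ennreal (norm (f y)) * indicator (cball x (d + 1)) y \<partial>lborel) \<le> ennreal B"
begin

lemma mollify_integrable: "integrable lborel (\<lambda>y. \<kappa> (x - y) *\<^sub>R f y)"
  and mollify_bounded: "(\<And>z. \<kappa> z \<le> C) \<Longrightarrow> norm (mollify \<kappa> f x) \<le> C * B"
proof -
  obtain C0 where C0: "\<And>z. \<kappa> z \<le> C0" using kernel_bounds by blast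
  have bd: "norm (\<kappa> (x - y) *\<^sub>R f y) \<le> C * (norm (f y) * indicator (cball x (d + 1)) y)" if C: "\<And>z. \<kappa> z \<le> C" for C y
  proof (cases "d \<le> norm (x - y)")
    case True
    have "0 \<le> C" using C[of 0] kernel_nonneg[of 0] by linarith
    then show ?thesis using True by (simp add: kernel_zero)
  next
    case False
    then show ?thesis using C[of "x - y"] kernel_nonneg[of "x - y"] by (simp add: dist_norm mult_right_mono)
  qed
  have C: "0 \<le> C" if "\<And>z. \<kappa> z \<le> C" for C using that[of 0] kernel_nonneg[of 0] by linarith
  show "integrable lborel (\<lambda>y. \<kappa> (x - y) *\<^sub>R f y)"
    by (rule integrable_dominated_local(1)[OF f _ B(2) B(1) bd[OF C0] C[OF C0]]) measurable
  show "norm (mollify \<kappa> f x) \<le> C * B" if "\<And>z. \<kappa> z \<le> C"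
    unfolding mollify_def
    by (rule integrable_dominated_local(2)[OF f _ B(2) B(1) bd[OF that] C[OF that]]) measurable
qed

lemma mollify_lipschitz: "\<exists>M>0. \<forall>x y. norm (mollify \<kappa> f x - mollify \<kappa> f y) \<le> M * dist x y"
proof -
  obtain C where C: "0 < C" "\<And>z. \<kappa> z \<le> C" "\<And>z. norm (\<kappa>' z) \<le> C" using kernel_bounds by blast
  \<comment> \<open>\<open>C * B\<close> is the Lipschitz constant at distances up to 1, and
    \<open>2 * (C * B)\<close> bounds the difference of any two values, which suffices at larger
    distances; the summand 1 makes \<open>M\<close> positive.\<close>
  define M where "M = 2 * (C * B) + 1"
  have "0 \<le> C * B" using C B by simp
  then have M: "0 < M" "C * B \<le> M" "2 * (C * B) \<le> M" unfolding M_def by linarith+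
  have "norm (mollify \<kappa> f x - mollify \<kappa> f y) \<le> M * dist x y" for x y
  proof (cases "dist x y \<le> 1")
    case True
    have "mollify \<kappa> f x - mollify \<kappa> f y = (\<integral> z. (\<kappa> (x - z) - \<kappa> (y - z)) *\<^sub>R f z \<partial>lborel)"
      unfolding mollify_def by (simp add: scaleR_diff_left mollify_integrable)
    also have "norm \<dots> \<le> (C * dist x y) * B"
    proof (rule integrable_dominated_local(2)[OF f _ B(2) B(1)])
      fix z
      show "norm ((\<kappa> (x - z) - \<kappa> (y - z)) *\<^sub>R f z) \<le> C * dist x y * (norm (f z) * indicator (cball x (d + 1)) z)"
      proof (cases "z \<in> cball x (d + 1)")
        case True
        have "\<bar>\<kappa> (x - z) - \<kappa> (y - z)\<bar> \<le> C * dist x y"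
          using kernel_lipschitz[OF C(3), of "x - z" "y - z"] by (simp add: dist_norm)
        then show ?thesis using True by (simp add: mult_right_mono)
      next
        case False
        have "dist x z \<le> dist x y + dist y z" by (rule dist_triangle)
        then have "d \<le> norm (x - z)" "d \<le> norm (y - z)"
          using False \<open>dist x y \<le> 1\<close> by (auto simp: dist_norm)
        then show ?thesis using C by (simp add: kernel_zero)
      qed
    qed (use C in auto)
    also have "\<dots> = (C * B) * dist x y" by simp
    also have "\<dots> \<le> M * dist x y" using M by (intro mult_right_mono) auto
    finally show ?thesis .
  next
    case False
    have "norm (mollify \<kappa> f x - mollify \<kappa> f y) \<le> norm (mollify \<kappa> f x) + norm (mollify \<kappa> f y)"
      by (rule norm_triangle_ineq4)
    also have "\<dots> \<le> 2 * (C * B)" using mollify_bounded[OF C(2)] by (smt (verit))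
    also have "\<dots> \<le> M * 1" using M by simp
    also have "\<dots> \<le> M * dist x y" using M False by (intro mult_left_mono) auto
    finally show ?thesis .
  qed
  then show ?thesis using M by blast
qed

lemma mollify_measurable[measurable]: "mollify \<kappa> f \<in> borel_measurable borel"
proof -
  obtain M where M: "0 < M" "\<And>x y. norm (mollify \<kappa> f x - mollify \<kappa> f y) \<le> M * dist x y" using mollify_lipschitz by blast
  have "M-lipschitz_on UNIV (mollify \<kappa> f)"
    using M by (auto intro!: lipschitz_onI simp: dist_norm less_imp_le)
  then show ?thesis by (intro borel_measurable_continuous_onI lipschitz_on_continuous_on)
qed

text \<open>Jensen for the probability density \<open>\<kappa> (x - y)\<close>, then Fubini. The
  constant must be exactly 1: in \<open>sobolev_level_sets_le_gradient_continuous\<close> the norms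
  of the approximations may not exceed those of the limit.\<close>

lemma mollify_Lp_le:
  assumes p: "1 \<le> p"
  shows "(\<integral>\<^sup>+ x. ennreal (norm (mollify \<kappa> f x) powr p) \<partial>lborel) \<le> (\<integral>\<^sup>+ x. ennreal (norm (f x) powr p) \<partial>lborel)"
proof -
  have "(\<integral>\<^sup>+ x. ennreal (norm (mollify \<kappa> f x) powr p) \<partial>lborel)
     \<le> (\<integral>\<^sup>+ x. \<integral>\<^sup>+ y. ennreal (norm (f y) powr p * \<kappa> (x - y)) \<partial>lborel \<partial>lborel)"
  proof (rule nn_integral_mono)
    fix x
    let ?I = "\<integral>\<^sup>+ y. ennreal (norm (f y) * \<kappa> (x - y)) \<partial>lborel"
    have le: "ennreal (norm (mollify \<kappa> f x)) \<le> ?I"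
      unfolding mollify_def using integral_norm_bound_ennreal[OF mollify_integrable[of x]]
      by (simp add: kernel_nonneg mult.commute)
    have "ennreal (norm (mollify \<kappa> f x) powr p) \<le> ennpowr ?I p"
    proof (cases "?I = \<infinity>")
      case False
      then have "norm (mollify \<kappa> f x) \<le> enn2real ?I"
        using le by (metis enn2real_ennreal enn2real_mono infinity_ennreal_def less_top norm_ge_zero)
      then show ?thesis using False p by (simp add: ennpowr_def ennreal_leI powr_mono2)
    qed (simp add: ennpowr_def)
    also have "\<dots> \<le> ennreal (1 powr (p - 1)) * (\<integral>\<^sup>+ y. ennreal (norm (f y) powr p * \<kappa> (x - y)) \<partial>lborel)"
      by (rule jensen_ennpowr) (use p kernel_nonneg in \<open>auto simp: lborel_reflect_translate(1)[of "\<lambda>y. ennreal (\<kappa> y)" x] kernel_integral\<close>)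
    finally show "ennreal (norm (mollify \<kappa> f x) powr p) \<le> (\<integral>\<^sup>+ y. ennreal (norm (f y) powr p * \<kappa> (x - y)) \<partial>lborel)" by simp
  qed
  also have "\<dots> = (\<integral>\<^sup>+ y. \<integral>\<^sup>+ x. ennreal (norm (f y) powr p * \<kappa> (x - y)) \<partial>lborel \<partial>lborel)"
    by (rule lborel_pair.Fubini'[symmetric]) measurable
  also have "\<dots> = (\<integral>\<^sup>+ y. ennreal (norm (f y) powr p) \<partial>lborel)"
  proof (rule nn_integral_cong)
    fix y
    have "(\<integral>\<^sup>+ x. ennreal (norm (f y) powr p * \<kappa> (x - y)) \<partial>lborel) = ennreal (norm (f y) powr p) * (\<integral>\<^sup>+ x. ennreal (\<kappa> (x - y)) \<partial>lborel)"
      by (subst nn_integral_cmult[symmetric]) (auto simp: ennreal_mult kernel_nonneg)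
    also have "(\<integral>\<^sup>+ x. ennreal (\<kappa> (x - y)) \<partial>lborel) = 1"
      using lborel_reflect_translate(2)[of "\<lambda>y. ennreal (\<kappa> y)" y] by (simp add: kernel_integral)
    finally show "(\<integral>\<^sup>+ x. ennreal (norm (f y) powr p * \<kappa> (x - y)) \<partial>lborel) = ennreal (norm (f y) powr p)" by simp
  qed
  finally show ?thesis .
qed

end

end

context mollifier
begin

context
  fixes f :: "'a \<Rightarrow> real" and B :: real
  assumes f[measurable]: "f \<in> borel_measurable borel"
    and B: "0 \<le> B" "\<And>x. (\<integral>\<^sup>+ y. ennreal (norm (f y)) * indicator (cball x (d + 1)) y \<partial>lborel) \<le> ennreal B"
begin

lemma integrable_scaleR_kernel': "integrable lborel (\<lambda>y. f y *\<^sub>R \<kappa>' (x - y))"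
proof -
  obtain C where C: "0 < C" "\<And>z. norm (\<kappa>' z) \<le> C" using kernel_bounds by blast
  show ?thesis
  proof (rule integrable_dominated_local(1)[OF f _ B(2) B(1)])
    fix y
    show "norm (f y *\<^sub>R \<kappa>' (x - y)) \<le> C * (norm (f y) * indicator (cball x (d + 1)) y)"
    proof (cases "d \<le> norm (x - y)")
      case False
      then show ?thesis using mult_left_mono[OF C(2)[of "x - y"], of "\<bar>f y\<bar>"]
        by (simp add: dist_norm mult.commute)
    qed (use C in \<open>simp add: kernel'_zero\<close>)
  qed (use C in auto)
qed

lemma mollify_has_derivative:
  "(mollify \<kappa> f has_derivative (\<lambda>v. (\<integral> y. f y *\<^sub>R \<kappa>' (x - y) \<partial>lborel) \<bullet> v)) (at x)"
proof -
  define G where "G = (\<integral> y. f y *\<^sub>R \<kappa>' (x - y) \<partial>lborel)"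
  have "\<exists>\<delta>>0. \<forall>y. norm (y - x) < \<delta> \<longrightarrow> norm (mollify \<kappa> f y - mollify \<kappa> f x - G \<bullet> (y - x)) \<le> e * norm (y - x)"
    if e: "0 < e" for e
  proof -
    \<comment> \<open>The linearization error of the kernel is integrated against \<open>f\<close>
      over a ball, so \<open>e' * B\<close> has to stay below \<open>e\<close>; \<open>B + 1\<close>
      excludes a division by 0.\<close>
    define e' where "e' = e / (B + 1)"
    have e': "0 < e'" "e' * B \<le> e" using e B(1) by (auto simp: e'_def divide_simps)
    obtain \<delta> where \<delta>: "0 < \<delta>" "\<delta> \<le> 1" "\<And>z w. dist z w < \<delta> \<Longrightarrow> norm (\<kappa>' z - \<kappa>' w) \<le> e'"
      using kernel'_uniformly_continuous[OF e'(1)] by blast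
    have "norm (mollify \<kappa> f (x + v) - mollify \<kappa> f x - G \<bullet> v) \<le> e * norm v" if v: "norm v < \<delta>" for v
    proof -
      have "mollify \<kappa> f (x + v) - mollify \<kappa> f x - G \<bullet> v
          = (\<integral> y. (\<kappa> (x + v - y) - \<kappa> (x - y) - \<kappa>' (x - y) \<bullet> v) * f y \<partial>lborel)"
      proof -
        have "integrable lborel (\<lambda>y. (f y *\<^sub>R \<kappa>' (x - y)) \<bullet> v)"
          by (intro integrable_inner_left integrable_scaleR_kernel')
        moreover have "G \<bullet> v = (\<integral> y. (f y *\<^sub>R \<kappa>' (x - y)) \<bullet> v \<partial>lborel)"
          unfolding G_def by (intro integral_inner_left[symmetric] integrable_scaleR_kernel')
        ultimately show ?thesis
          using mollify_integrable[OF f B, of "x + v"] mollify_integrable[OF f B, of x]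
          unfolding mollify_def by (simp add: algebra_simps)
      qed
      also have "norm \<dots> \<le> (e' * norm v) * B"
      proof (rule integrable_dominated_local(2)[OF f _ B(2) B(1)])
        fix y
        show "norm ((\<kappa> (x + v - y) - \<kappa> (x - y) - \<kappa>' (x - y) \<bullet> v) * f y)
            \<le> e' * norm v * (norm (f y) * indicator (cball x (d + 1)) y)"
        proof (cases "y \<in> cball x (d + 1)")
          case True
          have "\<bar>\<kappa> (x - y + v) - \<kappa> (x - y) - \<kappa>' (x - y) \<bullet> v\<bar> \<le> e' * norm v"
            by (rule kernel_linearization[of "x - y" \<delta>]) (use \<delta> v e' in auto)
          moreover have "x - y + v = x + v - y" by simp
          ultimately have "\<bar>\<kappa> (x + v - y) - \<kappa> (x - y) - \<kappa>' (x - y) \<bullet> v\<bar> * \<bar>f y\<bar> \<le> e' * norm v * \<bar>f y\<bar>"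
            by (intro mult_right_mono) auto
          then show ?thesis using True by (simp add: abs_mult)
        next
          case False
          have "norm (x - y) \<le> norm (x + v - y) + norm v"
            using norm_triangle_ineq4[of "x + v - y" v] by (simp add: algebra_simps)
          then have "d \<le> norm (x - y)" "d \<le> norm (x + v - y)"
            using False v \<delta> by (auto simp: dist_norm)
          then show ?thesis using e' by (simp add: kernel_zero kernel'_zero)
        qed
      qed (use e' in auto)
      also have "\<dots> = (e' * B) * norm v" by simp
      also have "\<dots> \<le> e * norm v" using e' by (intro mult_right_mono) auto
      finally show ?thesis .
    qed
    from this[of "_ - x"] show ?thesis using \<delta>(1) by (intro exI[of _ \<delta>]) simp
  qed
  then show ?thesis
    unfolding has_derivative_at_alt G_def[symmetric] by (auto intro: bounded_linear_inner_right)
qed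

end

text \<open>Continuity of translations is available for integrable functions only, hence the
  truncation of \<open>f\<close> to the ball of radius \<open>R + 1\<close>. As
  \<open>d \<le> 1\<close>, the mollified function on the ball of radius \<open>R\<close> depends on
  no other values of \<open>f\<close>.\<close>

lemma mollify_minus_le:
  fixes f :: "'a \<Rightarrow> 'b::euclidean_space"
  assumes f[measurable]: "f \<in> borel_measurable borel" and d: "d \<le> 1"
    and B: "0 \<le> B" "\<And>x. (\<integral>\<^sup>+ y. ennreal (norm (f y)) * indicator (cball x (d + 1)) y \<partial>lborel) \<le> ennreal B"
    and e: "\<And>z. norm z < d \<Longrightarrow> (\<integral>\<^sup>+ x. ennreal (norm (indicator (ball 0 (R + 1)) (x - z) *\<^sub>R f (x - z)
              - indicator (ball 0 (R + 1)) x *\<^sub>R f x)) \<partial>lborel) \<le> e"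
  shows "(\<integral>\<^sup>+ x. ennreal (norm (mollify \<kappa> f x - f x)) * indicator (ball 0 R) x \<partial>lborel) \<le> e"
proof -
  define f1 where "f1 = (\<lambda>x. indicator (ball 0 (R + 1)) x *\<^sub>R f x)"
  have [measurable]: "ball (0::'a) r \<in> sets borel" for r by simp
  have f1[measurable]: "f1 \<in> borel_measurable borel" unfolding f1_def by measurable
  have ker1: "integrable lborel \<kappa>" "(\<integral> z. \<kappa> z \<partial>lborel) = 1"
  proof -
    show "integrable lborel \<kappa>" using kernel_integral by (intro integrableI_nonneg) (auto simp: kernel_nonneg)
    show "(\<integral> z. \<kappa> z \<partial>lborel) = 1" using kernel_integral by (simp add: integral_eq_nn_integral kernel_nonneg)
  qed
  have pt: "ennreal (norm (mollify \<kappa> f x - f x)) * indicator (ball 0 R) x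
      \<le> (\<integral>\<^sup>+ z. ennreal (\<kappa> z) * ennreal (norm (f1 (x - z) - f1 x)) \<partial>lborel)" for x
  proof (cases "x \<in> ball 0 R")
    case True
    have m: "mollify \<kappa> f x = (\<integral> z. \<kappa> z *\<^sub>R f (x - z) \<partial>lborel)"
      unfolding mollify_def using lborel_reflect_translate(3)[of "\<lambda>y. \<kappa> (x - y) *\<^sub>R f y" x] by simp
    have i: "integrable lborel (\<lambda>z. \<kappa> z *\<^sub>R f (x - z))"
    proof -
      have "integrable (distr lborel borel (\<lambda>y. x - y)) (\<lambda>y. \<kappa> (x - y) *\<^sub>R f y)"
        using mollify_integrable[OF f B, of x] lborel_affine[of "-1" x] by (simp add: density_1)
      then show ?thesis by (subst (asm) integrable_distr_eq) auto
    qed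
    have "mollify \<kappa> f x - f x = (\<integral> z. \<kappa> z *\<^sub>R f (x - z) - \<kappa> z *\<^sub>R f x \<partial>lborel)"
      using i ker1 by (subst Bochner_Integration.integral_diff) (auto simp: m)
    moreover have i2: "integrable lborel (\<lambda>z. \<kappa> z *\<^sub>R f (x - z) - \<kappa> z *\<^sub>R f x)"
      using i ker1 by auto
    ultimately have "ennreal (norm (mollify \<kappa> f x - f x)) \<le> (\<integral>\<^sup>+ z. ennreal (norm (\<kappa> z *\<^sub>R f (x - z) - \<kappa> z *\<^sub>R f x)) \<partial>lborel)"
      using integral_norm_bound_ennreal[OF i2] by simp
    also have "\<dots> = (\<integral>\<^sup>+ z. ennreal (\<kappa> z) * ennreal (norm (f1 (x - z) - f1 x)) \<partial>lborel)"
    proof (rule nn_integral_cong)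
      fix z
      show "ennreal (norm (\<kappa> z *\<^sub>R f (x - z) - \<kappa> z *\<^sub>R f x)) = ennreal (\<kappa> z) * ennreal (norm (f1 (x - z) - f1 x))"
      proof (cases "norm z < d")
        case z: True
        have "norm (x - z) \<le> norm x + norm z" by (rule norm_triangle_ineq4)
        then have "x - z \<in> ball 0 (R + 1)" "x \<in> ball 0 (R + 1)" using z d True by auto
        then show ?thesis
          by (simp add: f1_def scaleR_diff_right[symmetric] kernel_nonneg ennreal_mult del: scaleR_diff_right)
      qed (simp add: kernel_zero)
    qed
    finally show ?thesis using True by simp
  qed simp
  have "(\<integral>\<^sup>+ x. ennreal (norm (mollify \<kappa> f x - f x)) * indicator (ball 0 R) x \<partial>lborel)
     \<le> (\<integral>\<^sup>+ x. \<integral>\<^sup>+ z. ennreal (\<kappa> z) * ennreal (norm (f1 (x - z) - f1 x)) \<partial>lborel \<partial>lborel)"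
    by (rule nn_integral_mono) (rule pt)
  also have "\<dots> = (\<integral>\<^sup>+ z. \<integral>\<^sup>+ x. ennreal (\<kappa> z) * ennreal (norm (f1 (x - z) - f1 x)) \<partial>lborel \<partial>lborel)"
    by (rule lborel_pair.Fubini'[symmetric]) measurable
  also have "\<dots> \<le> (\<integral>\<^sup>+ z. ennreal (\<kappa> z) * e \<partial>lborel)"
  proof (rule nn_integral_mono)
    fix z
    show "(\<integral>\<^sup>+ x. ennreal (\<kappa> z) * ennreal (norm (f1 (x - z) - f1 x)) \<partial>lborel) \<le> ennreal (\<kappa> z) * e"
    proof (cases "norm z < d")
      case True
      have "(\<integral>\<^sup>+ x. ennreal (norm (f1 (x - z) - f1 x)) \<partial>lborel) \<le> e"
        using e[OF True] by (simp only: f1_def)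
      then show ?thesis by (subst nn_integral_cmult) (auto intro: mult_left_mono)
    qed (simp add: kernel_zero)
  qed
  also have "\<dots> = e" by (subst nn_integral_multc) (auto simp: kernel_integral)
  finally show ?thesis .
qed

end

lemma partial_deriv_mollifier:
  fixes \<kappa> :: "real ^ 'n \<Rightarrow> real"
  assumes "mollifier d \<kappa> \<kappa>'"
  shows "partial_deriv i (\<lambda>y. \<kappa> (x - y)) y = - \<kappa>' (x - y) $ i"
proof -
  have "((\<lambda>y. x - y) has_derivative (\<lambda>v. - v)) (at y)" by (auto intro!: derivative_eq_intros)
  from has_derivative_compose[OF this mollifier.kernel_derivative[OF assms]]
  have "((\<lambda>y. \<kappa> (x - y)) has_derivative (\<lambda>v. \<kappa>' (x - y) \<bullet> (- v))) (at y)" .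
  from partial_deriv_eqI[OF this, of i] show ?thesis by (simp add: inner_axis)
qed

text \<open>The weak gradient is tested with \<open>\<kappa> (x - y)\<close> as a function of
  \<open>y\<close>. Differentiation in \<open>y\<close> instead of \<open>x\<close> reverses the
  sign, and this cancels the sign in the definition of the weak gradient.\<close>

lemma mollify_gradient:
  fixes f :: "real ^ 'n \<Rightarrow> real" and g :: "real ^ 'n \<Rightarrow> real ^ 'n"
  assumes \<kappa>: "mollifier d \<kappa> \<kappa>'" and test: "test_function (\<lambda>y. \<kappa> (x - y))"
    and f: "f \<in> borel_measurable borel" and g: "g \<in> borel_measurable borel" and B: "0 \<le> B"
    and Bf: "\<And>x. (\<integral>\<^sup>+ y. ennreal (norm (f y)) * indicator (cball x (d + 1)) y \<partial>lborel) \<le> ennreal B"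
    and Bg: "\<And>x. (\<integral>\<^sup>+ y. ennreal (norm (g y)) * indicator (cball x (d + 1)) y \<partial>lborel) \<le> ennreal B"
    and weak: "\<And>\<phi> i. test_function \<phi> \<Longrightarrow>
        (\<integral> x. f x * partial_deriv i \<phi> x \<partial>lborel) = - (\<integral> x. g x $ i * \<phi> x \<partial>lborel)"
  shows "(mollify \<kappa> f has_derivative (\<lambda>v. mollify \<kappa> g x \<bullet> v)) (at x)"
proof -
  interpret mollifier d \<kappa> \<kappa>' by (rule \<kappa>)
  have "(\<integral> y. f y *\<^sub>R \<kappa>' (x - y) \<partial>lborel) $ i = mollify \<kappa> g x $ i" for i
  proof -
    have "(\<integral> y. f y *\<^sub>R \<kappa>' (x - y) \<partial>lborel) $ i = (\<integral> y. (f y *\<^sub>R \<kappa>' (x - y)) $ i \<partial>lborel)"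
      by (rule integral_bounded_linear[OF bounded_linear_vec_nth integrable_scaleR_kernel'[OF f B Bf], symmetric])
    also have "\<dots> = - (\<integral> y. f y * partial_deriv i (\<lambda>y. \<kappa> (x - y)) y \<partial>lborel)"
      by (simp add: partial_deriv_mollifier[OF \<kappa>])
    also have "\<dots> = (\<integral> y. g y $ i * \<kappa> (x - y) \<partial>lborel)" by (simp add: weak[OF test])
    also have "\<dots> = (\<integral> y. (\<kappa> (x - y) *\<^sub>R g y) $ i \<partial>lborel)" by (simp add: mult.commute)
    also have "\<dots> = mollify \<kappa> g x $ i"
      unfolding mollify_def
      by (rule integral_bounded_linear[OF bounded_linear_vec_nth mollify_integrable[OF g B Bg]])
    finally show ?thesis .
  qed
  then have "(\<integral> y. f y *\<^sub>R \<kappa>' (x - y) \<partial>lborel) = mollify \<kappa> g x" by (simp add: vec_eq_iff)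
  then show ?thesis using mollify_has_derivative[OF f B Bf, of x] by simp
qed

section \<open>Continuity of translations in L1\<close>

lemma L1_translation_continuous:
  fixes f :: "'a::euclidean_space \<Rightarrow> 'b::euclidean_space"
  assumes "integrable lborel f"
  shows "\<forall>e>0. \<exists>\<delta>>0. \<forall>z. norm z < \<delta> \<longrightarrow> (\<integral>\<^sup>+ x. ennreal (norm (f (x - z) - f x)) \<partial>lborel) \<le> ennreal e"
  using assms
proof (induction rule: integrable_induct)
  case (base A c)
  have A[measurable]: "A \<in> sets borel" using base by simp
  show ?case
  proof (intro allI impI)
    fix e :: real assume e: "0 < e"
    \<comment> \<open>\<open>U - K\<close> below has measure at most \<open>2 * e1\<close> and
      enters twice, at \<open>x\<close> and at \<open>x - z\<close>, each time with the factor
      \<open>norm c\<close>; the summand 1 covers \<open>c = 0\<close>.\<close>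
    define e1 where "e1 = e / (4 * (norm c + 1))"
    have "0 < norm c + 1" by (simp add: add_nonneg_pos)
    then have e1: "0 < e1" "4 * e1 * norm c \<le> e" using e by (auto simp: e1_def field_simps)
    obtain U where U: "open U" "A \<subseteq> U" "emeasure lborel (U - A) < ennreal e1"
      using outer_regular_lborel[OF A e1(1)] by blast
    have "\<exists>K. compact K \<and> K \<subseteq> A \<and> emeasure lborel (A - K) < ennreal e1"
    proof -
      \<comment> \<open>Lebesgue measure restricted to \<open>A\<close> is finite, as inner
        regularity requires.\<close>
      define N where "N = density lborel (indicator A :: 'a \<Rightarrow> ennreal)"
      have N: "emeasure N B = emeasure lborel (A \<inter> B)" if B: "B \<in> sets borel" for B
      proof -
        have "emeasure N B = (\<integral>\<^sup>+ x. indicator (A \<inter> B) x \<partial>lborel)"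
          unfolding N_def using A B by (simp add: emeasure_density indicator_inter_arith)
        then show ?thesis using A B by simp
      qed
      have eq: "emeasure N A = (SUP K\<in>{K. K \<subseteq> A \<and> compact K}. emeasure N K)"
      proof (rule inner_regular)
        show "sets N = sets borel" by (simp add: N_def)
        show "emeasure N (space N) \<noteq> \<infinity>" using N[of UNIV] base(2) by (simp add: N_def)
      qed (rule A)
      have ne: "{K. K \<subseteq> A \<and> compact K} \<noteq> {}" by (auto intro: exI[of _ "{}"])
      have fin: "emeasure N A \<noteq> \<infinity>" using N[OF A] base(2) by simp
      from SUP_approx_ennreal[OF e1(1) ne eq fin]
      obtain K where K: "K \<subseteq> A" "compact K" "emeasure N A < emeasure N K + ennreal e1" by blast
      have Kb: "K \<in> sets borel" using K(2) by (simp add: compact_imp_closed)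
      have "emeasure lborel A = emeasure lborel K + emeasure lborel (A - K)"
        using plus_emeasure[of K lborel "A - K"] Kb K(1) A by (simp add: Un_absorb1)
      then have "emeasure lborel K + emeasure lborel (A - K) < emeasure lborel K + ennreal e1"
        using K(3) N[OF A] N[OF Kb] K(1) by (simp add: Int_absorb1)
      then have "emeasure lborel (A - K) < ennreal e1" by (meson add_left_mono not_le)
      then show ?thesis using K by blast
    qed
    then obtain K where K: "compact K" "K \<subseteq> A" "emeasure lborel (A - K) < ennreal e1" by blast
    show "\<exists>\<delta>>0. \<forall>z. norm z < \<delta> \<longrightarrow>
       (\<integral>\<^sup>+ x. ennreal (norm (indicator A (x - z) *\<^sub>R c - indicator A x *\<^sub>R c)) \<partial>lborel) \<le> ennreal e"
    proof -
      obtain \<delta> where \<delta>: "0 < \<delta>" "(\<Union>x\<in>K. ball x \<delta>) \<subseteq> U"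
        using compact_subset_open_imp_ball_epsilon_subset[OF K(1) U(1)] K(2) U(2) by blast
      have KU: "y \<in> U" if "x \<in> K" "norm (x - y) < \<delta>" for x y
        using \<delta>(2) that by (force simp: dist_norm)
      have [measurable]: "U \<in> sets borel" "K \<in> sets borel" using U K by (auto simp: compact_imp_closed)
      have "emeasure lborel (U - K) \<le> emeasure lborel (U - A) + emeasure lborel (A - K)"
      proof -
        have "U - K = (U - A) \<union> (A - K)" using U(2) K(2) by blast
        then show ?thesis using emeasure_subadditive[of "U - A" lborel "A - K"] by simp
      qed
      also have "\<dots> \<le> ennreal e1 + ennreal e1" using U K by (intro add_mono) auto
      also have "\<dots> = ennreal (2 * e1)" using e1 by (simp add: ennreal_plus[symmetric] del: ennreal_plus)
      finally have UK: "emeasure lborel (U - K) \<le> ennreal (2 * e1)" .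
      have "(\<integral>\<^sup>+ x. ennreal (norm (indicator A (x - z) *\<^sub>R c - indicator A x *\<^sub>R c)) \<partial>lborel) \<le> ennreal e" if z: "norm z < \<delta>" for z
      proof -
        define h where "h = (indicator (U - K) :: 'a \<Rightarrow> ennreal)"
        have h[measurable]: "h \<in> borel_measurable borel" unfolding h_def by measurable
        have "(\<integral>\<^sup>+ x. ennreal (norm (indicator A (x - z) *\<^sub>R c - indicator A x *\<^sub>R c)) \<partial>lborel)
            \<le> (\<integral>\<^sup>+ x. ennreal (norm c) * (h x + h (x - z)) \<partial>lborel)"
        proof (rule nn_integral_mono)
          fix x
          \<comment> \<open>If exactly one of the two points belongs to \<open>A\<close>, then one
            of them lies in \<open>U - K\<close>: otherwise the point in \<open>A\<close> belongs to
            \<open>K\<close>, so the other, closer to it than \<open>\<delta>\<close>, is in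
            \<open>U\<close> but outside \<open>A\<close> and hence in \<open>U - K\<close> after
            all.\<close>
          consider "x \<in> A \<longleftrightarrow> x - z \<in> A" | "x \<in> A" "x - z \<notin> A" | "x \<notin> A" "x - z \<in> A" by blast
          then show "ennreal (norm (indicator A (x - z) *\<^sub>R c - indicator A x *\<^sub>R c)) \<le> ennreal (norm c) * (h x + h (x - z))"
          proof cases
            case 2
            then have "x \<in> U - K \<or> x - z \<in> U - K" using KU[of x "x - z"] z U(2) K(2) by auto
            then have "1 \<le> h x + h (x - z)" unfolding h_def by auto
            then show ?thesis using 2 mult_left_mono[of 1 "h x + h (x - z)" "ennreal (norm c)"] by simp
          next
            case 3
            then have "x \<in> U - K \<or> x - z \<in> U - K" using KU[of "x - z" x] z U(2) K(2) by auto
            then have "1 \<le> h x + h (x - z)" unfolding h_def by auto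
            then show ?thesis using 3 mult_left_mono[of 1 "h x + h (x - z)" "ennreal (norm c)"] by simp
          qed (simp add: indicator_def)
        qed
        also have "\<dots> = ennreal (norm c) * ((\<integral>\<^sup>+ x. h x \<partial>lborel) + (\<integral>\<^sup>+ x. h (x - z) \<partial>lborel))"
          by (subst nn_integral_cmult, measurable, subst nn_integral_add, measurable)
        also have "\<dots> = ennreal (norm c) * (emeasure lborel (U - K) + emeasure lborel (U - K))"
          unfolding lborel_reflect_translate(2)[OF h] by (simp add: h_def)
        also have "\<dots> \<le> ennreal (norm c) * (ennreal (2 * e1) + ennreal (2 * e1))"
          by (intro mult_left_mono add_mono UK) simp
        also have "\<dots> = ennreal (4 * e1 * norm c)"
          using e1 by (simp add: ennreal_plus[symmetric] ennreal_mult[symmetric] mult.commute del: ennreal_plus)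
        also have "\<dots> \<le> ennreal e" using e1(2) by (rule ennreal_leI)
        finally show ?thesis .
      qed
      then show ?thesis using \<delta>(1) by blast
    qed
  qed
next
  case (add f g)
  have [measurable]: "f \<in> borel_measurable borel" "g \<in> borel_measurable borel" using add.hyps by auto
  show ?case
  proof (intro allI impI)
    fix e :: real assume "0 < e"
    then have e: "0 < e / 2" by simp
    obtain d1 where d1: "0 < d1" "\<And>z. norm z < d1 \<Longrightarrow> (\<integral>\<^sup>+ x. ennreal (norm (f (x - z) - f x)) \<partial>lborel) \<le> ennreal (e / 2)"
      using add.IH(1) e by blast
    obtain d2 where d2: "0 < d2" "\<And>z. norm z < d2 \<Longrightarrow> (\<integral>\<^sup>+ x. ennreal (norm (g (x - z) - g x)) \<partial>lborel) \<le> ennreal (e / 2)"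
      using add.IH(2) e by blast
    have "(\<integral>\<^sup>+ x. ennreal (norm (f (x - z) + g (x - z) - (f x + g x))) \<partial>lborel) \<le> ennreal e" if z: "norm z < min d1 d2" for z
    proof -
      have "(\<integral>\<^sup>+ x. ennreal (norm (f (x - z) + g (x - z) - (f x + g x))) \<partial>lborel)
         \<le> (\<integral>\<^sup>+ x. ennreal (norm (f (x - z) - f x)) + ennreal (norm (g (x - z) - g x)) \<partial>lborel)"
        by (intro nn_integral_mono) (simp add: ennreal_plus[symmetric] ennreal_leI norm_diff_triangle_ineq del: ennreal_plus)
      also have "\<dots> = (\<integral>\<^sup>+ x. ennreal (norm (f (x - z) - f x)) \<partial>lborel) + (\<integral>\<^sup>+ x. ennreal (norm (g (x - z) - g x)) \<partial>lborel)"
        by (rule nn_integral_add) measurable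
      also have "\<dots> \<le> ennreal (e / 2) + ennreal (e / 2)" using z by (intro add_mono d1 d2) auto
      also have "\<dots> = ennreal e" using e by (simp add: ennreal_plus[symmetric] del: ennreal_plus)
      finally show ?thesis .
    qed
    then show "\<exists>\<delta>>0. \<forall>z. norm z < \<delta> \<longrightarrow> (\<integral>\<^sup>+ x. ennreal (norm (f (x - z) + g (x - z) - (f x + g x))) \<partial>lborel) \<le> ennreal e"
      using d1(1) d2(1) by (intro exI[of _ "min d1 d2"]) auto
  qed
next
  case (lim f s)
  have [measurable]: "f \<in> borel_measurable borel" "s i \<in> borel_measurable borel" for i using lim.hyps by auto
  have L1: "(\<lambda>i. \<integral>\<^sup>+ x. ennreal (norm (s i x - f x)) \<partial>lborel) \<longlonglongrightarrow> 0"
  proof -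
    have "(\<lambda>i. \<integral>\<^sup>+ x. ennreal (norm (f x - s i x)) \<partial>lborel) \<longlonglongrightarrow> (\<integral>\<^sup>+ (x::'a). 0 \<partial>lborel)"
    proof (rule nn_integral_dominated_convergence[where w="\<lambda>x. ennreal (3 * norm (f x))"])
      show "AE x in lborel. ennreal (norm (f x - s i x)) \<le> ennreal (3 * norm (f x))" for i
      proof (rule AE_I2, rule ennreal_leI)
        fix x
        have "norm (f x - s i x) \<le> norm (f x) + norm (s i x)" by (rule norm_triangle_ineq4)
        then show "norm (f x - s i x) \<le> 3 * norm (f x)" using lim.hyps(3)[of x i] by simp
      qed
      have "integrable lborel (\<lambda>x. 3 * norm (f x))" using lim.hyps(4) by auto
      then have "(\<integral>\<^sup>+ x. ennreal (norm (3 * norm (f x))) \<partial>lborel) < \<infinity>"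
        unfolding integrable_iff_bounded by blast
      then show "(\<integral>\<^sup>+ x. ennreal (3 * norm (f x)) \<partial>lborel) < \<infinity>" by simp
      show "AE x in lborel. (\<lambda>i. ennreal (norm (f x - s i x))) \<longlonglongrightarrow> 0"
      proof (rule AE_I2)
        fix x
        have "(\<lambda>i. norm (f x - s i x)) \<longlonglongrightarrow> norm (f x - f x)"
          using lim.hyps(2)[of x] by (intro tendsto_intros) auto
        then show "(\<lambda>i. ennreal (norm (f x - s i x))) \<longlonglongrightarrow> 0" using tendsto_ennrealI by force
      qed
    qed auto
    then show ?thesis by (simp add: norm_minus_commute)
  qed
  show ?case
  proof (intro allI impI)
    fix e :: real assume "0 < e"
    then have e: "0 < e / 3" by simp
    then have "\<forall>\<^sub>F i in sequentially. (\<integral>\<^sup>+ x. ennreal (norm (s i x - f x)) \<partial>lborel) < ennreal (e / 3)"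
      using L1 by (intro order_tendstoD) auto
    then obtain i where i: "(\<integral>\<^sup>+ x. ennreal (norm (s i x - f x)) \<partial>lborel) < ennreal (e / 3)"
      by (auto simp: eventually_sequentially)
    obtain \<delta> where \<delta>: "0 < \<delta>" "\<And>z. norm z < \<delta> \<Longrightarrow> (\<integral>\<^sup>+ x. ennreal (norm (s i (x - z) - s i x)) \<partial>lborel) \<le> ennreal (e / 3)"
      using lim.IH e by blast
    have "(\<integral>\<^sup>+ x. ennreal (norm (f (x - z) - f x)) \<partial>lborel) \<le> ennreal e" if z: "norm z < \<delta>" for z
    proof -
      define h where "h = (\<lambda>x. ennreal (norm (s i x - f x)))"
      have h[measurable]: "h \<in> borel_measurable borel" unfolding h_def by measurable
      have "(\<integral>\<^sup>+ x. ennreal (norm (f (x - z) - f x)) \<partial>lborel)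
         \<le> (\<integral>\<^sup>+ x. h (x - z) + (ennreal (norm (s i (x - z) - s i x)) + h x) \<partial>lborel)"
      proof (intro nn_integral_mono)
        fix x
        have "f (x - z) - f x = (s i (x - z) - s i x) - (s i (x - z) - f (x - z)) + (s i x - f x)" by simp
        also have "norm \<dots> \<le> norm (s i (x - z) - f (x - z)) + (norm (s i (x - z) - s i x) + norm (s i x - f x))"
          by (smt (verit) norm_triangle_ineq norm_triangle_ineq4)
        finally show "ennreal (norm (f (x - z) - f x)) \<le> h (x - z) + (ennreal (norm (s i (x - z) - s i x)) + h x)"
          by (simp add: h_def ennreal_plus[symmetric] ennreal_leI del: ennreal_plus)
      qed
      also have "\<dots> = (\<integral>\<^sup>+ x. h (x - z) \<partial>lborel) + ((\<integral>\<^sup>+ x. ennreal (norm (s i (x - z) - s i x)) \<partial>lborel) + (\<integral>\<^sup>+ x. h x \<partial>lborel))"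
        by (subst nn_integral_add, measurable, subst nn_integral_add, measurable)
      also have "(\<integral>\<^sup>+ x. h (x - z) \<partial>lborel) = (\<integral>\<^sup>+ x. h x \<partial>lborel)"
        by (rule lborel_reflect_translate(2)[OF h])
      also have "(\<integral>\<^sup>+ x. h x \<partial>lborel) + ((\<integral>\<^sup>+ x. ennreal (norm (s i (x - z) - s i x)) \<partial>lborel) + (\<integral>\<^sup>+ x. h x \<partial>lborel))
         \<le> ennreal (e / 3) + (ennreal (e / 3) + ennreal (e / 3))"
        using i \<delta>(2)[OF z] unfolding h_def by (intro add_mono) auto
      also have "\<dots> = ennreal e" using e by (simp add: ennreal_plus[symmetric] del: ennreal_plus)
      finally show ?thesis .
    qed
    then show "\<exists>\<delta>>0. \<forall>z. norm z < \<delta> \<longrightarrow> (\<integral>\<^sup>+ x. ennreal (norm (f (x - z) - f x)) \<partial>lborel) \<le> ennreal e"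
      using \<delta>(1) by blast
  qed
qed

section \<open>Level sets of Sobolev functions\<close>

text \<open>The errors are summable, so almost everywhere their sum is finite and they tend to 0; no
  subsequence has to be extracted. Any given point lies in all but finitely many of the
  balls.\<close>

lemma AE_tendsto_of_local_L1:
  fixes F :: "nat \<Rightarrow> 'a::euclidean_space \<Rightarrow> 'b::euclidean_space"
  assumes [measurable]: "\<And>k. F k \<in> borel_measurable borel" "G \<in> borel_measurable borel"
    and le: "\<And>k. (\<integral>\<^sup>+ x. ennreal (norm (F k x - G x)) * indicator (ball 0 (real k)) x \<partial>lborel) \<le> ennreal ((1/2) ^ k)"
  shows "AE x in lborel. (\<lambda>k. F k x) \<longlonglongrightarrow> G x"
proof -
  define r where "r = (\<lambda>k x. norm (F k x - G x) * indicator (ball 0 (real k)) x)"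
  have [measurable]: "ball (0::'a) (real k) \<in> sets borel" for k by simp
  have [measurable]: "r k \<in> borel_measurable borel" for k unfolding r_def by measurable
  have "(\<integral>\<^sup>+ x. (\<Sum>k. ennreal (r k x)) \<partial>lborel) = (\<Sum>k. \<integral>\<^sup>+ x. ennreal (r k x) \<partial>lborel)"
    by (rule nn_integral_suminf) measurable
  also have "\<dots> \<le> (\<Sum>k. ennreal ((1/2) ^ k))"
  proof (intro suminf_le allI)
    fix k
    have "ennreal (r k x) = ennreal (norm (F k x - G x)) * indicator (ball 0 (real k)) x" for x
      by (simp add: r_def split: split_indicator)
    then show "(\<integral>\<^sup>+ x. ennreal (r k x) \<partial>lborel) \<le> ennreal ((1/2) ^ k)" using le[of k] by simp
  qed auto
  also have "\<dots> = ennreal (\<Sum>k. (1/2) ^ k)" by (rule suminf_ennreal2) (auto intro: summable_geometric)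
  finally have "(\<integral>\<^sup>+ x. (\<Sum>k. ennreal (r k x)) \<partial>lborel) \<noteq> \<infinity>" by (auto simp: top_unique)
  then have "AE x in lborel. (\<Sum>k. ennreal (r k x)) \<noteq> \<infinity>"
    by (intro nn_integral_noteq_infinite) auto
  then show ?thesis
  proof eventually_elim
    case (elim x)
    then have "summable (\<lambda>k. r k x)" by (intro summable_suminf_not_top) (auto simp: r_def)
    then have "(\<lambda>k. r k x) \<longlonglongrightarrow> 0" by (rule summable_LIMSEQ_zero)
    moreover have "\<forall>\<^sub>F k in sequentially. r k x = norm (F k x - G x)"
    proof -
      obtain N where "norm x < real N" using reals_Archimedean2 by blast
      then show ?thesis by (auto intro!: eventually_sequentiallyI[of N] simp: r_def split: split_indicator)
    qed
    ultimately have "(\<lambda>k. norm (F k x - G x)) \<longlonglongrightarrow> 0" by (rule Lim_transform_eventually)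
    then have "(\<lambda>k. F k x - G x) \<longlonglongrightarrow> 0" by (rule tendsto_norm_zero_cancel)
    then show ?case by (rule LIM_zero_cancel)
  qed
qed

text \<open>The tail infima increase, so their suprema add up, and the sum of the infima over the
  tail from \<open>n\<close> on is at most \<open>D n + L n\<close>.\<close>

lemma liminf_add_le:
  fixes D L :: "nat \<Rightarrow> ennreal"
  assumes "\<And>k. D k + L k \<le> Q" shows "liminf D + liminf L \<le> Q"
proof -
  define a b where "a = (\<lambda>n. INF k\<in>{n..}. D k)" and "b = (\<lambda>n. INF k\<in>{n..}. L k)"
  have "incseq a" "incseq b" unfolding a_def b_def incseq_def by (auto intro!: INF_superset_mono)
  then have "liminf D + liminf L = (SUP n. a n + b n)"
    unfolding liminf_SUP_INF a_def[symmetric] b_def[symmetric] by (simp add: ennreal_SUP_add)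
  also have "\<dots> \<le> Q"
  proof (rule SUP_least)
    fix n
    have "a n + b n \<le> D n + L n" unfolding a_def b_def by (intro add_mono INF_lower) auto
    then show "a n + b n \<le> Q" using assms[of n] by (rule order_trans)
  qed
  finally show ?thesis .
qed

text \<open>Lower semicontinuity of a continuous nondecreasing function: a value below the target is
  already exceeded at some \<open>t < m\<close>, and eventually \<open>M k\<close> is greater than
  \<open>t\<close>.\<close>

lemma powr_le_liminf:
  fixes m :: real and M :: "nat \<Rightarrow> real"
  assumes le: "ennreal m \<le> liminf (\<lambda>k. ennreal (M k))" and m: "0 \<le> m" and C: "0 \<le> C" and \<theta>: "0 \<le> \<theta>"
  shows "ennreal (C * m powr \<theta>) \<le> liminf (\<lambda>k. ennreal (C * M k powr \<theta>))"
  unfolding le_Liminf_iff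
proof (intro allI impI)
  fix y assume y: "y < ennreal (C * m powr \<theta>)"
  then have m0: "0 < m" using m by (cases "m = 0") auto
  obtain r where r: "y = ennreal r" "0 \<le> r" using y by (cases y) auto
  have "r < C * m powr \<theta>" using y r by (simp add: ennreal_less_iff)
  moreover have "((\<lambda>t. C * t powr \<theta>) \<longlongrightarrow> C * m powr \<theta>) (at_left m)"
    using m0 by (intro tendsto_intros) auto
  ultimately have "\<forall>\<^sub>F t in at_left m. r < C * t powr \<theta>" by (simp add: order_tendstoD(1))
  moreover have "\<forall>\<^sub>F t in at_left m. 0 < t \<and> t < m"
    using m0 by (intro eventually_conj) (auto simp: eventually_at_left_field intro: exI[of _ 0])
  ultimately have "\<forall>\<^sub>F t in at_left m. r < C * t powr \<theta> \<and> 0 < t \<and> t < m" by (rule eventually_conj)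
  then obtain t where t: "r < C * t powr \<theta>" "0 < t" "t < m"
    using eventually_happens'[OF trivial_limit_at_left_real] by blast
  have "ennreal t < liminf (\<lambda>k. ennreal (M k))"
    using t le by (meson ennreal_lessI less_le_trans less_trans)
  then have "\<forall>\<^sub>F k in sequentially. ennreal t < ennreal (M k)" by (rule less_LiminfD)
  then show "\<forall>\<^sub>F k in sequentially. y < ennreal (C * M k powr \<theta>)"
  proof eventually_elim
    case (elim k)
    then have "t \<le> M k" using t by (simp add: ennreal_less_iff)
    then have "C * t powr \<theta> \<le> C * M k powr \<theta>" using t C \<theta> by (intro mult_left_mono powr_mono2) auto
    then show ?case using t r by (auto intro!: ennreal_lessI)
  qed
qed

text \<open>Chebyshev's inequality.\<close>

lemma Lp_level_set_finite:
  fixes f :: "'a::euclidean_space \<Rightarrow> 'b::euclidean_space"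
  assumes [measurable]: "f \<in> borel_measurable borel" and a: "0 < a" and p: "1 \<le> p"
    and f: "(\<integral>\<^sup>+ x. ennreal (norm (f x) powr p) \<partial>lborel) < \<infinity>"
  shows "emeasure lborel {x. a < norm (f x)} < \<infinity>"
proof -
  have "ennreal (a powr p) * emeasure lborel {x. a < norm (f x)} = (\<integral>\<^sup>+ x. ennreal (a powr p) * indicator {x. a < norm (f x)} x \<partial>lborel)"
    by (subst nn_integral_cmult_indicator) auto
  also have "\<dots> \<le> (\<integral>\<^sup>+ x. ennreal (norm (f x) powr p) \<partial>lborel)"
    using a p by (intro nn_integral_mono) (auto split: split_indicator intro!: ennreal_leI powr_mono2)
  finally have "ennreal (a powr p) * emeasure lborel {x. a < norm (f x)} < \<infinity>" using f by (rule order_le_less_trans)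
  then show ?thesis using a by (auto simp: ennreal_mult_less_top)
qed

lemma mollified_sequence:
  fixes f :: "real ^ 'n \<Rightarrow> real" and g :: "real ^ 'n \<Rightarrow> real ^ 'n"
  assumes f[measurable]: "f \<in> borel_measurable borel" and g[measurable]: "g \<in> borel_measurable borel" and p: "1 \<le> p"
    and fp: "(\<integral>\<^sup>+ x. ennreal (norm (f x) powr p) \<partial>lborel) < \<infinity>"
    and gp: "(\<integral>\<^sup>+ x. ennreal (norm (g x) powr p) \<partial>lborel) < \<infinity>"
    and weak: "\<And>\<phi> i. test_function \<phi> \<Longrightarrow>
        (\<integral> x. f x * partial_deriv i \<phi> x \<partial>lborel) = - (\<integral> x. g x $ i * \<phi> x \<partial>lborel)"
  obtains F :: "nat \<Rightarrow> real ^ 'n \<Rightarrow> real" and G :: "nat \<Rightarrow> real ^ 'n \<Rightarrow> real ^ 'n"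
  where "\<And>k. F k \<in> borel_measurable borel" "\<And>k. G k \<in> borel_measurable borel"
    "\<And>k x. (F k has_derivative (\<lambda>v. G k x \<bullet> v)) (at x)"
    "\<And>k. \<exists>M>0. \<forall>x y. \<bar>F k x - F k y\<bar> \<le> M * dist x y"
    "\<And>k. (\<integral>\<^sup>+ x. ennreal (norm (F k x) powr p) \<partial>lborel) \<le> (\<integral>\<^sup>+ x. ennreal (norm (f x) powr p) \<partial>lborel)"
    "\<And>k. (\<integral>\<^sup>+ x. ennreal (norm (G k x) powr p) \<partial>lborel) \<le> (\<integral>\<^sup>+ x. ennreal (norm (g x) powr p) \<partial>lborel)"
    "AE x in lborel. (\<lambda>k. F k x) \<longlonglongrightarrow> f x" "AE x in lborel. (\<lambda>k. G k x) \<longlonglongrightarrow> g x"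
proof -
  have loc: "integrable lborel (\<lambda>x. indicator (ball 0 r) x *\<^sub>R h x)"
    if h[measurable]: "h \<in> borel_measurable borel" and hp: "(\<integral>\<^sup>+ x. ennreal (norm (h x) powr p) \<partial>lborel) < \<infinity>"
    for h :: "real ^ 'n \<Rightarrow> 'c::euclidean_space" and r :: real
  proof -
    obtain B where B: "0 \<le> B" "\<And>x. (\<integral>\<^sup>+ y. ennreal (norm (h y)) * indicator (cball x r) y \<partial>lborel) \<le> ennreal B"
      using Lp_imp_uniformly_locally_integrable[OF h p hp] by blast
    have [measurable]: "ball (0::real^'n) r \<in> sets borel" by simp
    show ?thesis
      by (rule integrable_dominated_local(1)[OF h _ B(2) B(1), where x=0 and C=1]) (auto split: split_indicator)
  qed
  \<comment> \<open>All demands on the \<open>k\<close>-th pair are collected in one predicate, so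
    that a single choice yields both sequences. The errors on the ball of radius \<open>k\<close>
    are those of \<open>AE_tendsto_of_local_L1\<close>.\<close>
  define good where "good = (\<lambda>k (H :: (real ^ 'n \<Rightarrow> real) \<times> (real ^ 'n \<Rightarrow> real ^ 'n)).
    fst H \<in> borel_measurable borel \<and> snd H \<in> borel_measurable borel \<and>
    (\<forall>x. (fst H has_derivative (\<lambda>v. snd H x \<bullet> v)) (at x)) \<and>
    (\<exists>M>0. \<forall>x y. \<bar>fst H x - fst H y\<bar> \<le> M * dist x y) \<and>
    (\<integral>\<^sup>+ x. ennreal (norm (fst H x) powr p) \<partial>lborel) \<le> (\<integral>\<^sup>+ x. ennreal (norm (f x) powr p) \<partial>lborel) \<and>
    (\<integral>\<^sup>+ x. ennreal (norm (snd H x) powr p) \<partial>lborel) \<le> (\<integral>\<^sup>+ x. ennreal (norm (g x) powr p) \<partial>lborel) \<and>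
    (\<integral>\<^sup>+ x. ennreal (norm (fst H x - f x)) * indicator (ball 0 (real k)) x \<partial>lborel) \<le> ennreal ((1/2) ^ k) \<and>
    (\<integral>\<^sup>+ x. ennreal (norm (snd H x - g x)) * indicator (ball 0 (real k)) x \<partial>lborel) \<le> ennreal ((1/2) ^ k))"
  have "\<exists>H. good k H" for k
  proof -
    let ?e = "(1/2::real) ^ k"
    obtain d1 where d1: "0 < d1" "\<And>z. norm z < d1 \<Longrightarrow> (\<integral>\<^sup>+ x. ennreal (norm (indicator (ball 0 (real k + 1)) (x - z) *\<^sub>R f (x - z)
              - indicator (ball 0 (real k + 1)) x *\<^sub>R f x)) \<partial>lborel) \<le> ennreal ?e"
      using L1_translation_continuous[OF loc[OF f fp, of "real k + 1"], rule_format, of ?e] by auto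
    obtain d2 where d2: "0 < d2" "\<And>z. norm z < d2 \<Longrightarrow> (\<integral>\<^sup>+ x. ennreal (norm (indicator (ball 0 (real k + 1)) (x - z) *\<^sub>R g (x - z)
              - indicator (ball 0 (real k + 1)) x *\<^sub>R g x)) \<partial>lborel) \<le> ennreal ?e"
      using L1_translation_continuous[OF loc[OF g gp, of "real k + 1"], rule_format, of ?e] by auto
    define d where "d = min 1 (min d1 d2)"
    have d: "0 < d" "d \<le> 1" "d \<le> d1" "d \<le> d2" using d1(1) d2(1) by (auto simp: d_def)
    obtain \<kappa> :: "real ^ 'n \<Rightarrow> real" and \<kappa>' where \<kappa>: "mollifier d \<kappa> \<kappa>'" "\<And>x. test_function (\<lambda>y. \<kappa> (x - y))"
      using mollifier_exists[OF d(1)] by blast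
    interpret mollifier d \<kappa> \<kappa>' by (rule \<kappa>)
    obtain B1 where B1: "0 \<le> B1" "\<And>x. (\<integral>\<^sup>+ y. ennreal (norm (f y)) * indicator (cball x (d + 1)) y \<partial>lborel) \<le> ennreal B1"
      using Lp_imp_uniformly_locally_integrable[OF f p fp] by blast
    obtain B2 where B2: "0 \<le> B2" "\<And>x. (\<integral>\<^sup>+ y. ennreal (norm (g y)) * indicator (cball x (d + 1)) y \<partial>lborel) \<le> ennreal B2"
      using Lp_imp_uniformly_locally_integrable[OF g p gp] by blast
    define B where "B = max B1 B2"
    have B: "0 \<le> B" using B1 by (simp add: B_def)
    have Bf: "(\<integral>\<^sup>+ y. ennreal (norm (f y)) * indicator (cball x (d + 1)) y \<partial>lborel) \<le> ennreal B" for x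
      using B1(2)[of x] by (rule order_trans) (simp add: B_def ennreal_leI)
    have Bg: "(\<integral>\<^sup>+ y. ennreal (norm (g y)) * indicator (cball x (d + 1)) y \<partial>lborel) \<le> ennreal B" for x
      using B2(2)[of x] by (rule order_trans) (simp add: B_def ennreal_leI)
    have "good k (mollify \<kappa> f, mollify \<kappa> g)"
      unfolding good_def fst_conv snd_conv
    proof (intro conjI allI)
      show "mollify \<kappa> f \<in> borel_measurable borel" by (rule mollify_measurable[OF f B Bf])
      show "mollify \<kappa> g \<in> borel_measurable borel" by (rule mollify_measurable[OF g B Bg])
      show "(mollify \<kappa> f has_derivative (\<lambda>v. mollify \<kappa> g x \<bullet> v)) (at x)" for x
        by (rule mollify_gradient[OF \<kappa> f g B Bf Bg weak])
      show "\<exists>M>0. \<forall>x y. \<bar>mollify \<kappa> f x - mollify \<kappa> f y\<bar> \<le> M * dist x y"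
        using mollify_lipschitz[OF f B Bf] by simp
      show "(\<integral>\<^sup>+ x. ennreal (norm (mollify \<kappa> f x) powr p) \<partial>lborel) \<le> (\<integral>\<^sup>+ x. ennreal (norm (f x) powr p) \<partial>lborel)"
        by (rule mollify_Lp_le[OF f B Bf p])
      show "(\<integral>\<^sup>+ x. ennreal (norm (mollify \<kappa> g x) powr p) \<partial>lborel) \<le> (\<integral>\<^sup>+ x. ennreal (norm (g x) powr p) \<partial>lborel)"
        by (rule mollify_Lp_le[OF g B Bg p])
      show "(\<integral>\<^sup>+ x. ennreal (norm (mollify \<kappa> f x - f x)) * indicator (ball 0 (real k)) x \<partial>lborel) \<le> ennreal ?e"
        by (rule mollify_minus_le[OF f d(2) B Bf d1(2)]) (use d in auto)
      show "(\<integral>\<^sup>+ x. ennreal (norm (mollify \<kappa> g x - g x)) * indicator (ball 0 (real k)) x \<partial>lborel) \<le> ennreal ?e"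
        by (rule mollify_minus_le[OF g d(2) B Bg d2(2)]) (use d in auto)
    qed
    then show ?thesis by blast
  qed
  then obtain H where H: "\<And>k. good k (H k)" by metis
  show ?thesis
  proof (rule that[of "\<lambda>k. fst (H k)" "\<lambda>k. snd (H k)"])
    show "AE x in lborel. (\<lambda>k. fst (H k) x) \<longlonglongrightarrow> f x"
      by (rule AE_tendsto_of_local_L1) (use H in \<open>auto simp: good_def\<close>)
    show "AE x in lborel. (\<lambda>k. snd (H k) x) \<longlonglongrightarrow> g x"
      by (rule AE_tendsto_of_local_L1) (use H in \<open>auto simp: good_def\<close>)
  qed (use H in \<open>auto simp: good_def\<close>)
qed

theorem sobolev_level_sets_le_gradient_continuous:
  fixes f :: "real ^ 'n \<Rightarrow> real" and g :: "real ^ 'n \<Rightarrow> real ^ 'n" and \<phi> :: "real \<Rightarrow> real"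
  assumes f[measurable]: "f \<in> borel_measurable borel" and g[measurable]: "g \<in> borel_measurable borel" and p: "1 \<le> p"
    and fp: "(\<integral>\<^sup>+ x. ennreal (norm (f x) powr p) \<partial>lborel) < \<infinity>"
    and gp: "(\<integral>\<^sup>+ x. ennreal (norm (g x) powr p) \<partial>lborel) < \<infinity>"
    and weak: "\<And>\<phi> i. test_function \<phi> \<Longrightarrow>
        (\<integral> x. f x * partial_deriv i \<phi> x \<partial>lborel) = - (\<integral> x. g x $ i * \<phi> x \<partial>lborel)"
    and \<phi>: "continuous_on UNIV \<phi>" "\<And>l. 0 \<le> \<phi> l" "\<And>l. \<phi> l \<le> 1" "\<And>l. l \<le> a \<Longrightarrow> \<phi> l = 0"
    and a: "0 < a"
  shows "(\<integral>\<^sup>+ l. ennreal (\<phi> l * (iso_const TYPE(real^'n) * measure lborel {x. l < \<bar>f x\<bar>} powr (1 - 1 / DIM(real^'n)))) \<partial>lborel)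
     \<le> (\<integral>\<^sup>+ x. ennreal (\<phi> \<bar>f x\<bar> * norm (g x)) \<partial>lborel)"
proof -
  obtain F :: "nat \<Rightarrow> real ^ 'n \<Rightarrow> real" and G :: "nat \<Rightarrow> real ^ 'n \<Rightarrow> real ^ 'n"
    where F[measurable]: "\<And>k. F k \<in> borel_measurable borel" and G[measurable]: "\<And>k. G k \<in> borel_measurable borel"
    and der: "\<And>k x. (F k has_derivative (\<lambda>v. G k x \<bullet> v)) (at x)"
    and lip: "\<And>k. \<exists>M>0. \<forall>x y. \<bar>F k x - F k y\<bar> \<le> M * dist x y"
    and Fp: "\<And>k. (\<integral>\<^sup>+ x. ennreal (norm (F k x) powr p) \<partial>lborel) \<le> (\<integral>\<^sup>+ x. ennreal (norm (f x) powr p) \<partial>lborel)"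
    and Gp: "\<And>k. (\<integral>\<^sup>+ x. ennreal (norm (G k x) powr p) \<partial>lborel) \<le> (\<integral>\<^sup>+ x. ennreal (norm (g x) powr p) \<partial>lborel)"
    and Fl: "AE x in lborel. (\<lambda>k. F k x) \<longlonglongrightarrow> f x" and Gl: "AE x in lborel. (\<lambda>k. G k x) \<longlonglongrightarrow> g x"
    using mollified_sequence[OF f g p fp gp weak] by blast
  have [measurable]: "\<phi> \<in> borel_measurable borel" using \<phi>(1) by (rule borel_measurable_continuous_onI)
  define \<theta> where "\<theta> = 1 - 1 / real DIM(real^'n)"
  have \<theta>: "0 \<le> \<theta>" by (simp add: \<theta>_def Suc_leI)
  define c where "c = iso_const TYPE(real^'n)"
  have c: "0 \<le> c" by (simp add: c_def iso_const_def)
  define L where "L = (\<lambda>u :: real ^ 'n \<Rightarrow> real. \<lambda>l. ennreal (\<phi> l * (c * measure lborel {x. l < \<bar>u x\<bar>} powr \<theta>)))"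
  have Lm[measurable]: "L u \<in> borel_measurable borel" if [measurable]: "u \<in> borel_measurable borel" for u
  proof -
    have "(\<lambda>l. emeasure lborel {x. l < \<bar>u x\<bar>}) \<in> borel_measurable borel" by measurable
    then have [measurable]: "(\<lambda>l. measure lborel {x. l < \<bar>u x\<bar>}) \<in> borel_measurable borel" unfolding measure_def by measurable
    show ?thesis unfolding L_def by measurable
  qed
  have finF: "emeasure lborel {x. l < \<bar>F k x\<bar>} < \<infinity>" if "0 < l" for k l
    using Lp_level_set_finite[OF F that p order_le_less_trans[OF Fp fp]] by simp
  have finf: "emeasure lborel {x. l < \<bar>f x\<bar>} < \<infinity>" if "0 < l" for l
    using Lp_level_set_finite[OF f that p fp] by simp
  have ineq: "(\<integral>\<^sup>+ l. L (F k) l \<partial>lborel) \<le> (\<integral>\<^sup>+ x. ennreal (\<phi> \<bar>F k x\<bar> * norm (G k x)) \<partial>lborel)" for k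
  proof -
    obtain M where M: "0 < M" "\<And>x y. \<bar>F k x - F k y\<bar> \<le> M * dist x y" using lip by blast
    show ?thesis unfolding L_def c_def \<theta>_def
      by (rule lipschitz_level_sets_le_gradient[OF M(2) M(1) der G finF \<phi> a])
  qed
  have lower: "(\<integral>\<^sup>+ l. L f l \<partial>lborel) \<le> liminf (\<lambda>k. \<integral>\<^sup>+ l. L (F k) l \<partial>lborel)"
  proof -
    have "(\<integral>\<^sup>+ l. L f l \<partial>lborel) \<le> (\<integral>\<^sup>+ l. liminf (\<lambda>k. L (F k) l) \<partial>lborel)"
    proof (rule nn_integral_mono)
      fix l :: real
      show "L f l \<le> liminf (\<lambda>k. L (F k) l)"
      proof (cases "l \<le> a")
        case True
        then show ?thesis by (simp add: L_def \<phi>(4))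
      next
        case False
        then have l: "0 < l" using a by simp
        have "emeasure lborel {x. l < \<bar>f x\<bar>} = (\<integral>\<^sup>+ x. indicator {x. l < \<bar>f x\<bar>} x \<partial>lborel)"
          by (rule nn_integral_indicator[symmetric]) simp
        also have "\<dots> \<le> (\<integral>\<^sup>+ x. liminf (\<lambda>k. indicator {x. l < \<bar>F k x\<bar>} x) \<partial>lborel)"
        proof (rule nn_integral_mono_AE, use Fl in eventually_elim)
          case (elim x)
          show ?case
          \<comment> \<open>As the inequality is strict, it persists along the sequence; hence the
            measures of superlevel sets are lower semicontinuous.\<close>
          proof (cases "l < \<bar>f x\<bar>")
            case True
            have "(\<lambda>k. \<bar>F k x\<bar>) \<longlonglongrightarrow> \<bar>f x\<bar>" using elim by (rule tendsto_rabs)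
            then have "\<forall>\<^sub>F k in sequentially. l < \<bar>F k x\<bar>" using True by (rule order_tendstoD)
            then have "\<forall>\<^sub>F k in sequentially. 1 \<le> (indicator {x. l < \<bar>F k x\<bar>} x :: ennreal)" by eventually_elim simp
            then have "1 \<le> liminf (\<lambda>k. indicator {x. l < \<bar>F k x\<bar>} x :: ennreal)" by (rule Liminf_bounded)
            then show ?thesis using True by simp
          qed simp
        qed
        also have "\<dots> \<le> liminf (\<lambda>k. \<integral>\<^sup>+ x. indicator {x. l < \<bar>F k x\<bar>} x \<partial>lborel)"
          by (rule nn_integral_liminf) simp
        also have "\<dots> = liminf (\<lambda>k. emeasure lborel {x. l < \<bar>F k x\<bar>})"
          by (subst nn_integral_indicator) auto
        also have "\<dots> = liminf (\<lambda>k. ennreal (measure lborel {x. l < \<bar>F k x\<bar>}))"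
          using finF[OF l] by (subst emeasure_eq_ennreal_measure) (auto simp: less_top)
        finally have "ennreal (measure lborel {x. l < \<bar>f x\<bar>}) \<le> liminf (\<lambda>k. ennreal (measure lborel {x. l < \<bar>F k x\<bar>}))"
          using finf[OF l] by (subst (asm) emeasure_eq_ennreal_measure) (auto simp: less_top)
        from powr_le_liminf[OF this _ _ \<theta>, of "\<phi> l * c"] \<phi>(2)[of l] c
        show ?thesis by (simp add: L_def mult.assoc)
      qed
    qed
    also have "\<dots> \<le> liminf (\<lambda>k. \<integral>\<^sup>+ l. L (F k) l \<partial>lborel)" by (rule nn_integral_liminf) simp
    finally show ?thesis .
  qed
  \<comment> \<open>A majorant of \<open>P\<close>: where |u| exceeds \<open>a\<close> its first
    summand is at least 1, so it dominates 1 + |w|^p and thereby |w|, and elsewhere \<open>P\<close>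
    vanishes. By \<open>intQ\<close> its integral is a combination of two integrals that
    mollification does not increase.\<close>
  define Q where "Q = (\<lambda>(u :: real ^ 'n \<Rightarrow> real) (w :: real ^ 'n \<Rightarrow> real ^ 'n) x. a powr (- p) * \<bar>u x\<bar> powr p + norm (w x) powr p)"
  define P where "P = (\<lambda>(u :: real ^ 'n \<Rightarrow> real) (w :: real ^ 'n \<Rightarrow> real ^ 'n) x. \<phi> \<bar>u x\<bar> * norm (w x))"
  have PQ: "0 \<le> P u w x" "P u w x \<le> Q u w x" for u w x
  proof -
    show "0 \<le> P u w x" by (simp add: P_def \<phi>(2))
    show "P u w x \<le> Q u w x"
    proof (cases "\<bar>u x\<bar> \<le> a")
      case False
      have "1 \<le> (\<bar>u x\<bar> / a) powr p" using False a p by (intro ge_one_powr_ge_zero) auto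
      then have "1 \<le> a powr (- p) * \<bar>u x\<bar> powr p"
        using a by (simp add: powr_divide powr_minus field_simps)
      moreover have "norm (w x) \<le> 1 + norm (w x) powr p" by (rule le_one_plus_powr) (use p in auto)
      moreover have "\<phi> \<bar>u x\<bar> * norm (w x) \<le> 1 * norm (w x)" by (intro mult_right_mono \<phi>) simp
      ultimately show ?thesis by (simp add: P_def Q_def)
    qed (simp add: P_def Q_def \<phi>(4))
  qed
  have [measurable]: "Q u w \<in> borel_measurable borel" "P u w \<in> borel_measurable borel"
    if [measurable]: "u \<in> borel_measurable borel" "w \<in> borel_measurable borel" for u w
    unfolding Q_def P_def by measurable
  have intQ: "(\<integral>\<^sup>+ x. ennreal (Q u w x) \<partial>lborel) = ennreal (a powr (- p)) * (\<integral>\<^sup>+ x. ennreal (norm (u x) powr p) \<partial>lborel) + (\<integral>\<^sup>+ x. ennreal (norm (w x) powr p) \<partial>lborel)"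
    if [measurable]: "u \<in> borel_measurable borel" "w \<in> borel_measurable borel" for u w
    unfolding Q_def
    by (subst nn_integral_cmult[symmetric], measurable, subst nn_integral_add[symmetric], measurable)
       (simp add: ennreal_mult ennreal_plus)
  define IQ where "IQ = (\<integral>\<^sup>+ x. ennreal (Q f g x) \<partial>lborel)"
  have IQfin: "IQ < \<infinity>" unfolding IQ_def intQ[OF f g] using fp gp by (simp add: ennreal_mult_less_top)
  define D where "D = (\<lambda>u w. \<integral>\<^sup>+ x. ennreal (Q u w x - P u w x) \<partial>lborel)"
  have DP: "D u w + (\<integral>\<^sup>+ x. ennreal (P u w x) \<partial>lborel) = (\<integral>\<^sup>+ x. ennreal (Q u w x) \<partial>lborel)"
    if [measurable]: "u \<in> borel_measurable borel" "w \<in> borel_measurable borel" for u w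
    unfolding D_def by (subst nn_integral_add[symmetric]) (auto simp: ennreal_plus[symmetric] PQ simp del: ennreal_plus)
  have DL: "D (F k) (G k) + (\<integral>\<^sup>+ l. L (F k) l \<partial>lborel) \<le> IQ" for k
  proof -
    have "D (F k) (G k) + (\<integral>\<^sup>+ l. L (F k) l \<partial>lborel) \<le> D (F k) (G k) + (\<integral>\<^sup>+ x. ennreal (P (F k) (G k) x) \<partial>lborel)"
      unfolding P_def by (intro add_left_mono ineq)
    also have "\<dots> = (\<integral>\<^sup>+ x. ennreal (Q (F k) (G k) x) \<partial>lborel)" by (rule DP) auto
    also have "\<dots> \<le> IQ" unfolding IQ_def intQ[OF f g] intQ[OF F G] by (intro add_mono mult_left_mono Fp Gp) simp
    finally show ?thesis .
  qed
  have Dlim: "D f g \<le> liminf (\<lambda>k. D (F k) (G k))"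
  proof -
    have "D f g \<le> (\<integral>\<^sup>+ x. liminf (\<lambda>k. ennreal (Q (F k) (G k) x - P (F k) (G k) x)) \<partial>lborel)"
      unfolding D_def
    proof (rule nn_integral_mono_AE, use Fl Gl in eventually_elim)
      case (elim x)
      have "isCont \<phi> \<bar>f x\<bar>" using \<phi>(1) by (simp add: continuous_on_eq_continuous_at)
      then have "(\<lambda>k. \<phi> \<bar>F k x\<bar>) \<longlonglongrightarrow> \<phi> \<bar>f x\<bar>"
        by (rule isCont_tendsto_compose) (intro tendsto_rabs elim)
      then have "(\<lambda>k. Q (F k) (G k) x - P (F k) (G k) x) \<longlonglongrightarrow> Q f g x - P f g x"
        unfolding Q_def P_def using p elim by (intro tendsto_intros) auto
      then have "(\<lambda>k. ennreal (Q (F k) (G k) x - P (F k) (G k) x)) \<longlonglongrightarrow> ennreal (Q f g x - P f g x)"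
        by (rule tendsto_ennrealI)
      then show ?case by (simp add: lim_imp_Liminf)
    qed
    also have "\<dots> \<le> liminf (\<lambda>k. D (F k) (G k))" unfolding D_def by (rule nn_integral_liminf) simp
    finally show ?thesis .
  qed
  \<comment> \<open>Both summands are lower semicontinuous, while \<open>DL\<close> bounds their sum
    by the integral of \<open>Q\<close> for the limit itself; the finite \<open>D f g\<close> then
    cancels.\<close>
  have "D f g + (\<integral>\<^sup>+ l. L f l \<partial>lborel) \<le> liminf (\<lambda>k. D (F k) (G k)) + liminf (\<lambda>k. \<integral>\<^sup>+ l. L (F k) l \<partial>lborel)"
    by (intro add_mono Dlim lower)
  also have "\<dots> \<le> IQ" by (rule liminf_add_le[OF DL])
  also have "IQ = D f g + (\<integral>\<^sup>+ x. ennreal (P f g x) \<partial>lborel)" unfolding IQ_def by (rule DP[symmetric]) auto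
  finally have "D f g + (\<integral>\<^sup>+ l. L f l \<partial>lborel) \<le> D f g + (\<integral>\<^sup>+ x. ennreal (P f g x) \<partial>lborel)" .
  moreover have "D f g < \<infinity>"
  proof -
    have "D f g \<le> IQ" unfolding IQ_def using DP[OF f g] by (metis le_iff_add)
    then show ?thesis using IQfin by (rule order_le_less_trans)
  qed
  ultimately have "(\<integral>\<^sup>+ l. L f l \<partial>lborel) \<le> (\<integral>\<^sup>+ x. ennreal (P f g x) \<partial>lborel)"
    by (auto simp: ennreal_add_left_cancel_le)
  then show ?thesis unfolding L_def P_def c_def \<theta>_def .
qed

section \<open>From continuous to Borel functions of the level\<close>

lemma measure_le_of_continuous:
  fixes M N :: "real measure"
  assumes M: "sets M = sets borel" and N: "sets N = sets borel" and fin: "emeasure N {a<..} < \<infinity>"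
    and le: "\<And>\<phi>. continuous_on UNIV \<phi> \<Longrightarrow> (\<And>l. 0 \<le> \<phi> l) \<Longrightarrow> (\<And>l. \<phi> l \<le> 1) \<Longrightarrow> (\<And>l. l \<le> a \<Longrightarrow> \<phi> l = 0)
        \<Longrightarrow> (\<integral>\<^sup>+ l. ennreal (\<phi> l) \<partial>M) \<le> (\<integral>\<^sup>+ l. ennreal (\<phi> l) \<partial>N)"
    and B: "B \<in> sets borel" "B \<subseteq> {a<..}"
  shows "emeasure M B \<le> emeasure N B"
proof -
  note [measurable_cong] = M N
  have op: "emeasure M U \<le> emeasure N U" if U: "open U" "U \<subseteq> {a<..}" for U
  proof -
    have [measurable]: "U \<in> sets borel" using U by simp
    have ne: "- U \<noteq> {}" using U(2) by (metis Compl_empty_eq UNIV_I double_complement greaterThan_iff less_irrefl subsetD)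
    have cl: "closed (- U)" using U(1) by (simp add: closed_Compl)
    \<comment> \<open>Continuous functions that increase to the indicator of \<open>U\<close>. They
      vanish up to \<open>a\<close> because \<open>U\<close> is contained in
      \<open>{a<..}\<close>.\<close>
    define \<phi> where "\<phi> = (\<lambda>(j::nat) l. min 1 (real j * infdist l (- U)))"
    have c: "continuous_on UNIV (\<phi> j)" for j unfolding \<phi>_def by (intro continuous_intros)
    have [measurable]: "\<phi> j \<in> borel_measurable borel" for j using c by (rule borel_measurable_continuous_onI)
    have b: "0 \<le> \<phi> j l" "\<phi> j l \<le> 1" for j l by (auto simp: \<phi>_def infdist_nonneg)
    have z: "\<phi> j l = 0" if "l \<notin> U" for j l using that by (simp add: \<phi>_def)
    have sup: "(SUP j. ennreal (\<phi> j l)) = indicator U l" for l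
    proof (cases "l \<in> U")
      case True
      then have "0 < infdist l (- U)" using in_closed_iff_infdist_zero[OF cl ne, of l] infdist_nonneg[of l "- U"] by auto
      then obtain j :: nat where "1 < real j * infdist l (- U)" using reals_Archimedean3 by blast
      then have "\<phi> j l = 1" by (simp add: \<phi>_def)
      then have "1 \<le> (SUP j. ennreal (\<phi> j l))" by (intro SUP_upper2[of j]) auto
      moreover have "(SUP j. ennreal (\<phi> j l)) \<le> 1" using b by (intro SUP_least) simp
      ultimately show ?thesis using True by simp
    qed (simp add: z)
    have inc: "incseq (\<lambda>j l. ennreal (\<phi> j l))"
      unfolding incseq_def le_fun_def \<phi>_def
      by (intro allI impI ennreal_leI min.mono order_refl mult_right_mono) (auto simp: infdist_nonneg)
    have "emeasure M U = (\<integral>\<^sup>+ l. (SUP j. ennreal (\<phi> j l)) \<partial>M)" unfolding sup by simp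
    also have "\<dots> = (SUP j. \<integral>\<^sup>+ l. ennreal (\<phi> j l) \<partial>M)"
      by (rule nn_integral_monotone_convergence_SUP[OF inc]) simp
    also have "\<dots> \<le> (SUP j. \<integral>\<^sup>+ l. ennreal (\<phi> j l) \<partial>N)"
    proof (intro SUP_subset_mono order_refl le c b)
      fix j l assume "l \<le> a"
      then show "\<phi> j l = 0" using U(2) by (intro z) auto
    qed
    also have "\<dots> = (\<integral>\<^sup>+ l. (SUP j. ennreal (\<phi> j l)) \<partial>N)"
      by (rule nn_integral_monotone_convergence_SUP[OF inc, symmetric]) simp
    also have "\<dots> = emeasure N U" unfolding sup by simp
    finally show ?thesis .
  qed
  \<comment> \<open>The restriction of \<open>N\<close> to \<open>{a<..}\<close> is finite, as outer
    regularity requires.\<close>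
  define K where "K = density N (indicator {a<..})"
  have K: "emeasure K A = emeasure N (A \<inter> {a<..})" if [measurable]: "A \<in> sets borel" for A
  proof -
    have "emeasure K A = (\<integral>\<^sup>+ x. indicator (A \<inter> {a<..}) x \<partial>N)"
      unfolding K_def using that by (simp add: emeasure_density N indicator_inter_arith mult.commute)
    then show ?thesis by simp
  qed
  have "emeasure M B \<le> (INF U\<in>{U. B \<subseteq> U \<and> open U}. emeasure K U)"
  proof (rule INF_greatest, clarify)
    fix U assume U: "B \<subseteq> U" "open U"
    then have "emeasure M B \<le> emeasure M (U \<inter> {a<..})"
      using B by (intro emeasure_mono) (auto simp: M)
    also have "\<dots> \<le> emeasure N (U \<inter> {a<..})" using U by (intro op) auto
    finally show "emeasure M B \<le> emeasure K U" using U by (simp add: K)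
  qed
  also have "\<dots> = emeasure K B"
  proof (rule outer_regular[symmetric])
    show "sets K = sets borel" by (simp add: K_def N)
    show "emeasure K (space K) \<noteq> \<infinity>" using K[of UNIV] fin by (simp add: K_def space_density sets_eq_imp_space_eq[OF N])
  qed (rule B)
  also have "\<dots> = emeasure N B" using K[OF B(1)] B(2) by (simp add: Int_absorb2)
  finally show ?thesis .
qed

text \<open>Both sides are integrals of \<open>\<psi>\<close> over the half-line: against the
  measure with density \<open>w\<close>, and against the image under |f| of the measure with density
  |g|. The inequality for continuous functions compares these measures on Borel sets, and hence on
  all nonnegative Borel functions.\<close>

theorem sobolev_level_sets_le_gradient:
  fixes f :: "real ^ 'n \<Rightarrow> real" and g :: "real ^ 'n \<Rightarrow> real ^ 'n" and \<psi> :: "real \<Rightarrow> ennreal"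
  assumes f[measurable]: "f \<in> borel_measurable borel" and g[measurable]: "g \<in> borel_measurable borel" and p: "1 \<le> p"
    and fp: "(\<integral>\<^sup>+ x. ennreal (norm (f x) powr p) \<partial>lborel) < \<infinity>"
    and gp: "(\<integral>\<^sup>+ x. ennreal (norm (g x) powr p) \<partial>lborel) < \<infinity>"
    and weak: "\<And>\<phi> i. test_function \<phi> \<Longrightarrow>
        (\<integral> x. f x * partial_deriv i \<phi> x \<partial>lborel) = - (\<integral> x. g x $ i * \<phi> x \<partial>lborel)"
    and \<psi>[measurable]: "\<psi> \<in> borel_measurable borel"
  shows "(\<integral>\<^sup>+ l\<in>{0<..}. \<psi> l * ennreal (iso_const TYPE(real^'n) * measure lborel {x. l < \<bar>f x\<bar>} powr (1 - 1 / DIM(real^'n))) \<partial>lborel)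
     \<le> (\<integral>\<^sup>+ x. \<psi> \<bar>f x\<bar> * indicator {0<..} \<bar>f x\<bar> * ennreal (norm (g x)) \<partial>lborel)"
proof -
  define w where "w = (\<lambda>l. iso_const TYPE(real^'n) * measure lborel {x. l < \<bar>f x\<bar>} powr (1 - 1 / DIM(real^'n)))"
  have w: "0 \<le> w l" for l by (simp add: w_def iso_const_def)
  have [measurable]: "w \<in> borel_measurable borel"
  proof -
    have "(\<lambda>l. emeasure lborel {x. l < \<bar>f x\<bar>}) \<in> borel_measurable borel" by measurable
    then have [measurable]: "(\<lambda>l. measure lborel {x. l < \<bar>f x\<bar>}) \<in> borel_measurable borel" unfolding measure_def by measurable
    show ?thesis unfolding w_def by measurable
  qed
  define M where "M = density lborel (\<lambda>l. ennreal (w l))"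
  define N where "N = distr (density lborel (\<lambda>x. ennreal (norm (g x)))) borel (\<lambda>x. \<bar>f x\<bar>)"
  have sM[measurable_cong]: "sets M = sets borel" and sN[measurable_cong]: "sets N = sets borel" by (simp_all add: M_def N_def)
  have iM: "(\<integral>\<^sup>+ l. h l \<partial>M) = (\<integral>\<^sup>+ l. ennreal (w l) * h l \<partial>lborel)"
    if [measurable]: "h \<in> borel_measurable borel" for h
    unfolding M_def by (rule nn_integral_density) auto
  have iN: "(\<integral>\<^sup>+ l. h l \<partial>N) = (\<integral>\<^sup>+ x. ennreal (norm (g x)) * h \<bar>f x\<bar> \<partial>lborel)"
    if [measurable]: "h \<in> borel_measurable borel" for h
    unfolding N_def by (subst nn_integral_distr, simp, simp, subst nn_integral_density) auto
  have fin: "emeasure N {a<..} < \<infinity>" if a: "0 < a" for a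
  proof -
    have "emeasure N {a<..} = (\<integral>\<^sup>+ x. ennreal (norm (g x)) * indicator {a<..} \<bar>f x\<bar> \<partial>lborel)"
      using iN[of "indicator {a<..}"] by simp
    also have "\<dots> \<le> (\<integral>\<^sup>+ x. indicator {x. a < norm (f x)} x + ennreal (norm (g x) powr p) \<partial>lborel)"
    proof (rule nn_integral_mono)
      fix x
      have "ennreal (norm (g x)) \<le> ennreal (1 + norm (g x) powr p)"
        by (rule ennreal_leI[OF le_one_plus_powr]) (use p in auto)
      then show "ennreal (norm (g x)) * indicator {a<..} \<bar>f x\<bar> \<le> indicator {x. a < norm (f x)} x + ennreal (norm (g x) powr p)"
        by (auto split: split_indicator)
    qed
    also have "\<dots> = emeasure lborel {x. a < norm (f x)} + (\<integral>\<^sup>+ x. ennreal (norm (g x) powr p) \<partial>lborel)"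
      by (subst nn_integral_add) (auto intro!: borel_measurable_indicator)
    also have "\<dots> < \<infinity>" using Lp_level_set_finite[OF f a p fp] gp by simp
    finally show ?thesis .
  qed
  have le: "emeasure M B \<le> emeasure N B" if B: "B \<in> sets borel" "B \<subseteq> {0<..}" for B
  proof -
    \<comment> \<open>\<open>N\<close> is known to be finite only away from 0, so the measures are
      compared on the pieces of \<open>B\<close> above 1 / (k + 1).\<close>
    define A where "A = (\<lambda>k::nat. B \<inter> {1 / real (Suc k)<..})"
    have A: "range A \<subseteq> sets M" "range A \<subseteq> sets N" using B by (auto simp: A_def sM sN)
    have "incseq A" unfolding incseq_def A_def
      by (auto intro!: Int_mono simp: frac_le order.strict_trans1[rotated])
    have UA: "(\<Union>k. A k) = B"
    proof -
      have "\<exists>k. 1 / real (Suc k) < l" if "l \<in> B" for l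
        using B that reals_Archimedean[of l] by (auto simp: inverse_eq_divide)
      then show ?thesis by (auto simp: A_def)
    qed
    have "emeasure M (A k) \<le> emeasure N (A k)" for k
    proof (rule measure_le_of_continuous[OF sM sN fin])
      show "0 < 1 / real (Suc k)" by simp
      show "A k \<in> sets borel" "A k \<subseteq> {1 / real (Suc k)<..}" using B by (auto simp: A_def)
      fix \<phi> :: "real \<Rightarrow> real" assume \<phi>: "continuous_on UNIV \<phi>" "\<And>l. 0 \<le> \<phi> l" "\<And>l. \<phi> l \<le> 1" "\<And>l. l \<le> 1 / real (Suc k) \<Longrightarrow> \<phi> l = 0"
      have [measurable]: "\<phi> \<in> borel_measurable borel" using \<phi>(1) by (rule borel_measurable_continuous_onI)
      have "(\<integral>\<^sup>+ l. ennreal (\<phi> l) \<partial>M) = (\<integral>\<^sup>+ l. ennreal (\<phi> l * w l) \<partial>lborel)"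
        by (subst iM) (auto intro!: nn_integral_cong simp: ennreal_mult \<phi> w mult.commute)
      also have "\<dots> \<le> (\<integral>\<^sup>+ x. ennreal (\<phi> \<bar>f x\<bar> * norm (g x)) \<partial>lborel)"
        unfolding w_def
        by (rule sobolev_level_sets_le_gradient_continuous[OF f g p fp gp weak \<phi>]) auto
      also have "\<dots> = (\<integral>\<^sup>+ l. ennreal (\<phi> l) \<partial>N)"
        by (subst iN) (auto intro!: nn_integral_cong simp: ennreal_mult \<phi> mult.commute)
      finally show "(\<integral>\<^sup>+ l. ennreal (\<phi> l) \<partial>M) \<le> (\<integral>\<^sup>+ l. ennreal (\<phi> l) \<partial>N)" .
    qed
    then have "(SUP k. emeasure M (A k)) \<le> (SUP k. emeasure N (A k))" by (intro SUP_mono) auto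
    then show ?thesis
      using SUP_emeasure_incseq[OF A(1) \<open>incseq A\<close>] SUP_emeasure_incseq[OF A(2) \<open>incseq A\<close>] by (simp add: UA)
  qed
  define M0 where "M0 = density M (indicator {0<..})"
  define N0 where "N0 = density N (indicator {0<..})"
  have "(\<integral>\<^sup>+ l. \<psi> l \<partial>M0) \<le> (\<integral>\<^sup>+ l. \<psi> l \<partial>N0)"
  proof (rule nn_integral_mono_measure)
    show s: "sets M0 = sets N0" by (simp add: M0_def N0_def sM sN)
    show "M0 \<le> N0"
      unfolding le_measure[OF s]
    proof
    fix A assume "A \<in> sets M0"
    then have A[measurable]: "A \<in> sets borel" by (simp add: M0_def sM)
    have "emeasure M0 A = emeasure M (A \<inter> {0<..})" "emeasure N0 A = emeasure N (A \<inter> {0<..})"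
    proof -
      have "emeasure M0 A = (\<integral>\<^sup>+ x. indicator (A \<inter> {0<..}) x \<partial>M)" "emeasure N0 A = (\<integral>\<^sup>+ x. indicator (A \<inter> {0<..}) x \<partial>N)"
        unfolding M0_def N0_def by (simp_all add: emeasure_density sM sN indicator_inter_arith mult.commute)
      then show "emeasure M0 A = emeasure M (A \<inter> {0<..})" "emeasure N0 A = emeasure N (A \<inter> {0<..})" by simp_all
    qed
    then show "emeasure M0 A \<le> emeasure N0 A" using le[of "A \<inter> {0<..}"] by simp
    qed
  qed
  moreover have "(\<integral>\<^sup>+ l. \<psi> l \<partial>M0) = (\<integral>\<^sup>+ l\<in>{0<..}. \<psi> l * ennreal (w l) \<partial>lborel)"
    unfolding M0_def by (subst nn_integral_density, simp, simp, subst iM) (auto intro!: nn_integral_cong simp: mult_ac)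
  moreover have "(\<integral>\<^sup>+ l. \<psi> l \<partial>N0) = (\<integral>\<^sup>+ x. \<psi> \<bar>f x\<bar> * indicator {0<..} \<bar>f x\<bar> * ennreal (norm (g x)) \<partial>lborel)"
    unfolding N0_def by (subst nn_integral_density, simp, simp, subst iN) (auto intro!: nn_integral_cong simp: mult_ac)
  ultimately show ?thesis unfolding w_def by simp
qed

section \<open>The distribution of the superlevel measure\<close>

text \<open>An open set is the increasing union of the dyadic cells contained in it, generation by
  generation; outer regularity of Lebesgue measure does the rest.\<close>

lemma measure_le_lborel:
  fixes P :: "real measure"
  assumes P: "sets P = sets borel" and le: "\<And>a b. a < b \<Longrightarrow> emeasure P {a<..b} \<le> ennreal (b - a)"
  shows "P \<le> lborel"
proof -
  note [measurable_cong] = P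
  have op: "emeasure P U \<le> emeasure lborel U" if U: "open U" for U
  proof -
    \<comment> \<open>Cells open on the left and closed on the right: they have the form of the
      intervals in the hypothesis, and the index of the cell of \<open>x\<close> is a
      ceiling.\<close>
    define cell where "cell = (\<lambda>(k::nat) (i::int). {(real_of_int i - 1) / 2 ^ k<..real_of_int i / 2 ^ k})"
    have in_cell: "x \<in> cell k i \<longleftrightarrow> \<lceil>x * 2 ^ k\<rceil> = i" for x k i
      unfolding cell_def ceiling_eq_iff by (auto simp: field_simps)
    define I where "I = (\<lambda>k. {i. cell k i \<subseteq> U})"
    define V where "V = (\<lambda>k. \<Union>i\<in>I k. cell k i)"
    have cellm[measurable]: "cell k i \<in> sets borel" for k i by (simp add: cell_def)
    have dj: "disjoint_family_on (cell k) (I k)" for k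
      by (auto simp: disjoint_family_on_def in_cell)
    have cI: "countable (I k)" for k by simp
    have [measurable]: "V k \<in> sets borel" for k unfolding V_def by (intro sets.countable_UN'' cI cellm)
    have "emeasure P (V k) \<le> emeasure lborel (V k)" for k
    proof -
      have "emeasure P (V k) = (\<integral>\<^sup>+ i. emeasure P (cell k i) \<partial>count_space (I k))"
        unfolding V_def by (rule emeasure_UN_countable) (auto simp: P intro: dj)
      also have "\<dots> \<le> (\<integral>\<^sup>+ i. emeasure lborel (cell k i) \<partial>count_space (I k))"
      proof (rule nn_integral_mono)
        fix i
        have lt: "(real_of_int i - 1) / 2 ^ k < real_of_int i / 2 ^ k" by (simp add: divide_strict_right_mono)
        show "emeasure P (cell k i) \<le> emeasure lborel (cell k i)"
          unfolding cell_def using le[OF lt] lt by simp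
      qed
      also have "\<dots> = emeasure lborel (V k)"
        unfolding V_def by (rule emeasure_UN_countable[symmetric]) (auto intro: dj)
      finally show ?thesis .
    qed
    then have "(SUP k. emeasure P (V k)) \<le> (SUP k. emeasure lborel (V k))" by (intro SUP_mono) auto
    moreover have VU: "V k \<subseteq> U" for k unfolding V_def I_def by blast
    have "(\<Union>k. V k) = U"
    proof
      show "U \<subseteq> (\<Union>k. V k)"
      proof
        fix x assume "x \<in> U"
        then obtain e where e: "0 < e" "ball x e \<subseteq> U" using U open_contains_ball by blast
        obtain k where k: "(1/2) ^ k < e" using real_arch_pow_inv[OF e(1), of "1/2"] by auto
        define i where "i = \<lceil>x * 2 ^ k\<rceil>"
        have x: "x \<in> cell k i" by (simp add: in_cell i_def)
        have "cell k i \<subseteq> ball x e"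
        proof
          fix y assume "y \<in> cell k i"
          then have "\<bar>x - y\<bar> < real_of_int i / 2 ^ k - (real_of_int i - 1) / 2 ^ k"
            using x unfolding cell_def by auto
          also have "\<dots> = (1/2) ^ k" by (simp add: diff_divide_distrib[symmetric] power_one_over)
          finally show "y \<in> ball x e" using k by (simp add: dist_real_def)
        qed
        then show "x \<in> (\<Union>k. V k)" using x e unfolding V_def I_def by blast
      qed
    qed (use VU in blast)
    moreover have "incseq V"
    proof (rule incseq_SucI, rule subsetI)
      fix k x assume "x \<in> V k"
      then obtain i where i: "cell k i \<subseteq> U" "\<lceil>x * 2 ^ k\<rceil> = i" unfolding V_def I_def in_cell by (auto simp: in_cell)
      have "y \<in> cell k i" if y: "y \<in> cell (Suc k) \<lceil>x * 2 ^ Suc k\<rceil>" for y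
      proof -
        \<comment> \<open>The index in generation \<open>k\<close> is determined by that in
          generation \<open>k + 1\<close>. So every cell lies in a single cell of the preceding
          generation, and \<open>V\<close> increases.\<close>
        have half: "\<lceil>z * 2 ^ k\<rceil> = \<lceil>real_of_int \<lceil>z * 2 ^ Suc k\<rceil> / 2\<rceil>" for z :: real
        proof -
          have "\<lceil>w\<rceil> \<le> j \<longleftrightarrow> \<lceil>real_of_int \<lceil>2 * w\<rceil> / 2\<rceil> \<le> j" for w :: real and j :: int
          proof -
            have "\<lceil>real_of_int \<lceil>2 * w\<rceil> / 2\<rceil> \<le> j \<longleftrightarrow> real_of_int \<lceil>2 * w\<rceil> \<le> real_of_int (2 * j)"
              by (simp add: ceiling_le_iff field_simps)
            also have "\<dots> \<longleftrightarrow> 2 * w \<le> real_of_int (2 * j)" unfolding of_int_le_iff by (simp only: ceiling_le_iff)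
            also have "\<dots> \<longleftrightarrow> \<lceil>w\<rceil> \<le> j" by (simp add: ceiling_le_iff)
            finally show ?thesis by simp
          qed
          moreover have "2 * (z * 2 ^ k) = z * 2 ^ Suc k" by simp
          ultimately have "\<lceil>z * 2 ^ k\<rceil> \<le> j \<longleftrightarrow> \<lceil>real_of_int \<lceil>z * 2 ^ Suc k\<rceil> / 2\<rceil> \<le> j" for j by metis
          then show ?thesis by (meson order_antisym order_refl)
        qed
        have "\<lceil>y * 2 ^ Suc k\<rceil> = \<lceil>x * 2 ^ Suc k\<rceil>" using y by (simp only: in_cell)
        then have "\<lceil>y * 2 ^ k\<rceil> = \<lceil>x * 2 ^ k\<rceil>" by (simp only: half)
        then show ?thesis by (simp add: in_cell i)
      qed
      then have "\<lceil>x * 2 ^ Suc k\<rceil> \<in> I (Suc k)" using i(1) unfolding I_def by blast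
      moreover have "x \<in> cell (Suc k) \<lceil>x * 2 ^ Suc k\<rceil>" by (simp only: in_cell)
      ultimately show "x \<in> V (Suc k)" unfolding V_def by blast
    qed
    moreover have "range V \<subseteq> sets P" "range V \<subseteq> sets lborel" by (auto simp: P)
    ultimately show ?thesis using SUP_emeasure_incseq[of V P] SUP_emeasure_incseq[of V lborel] by simp
  qed
  have "emeasure P B \<le> emeasure lborel B" if B: "B \<in> sets borel" for B
  proof (rule ennreal_le_epsilon)
    fix e :: real assume e: "0 < e"
    obtain U where U: "open U" "B \<subseteq> U" "emeasure lborel (U - B) < ennreal e"
      using outer_regular_lborel[OF B e] by blast
    have "emeasure P B \<le> emeasure P U" using U by (intro emeasure_mono) (auto simp: P)
    also have "\<dots> \<le> emeasure lborel U" by (rule op[OF U(1)])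
    also have "\<dots> = emeasure lborel (B \<union> (U - B))" using U(2) by (simp add: Un_absorb1)
    also have "\<dots> \<le> emeasure lborel B + emeasure lborel (U - B)" using B U by (intro emeasure_subadditive) auto
    also have "\<dots> \<le> emeasure lborel B + ennreal e" using U(3) by (intro add_left_mono) simp
    finally show "emeasure P B \<le> emeasure lborel B + ennreal e" .
  qed
  then show ?thesis by (subst le_measure) (auto simp: P)
qed

text \<open>The distribution function of |f|. For a set of infinite measure \<open>measure\<close>
  returns 0; the lemmas that need the true value assume finiteness for all
  \<open>l > 0\<close>.\<close>

definition superlevel :: "('a::euclidean_space \<Rightarrow> real) \<Rightarrow> real \<Rightarrow> real" where
  "superlevel f l = measure lborel {x. l < \<bar>f x\<bar>}"

text \<open>The positive levels at which \<open>f\<close> has no plateau.\<close>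

definition regular_level :: "('a::euclidean_space \<Rightarrow> real) \<Rightarrow> real \<Rightarrow> bool" where
  "regular_level f l \<longleftrightarrow> 0 < l \<and> emeasure lborel {x. \<bar>f x\<bar> = l} = 0"

lemma superlevel_measurable[measurable]:
  assumes [measurable]: "f \<in> borel_measurable borel"
  shows "superlevel f \<in> borel_measurable borel"
proof -
  have "(\<lambda>l. emeasure lborel {x. l < \<bar>f x\<bar>}) \<in> borel_measurable borel" by measurable
  then show ?thesis unfolding superlevel_def measure_def by measurable
qed

lemma regular_level_measurable[measurable]:
  assumes [measurable]: "f \<in> borel_measurable borel"
  shows "Measurable.pred borel (regular_level f)"
proof -
  have "(\<lambda>l. emeasure lborel {x. \<bar>f x\<bar> = l}) \<in> borel_measurable borel" by measurable
  then show ?thesis unfolding regular_level_def by measurable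
qed

text \<open>Fubini for the graph of |f|: its fibre over each \<open>x\<close> is a single point and
  therefore null.\<close>

lemma AE_regular_level:
  assumes [measurable]: "f \<in> borel_measurable borel"
  shows "AE l in lborel. 0 < l \<longrightarrow> regular_level f l"
proof -
  have m: "(\<lambda>l. emeasure lborel {x. \<bar>f x\<bar> = l}) \<in> borel_measurable lborel" by measurable
  have "(\<integral>\<^sup>+ l. emeasure lborel {x. \<bar>f x\<bar> = l} \<partial>lborel) = (\<integral>\<^sup>+ l. \<integral>\<^sup>+ x. indicator {(x, l). \<bar>f x\<bar> = l} (x, l) \<partial>lborel \<partial>lborel)"
  proof (rule nn_integral_cong)
    fix l
    have "indicator {(x, l). \<bar>f x\<bar> = l} (x, l) = (indicator {x. \<bar>f x\<bar> = l} x :: ennreal)" for x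
      by (simp add: indicator_def)
    then show "emeasure lborel {x. \<bar>f x\<bar> = l} = (\<integral>\<^sup>+ x. indicator {(x, l). \<bar>f x\<bar> = l} (x, l) \<partial>lborel)" by simp
  qed
  also have "\<dots> = (\<integral>\<^sup>+ x. \<integral>\<^sup>+ l. indicator {(x, l). \<bar>f x\<bar> = l} (x, l) \<partial>lborel \<partial>lborel)"
    by (rule lborel_pair.Fubini') measurable
  also have "\<dots> = (\<integral>\<^sup>+ (x::'a). 0 \<partial>lborel)"
  proof (rule nn_integral_cong)
    fix x
    have "indicator {(x, l). \<bar>f x\<bar> = l} (x, l) = (indicator {\<bar>f x\<bar>} l :: ennreal)" for l
      by (auto simp: indicator_def)
    then show "(\<integral>\<^sup>+ l. indicator {(x, l). \<bar>f x\<bar> = l} (x, l) \<partial>lborel) = 0" by simp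
  qed
  finally have "AE l in lborel. emeasure lborel {x. \<bar>f x\<bar> = l} = 0"
    using nn_integral_0_iff_AE[OF m] by simp
  then show ?thesis by eventually_elim (simp add: regular_level_def)
qed

context
  fixes f :: "'a::euclidean_space \<Rightarrow> real"
  assumes f[measurable]: "f \<in> borel_measurable borel"
    and fin: "\<And>l. 0 < l \<Longrightarrow> emeasure lborel {x. l < \<bar>f x\<bar>} < \<infinity>"
begin

lemma emeasure_superlevel: "0 < l \<Longrightarrow> emeasure lborel {x. l < \<bar>f x\<bar>} = ennreal (superlevel f l)"
  unfolding superlevel_def using fin[of l] by (intro emeasure_eq_ennreal_measure) auto

lemma superlevel_antimono: "0 < l \<Longrightarrow> l \<le> l' \<Longrightarrow> superlevel f l' \<le> superlevel f l"
  unfolding superlevel_def using fin[of l]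
  by (intro measure_mono_fmeasurable) (auto simp: fmeasurable_def)

text \<open>On the regular levels \<open>superlevel f \<bar>f x\<bar>\<close> behaves like a uniformly distributed variable; the plateaus
  of \<open>f\<close> have to be left out for this.\<close>

lemma emeasure_superlevel_between:
  assumes r: "0 \<le> r" "r \<le> t"
  shows "emeasure lborel {x. regular_level f \<bar>f x\<bar> \<and> r < superlevel f \<bar>f x\<bar> \<and> superlevel f \<bar>f x\<bar> \<le> t} \<le> ennreal (t - r)"
    (is "emeasure lborel ?X \<le> _")
proof (cases "?X = {}")
  case False
  define E s where "E = regular_level f" and "s = superlevel f"
  have [measurable]: "Measurable.pred borel E" "s \<in> borel_measurable borel" unfolding E_def s_def by auto
  define X where "X = {x. E \<bar>f x\<bar> \<and> r < s \<bar>f x\<bar> \<and> s \<bar>f x\<bar> \<le> t}"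
  have Xm[measurable]: "X \<in> sets borel" unfolding X_def by measurable
  obtain x0 where x0: "x0 \<in> X" using False unfolding X_def E_def s_def by blast
  have Epos: "0 < l" if "E l" for l using that by (simp add: E_def regular_level_def)
  \<comment> \<open>The intersection with the regular levels makes this a null set for every
    \<open>l\<close>, in particular for the end levels \<open>l0\<close> and \<open>Sup Y\<close>,
    whose regularity is not known.\<close>
  define Z where "Z = (\<lambda>l. {x. E \<bar>f x\<bar> \<and> \<bar>f x\<bar> = l})"
  have Z: "Z l \<in> null_sets lborel" for l
  proof (cases "E l")
    case True
    then have "Z l = {x. \<bar>f x\<bar> = l}" by (auto simp: Z_def)
    then show ?thesis using True by (auto simp: E_def regular_level_def null_sets_def)
  next
    case False
    then have "Z l = {}" by (auto simp: Z_def)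
    then show ?thesis by simp
  qed
  have [measurable]: "Z l \<in> sets borel" for l using Z[of l] by (auto simp: null_sets_def)
  \<comment> \<open>\<open>l0\<close> below is a lower bound for the levels met by \<open>X\<close>.
    It need not belong to \<open>T\<close>, yet the superlevel sets exhaust {l0 < |f|} as the level
    decreases to \<open>l0\<close>, so this set still has measure at most \<open>t\<close>.\<close>
  define T where "T = {l. 0 < l \<and> s l \<le> t}"
  define l0 where "l0 = Inf T"
  have XT: "\<bar>f x\<bar> \<in> T" if "x \<in> X" for x using that Epos[of "\<bar>f x\<bar>"] by (auto simp: X_def T_def)
  have bT: "bdd_below T" by (rule bdd_belowI[of _ 0]) (auto simp: T_def)
  have neT: "T \<noteq> {}" using XT[OF x0] by blast
  have l0_nonneg: "0 \<le> l0" unfolding l0_def by (rule cInf_greatest[OF neT]) (auto simp: T_def)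
  have l0_le: "l0 \<le> \<bar>f x\<bar>" if "x \<in> X" for x unfolding l0_def using XT[OF that] bT by (rule cInf_lower)
  have V: "emeasure lborel {x. l0 < \<bar>f x\<bar>} \<le> ennreal t"
  proof -
    define W where "W = (\<lambda>k::nat. {x. l0 + 1 / real (Suc k) < \<bar>f x\<bar>})"
    have "incseq W" unfolding W_def
    proof (rule incseq_SucI, rule Collect_mono, rule impI)
      fix k x assume "l0 + 1 / real (Suc k) < \<bar>f x\<bar>"
      moreover have "1 / real (Suc (Suc k)) \<le> 1 / real (Suc k)" by (intro divide_left_mono) auto
      ultimately show "l0 + 1 / real (Suc (Suc k)) < \<bar>f x\<bar>" by linarith
    qed
    moreover have "range W \<subseteq> sets lborel" unfolding W_def by auto
    moreover have "(\<Union>k. W k) = {x. l0 < \<bar>f x\<bar>}"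
    proof -
      have "\<exists>k. l0 + 1 / real (Suc k) < l" if l: "l0 < l" for l
        using reals_Archimedean[of "l - l0"] l by (auto simp: inverse_eq_divide algebra_simps)
      moreover have "l0 < l" if "l0 + 1 / real (Suc k) < l" for k l
        using that by (smt (verit) divide_pos_pos of_nat_0_less_iff zero_less_Suc)
      ultimately show ?thesis unfolding W_def by blast
    qed
    moreover have "emeasure lborel (W k) \<le> ennreal t" for k
    proof -
      have "l0 < l0 + 1 / real (Suc k)" by simp
      then obtain l where l: "l \<in> T" "l < l0 + 1 / real (Suc k)"
        unfolding l0_def using cInf_less_iff[OF neT bT] by blast
      then have "s (l0 + 1 / real (Suc k)) \<le> t"
        using superlevel_antimono[of l "l0 + 1 / real (Suc k)"] by (auto simp: s_def T_def)
      moreover have "emeasure lborel (W k) = ennreal (s (l0 + 1 / real (Suc k)))"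
        unfolding W_def s_def using l0_nonneg by (intro emeasure_superlevel) (simp add: add_nonneg_pos)
      ultimately show ?thesis by (simp add: ennreal_leI)
    qed
    ultimately show ?thesis using SUP_emeasure_incseq[of W lborel] by (metis (mono_tags, lifting) SUP_least)
  qed
  \<comment> \<open>The points of \<open>X\<close> with values up to \<open>l\<close>, apart from
    the level \<open>l0\<close>, and the set {l < |f|} are disjoint parts of {l0 < |f|}. This leaves
    at most \<open>t - s l\<close>, which is below \<open>t - r\<close>.\<close>
  have part: "emeasure lborel (X \<inter> {x. \<bar>f x\<bar> \<le> l}) \<le> ennreal (t - r)" if l: "0 < l" "r < s l" for l
  proof (cases "l < l0")
    case True
    then have "X \<inter> {x. \<bar>f x\<bar> \<le> l} = {}" using l0_le by fastforce
    then show ?thesis by simp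
  next
    case False
    define X1 where "X1 = X \<inter> {x. \<bar>f x\<bar> \<le> l} - Z l0"
    have [measurable]: "X1 \<in> sets borel" unfolding X1_def by measurable
    have "l0 < \<bar>f x\<bar>" if "x \<in> X1" for x
      using that l0_le[of x] by (auto simp: X1_def Z_def X_def)
    then have sub: "X1 \<union> {x. l < \<bar>f x\<bar>} \<subseteq> {x. l0 < \<bar>f x\<bar>}" using False by auto
    have "emeasure lborel X1 + ennreal (s l) = emeasure lborel X1 + emeasure lborel {x. l < \<bar>f x\<bar>}"
      using emeasure_superlevel[OF l(1)] by (simp add: s_def)
    also have "\<dots> = emeasure lborel (X1 \<union> {x. l < \<bar>f x\<bar>})"
      by (rule plus_emeasure) (auto simp: X1_def)
    also have "\<dots> \<le> ennreal t" using emeasure_mono[OF sub, of lborel] V by simp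
    finally have le: "emeasure lborel X1 + ennreal (s l) \<le> ennreal t" .
    then have "emeasure lborel X1 \<noteq> \<infinity>" by (auto simp: top_unique)
    then obtain b where b: "emeasure lborel X1 = ennreal b" "0 \<le> b" by (cases "emeasure lborel X1") auto
    have "0 \<le> s l" by (simp add: s_def superlevel_def)
    then have "b + s l \<le> t"
      using le b r by (simp add: ennreal_plus[symmetric] ennreal_le_iff del: ennreal_plus)
    then have "emeasure lborel X1 \<le> ennreal (t - r)" unfolding b(1) using l by (intro ennreal_leI) simp
    moreover have "emeasure lborel (X \<inter> {x. \<bar>f x\<bar> \<le> l}) = emeasure lborel X1"
      unfolding X1_def by (rule emeasure_Diff_null_set[symmetric]) (auto intro: Z)
    ultimately show ?thesis by simp
  qed
  \<comment> \<open>The levels with \<open>r < s l\<close> are exhausted from below by a sequence,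
    with the supremum in \<open>ennreal\<close> since it may be infinite. If no member of the
    sequence reaches |f x|, then |f x| is that supremum and \<open>x\<close> lies in a null set
    \<open>Z\<close>.\<close>
  define Y where "Y = ennreal ` {l. 0 < l \<and> r < s l}"
  have XY: "ennreal \<bar>f x\<bar> \<in> Y" if "x \<in> X" for x using that Epos[of "\<bar>f x\<bar>"] by (auto simp: X_def Y_def)
  then have "Y \<noteq> {}" using x0 by blast
  then obtain F :: "nat \<Rightarrow> ennreal" where F: "incseq F" "range F \<subseteq> Y" "Sup Y = (SUP i. F i)"
    using ennreal_Sup_countable_SUP by metis
  define a where "a = (\<lambda>i. enn2real (F i))"
  have a: "0 < a i" "r < s (a i)" "F i = ennreal (a i)" for i
  proof -
    have "F i \<in> Y" using F(2) by blast
    then obtain l where "F i = ennreal l" "0 < l" "r < s l" unfolding Y_def by blast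
    then show "0 < a i" "r < s (a i)" "F i = ennreal (a i)" by (auto simp: a_def)
  qed
  define U where "U = (\<lambda>i. X \<inter> {x. \<bar>f x\<bar> \<le> a i})"
  have "incseq U"
  proof -
    have "a i \<le> a j" if "i \<le> j" for i j
      using incseqD[OF F(1) that] a(1)[of i] a(1)[of j] unfolding a(3) by (simp add: ennreal_le_iff)
    then show ?thesis unfolding incseq_def U_def by fastforce
  qed
  moreover have Um: "range U \<subseteq> sets lborel" unfolding U_def by auto
  ultimately have "emeasure lborel (\<Union>i. U i) = (SUP i. emeasure lborel (U i))"
    using SUP_emeasure_incseq[of U lborel] by simp
  also have "\<dots> \<le> ennreal (t - r)" unfolding U_def by (intro SUP_least part a)
  finally have UU: "emeasure lborel (\<Union>i. U i) \<le> ennreal (t - r)" .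
  have "X \<subseteq> (\<Union>i. U i) \<union> Z (enn2real (Sup Y))"
  proof
    fix x assume x: "x \<in> X"
    show "x \<in> (\<Union>i. U i) \<union> Z (enn2real (Sup Y))"
    proof (cases "\<exists>i. \<bar>f x\<bar> \<le> a i")
      case True
      then show ?thesis using x by (auto simp: U_def)
    next
      case False
      then have "F i \<le> ennreal \<bar>f x\<bar>" for i unfolding a(3) by (intro ennreal_leI) (meson linear)
      then have "Sup Y \<le> ennreal \<bar>f x\<bar>" unfolding F(3) by (rule SUP_least)
      then have "Sup Y = ennreal \<bar>f x\<bar>" using XY[OF x] by (intro order_antisym Sup_upper)
      then show ?thesis using x by (simp add: Z_def X_def)
    qed
  qed
  then have "emeasure lborel X \<le> emeasure lborel ((\<Union>i. U i) \<union> Z (enn2real (Sup Y)))"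
    using Um by (intro emeasure_mono) (auto intro!: sets.Un)
  also have "\<dots> = emeasure lborel (\<Union>i. U i)"
    using Um Z by (intro emeasure_Un_null_set) auto
  finally have "emeasure lborel X \<le> ennreal (t - r)" using UU by simp
  then show ?thesis by (simp add: X_def E_def s_def)
next
  case True
  show ?thesis unfolding True by simp
qed

text \<open>The image of Lebesgue measure under the superlevel value, restricted to regular levels,
  gives every interval at most its length. It can be strictly smaller than Lebesgue measure, as a
  plateau leaves a gap in the range of the distribution function.\<close>

lemma nn_integral_superlevel_le:
  assumes h[measurable]: "h \<in> borel_measurable borel"
  shows "(\<integral>\<^sup>+ x. h (superlevel f \<bar>f x\<bar>) * indicator {x. regular_level f \<bar>f x\<bar> \<and> 0 < superlevel f \<bar>f x\<bar>} x \<partial>lborel)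
    \<le> (\<integral>\<^sup>+ r. h r \<partial>lborel)"
proof -
  define S where "S = {x. regular_level f \<bar>f x\<bar> \<and> 0 < superlevel f \<bar>f x\<bar>}"
  have [measurable]: "S \<in> sets borel" unfolding S_def by measurable
  define P where "P = distr (density lborel (indicator S)) borel (\<lambda>x. superlevel f \<bar>f x\<bar>)"
  have sP: "sets P = sets borel" by (simp add: P_def)
  have eP: "emeasure P A = emeasure lborel (S \<inter> {x. superlevel f \<bar>f x\<bar> \<in> A})" if [measurable]: "A \<in> sets borel" for A
  proof -
    have v: "(\<lambda>x. superlevel f \<bar>f x\<bar>) -` A = {x. superlevel f \<bar>f x\<bar> \<in> A}" by auto
    have "emeasure P A = emeasure (density lborel (indicator S)) {x. superlevel f \<bar>f x\<bar> \<in> A}"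
      unfolding P_def by (subst emeasure_distr) (auto simp: v)
    also have "\<dots> = (\<integral>\<^sup>+ x. indicator S x * indicator {x. superlevel f \<bar>f x\<bar> \<in> A} x \<partial>lborel)"
      by (rule emeasure_density) auto
    also have "\<dots> = (\<integral>\<^sup>+ x. indicator (S \<inter> {x. superlevel f \<bar>f x\<bar> \<in> A}) x \<partial>lborel)"
      by (simp only: indicator_inter_arith)
    also have "\<dots> = emeasure lborel (S \<inter> {x. superlevel f \<bar>f x\<bar> \<in> A})" by (rule nn_integral_indicator) simp
    finally show ?thesis .
  qed
  have "P \<le> lborel"
  proof (rule measure_le_lborel[OF sP])
    fix a b :: real assume ab: "a < b"
    show "emeasure P {a<..b} \<le> ennreal (b - a)"
    proof (cases "0 < b")
      case True
      \<comment> \<open>\<open>max a 0\<close>, because the interval bound is for nonnegative lower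
        ends; on \<open>S\<close> all superlevel values are positive.\<close>
      have "emeasure P {a<..b} \<le> emeasure lborel {x. regular_level f \<bar>f x\<bar> \<and> max a 0 < superlevel f \<bar>f x\<bar> \<and> superlevel f \<bar>f x\<bar> \<le> b}"
        by (subst eP) (auto intro!: emeasure_mono simp: S_def)
      also have "\<dots> \<le> ennreal (b - max a 0)" using ab True by (intro emeasure_superlevel_between) auto
      also have "\<dots> \<le> ennreal (b - a)" by (intro ennreal_leI) simp
      finally show ?thesis .
    next
      case False
      then have "S \<inter> {x. superlevel f \<bar>f x\<bar> \<in> {a<..b}} = {}" by (auto simp: S_def)
      then show ?thesis by (simp add: eP)
    qed
  qed
  then have "(\<integral>\<^sup>+ r. h r \<partial>P) \<le> (\<integral>\<^sup>+ r. h r \<partial>lborel)"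
    by (intro nn_integral_mono_measure) (simp_all add: sP)
  moreover have "(\<integral>\<^sup>+ r. h r \<partial>P) = (\<integral>\<^sup>+ x. h (superlevel f \<bar>f x\<bar>) * indicator S x \<partial>lborel)"
    unfolding P_def by (subst nn_integral_distr, simp, simp, subst nn_integral_density) (auto simp: mult.commute)
  ultimately show ?thesis by (simp add: S_def)
qed

end

section \<open>Rearrangements and Hardy's inequality\<close>

lemma ennpowr_mono: "x \<le> y \<Longrightarrow> 0 \<le> a \<Longrightarrow> ennpowr x a \<le> ennpowr y a"
  unfolding ennpowr_def
  by (auto simp: top_unique less_top intro!: ennreal_leI powr_mono2 enn2real_mono)

lemma ennpowr_mult_ennreal:
  assumes k: "0 < k" shows "ennpowr (x * ennreal k) a = ennpowr x a * ennreal (k powr a)"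
proof (cases "x = \<infinity>")
  case True
  then show ?thesis using k by (simp add: ennpowr_def ennreal_top_mult)
next
  case False
  then have "x * ennreal k \<noteq> \<infinity>" by (simp add: ennreal_mult_eq_top_iff)
  then show ?thesis using k False
    by (simp add: ennpowr_def enn2real_mult powr_mult ennreal_mult)
qed

lemma nn_integral_powr_from_0:
  fixes t e :: real assumes "-1 < e" "0 \<le> t"
  shows "(\<integral>\<^sup>+ r\<in>{0..t}. ennreal (r powr e) \<partial>lborel) = ennreal (t powr (e + 1) / (e + 1))"
proof -
  have "(\<integral>\<^sup>+ r\<in>{0..t}. ennreal (r powr e) \<partial>lborel) = (\<integral>\<^sup>+ r. ennreal (indicator {0..t} r * r powr e) \<partial>lborel)"
    by (intro nn_integral_cong) (auto split: split_indicator)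
  also have "\<dots> = ennreal (t powr (e + 1) / (e + 1))"
    by (rule nn_integral_has_integral_lebesgue) (use assms has_integral_powr_from_0 in auto)
  finally show ?thesis .
qed

lemma nn_integral_powr_to_inf:
  fixes s e :: real assumes "e < -1" "0 < s"
  shows "(\<integral>\<^sup>+ r\<in>{s..}. ennreal (r powr e) \<partial>lborel) = ennreal (s powr (e + 1) / (- e - 1))"
proof -
  have "(\<integral>\<^sup>+ r\<in>{s..}. ennreal (r powr e) \<partial>lborel) = (\<integral>\<^sup>+ r. ennreal (indicator {s..} r * r powr e) \<partial>lborel)"
    by (intro nn_integral_cong) (auto split: split_indicator)
  also have "\<dots> = ennreal (- (s powr (e + 1)) / (e + 1))"
    by (rule nn_integral_has_integral_lebesgue) (use assms has_integral_powr_to_inf in auto)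
  also have "- (s powr (e + 1)) / (e + 1) = s powr (e + 1) / (- e - 1)"
    using assms by (auto simp: divide_simps algebra_simps)
  finally show ?thesis .
qed

lemma emeasure_lebesgue_borel: "A \<in> sets borel \<Longrightarrow> emeasure lebesgue A = emeasure lborel A"
  by (simp add: emeasure_completion main_part_sets)

context
  fixes f :: "real ^ 'n \<Rightarrow> real"
  assumes f[measurable]: "f \<in> borel_measurable borel"
    and fin: "\<And>l. 0 < l \<Longrightarrow> emeasure lborel {x. l < \<bar>f x\<bar>} < \<infinity>"
begin

lemma decr_rearr_eq: "decr_rearr f t = Inf {ennreal l | l. 0 < l \<and> ennreal (superlevel f l) \<le> ennreal t}"
proof -
  have "emeasure lebesgue {x. l < \<bar>f x\<bar>} = ennreal (superlevel f l)" if "0 < l" for l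
    using emeasure_superlevel[OF f fin that] by (subst emeasure_lebesgue_borel) auto
  then show ?thesis unfolding decr_rearr_def by (intro arg_cong[where f=Inf]) auto
qed

lemma decr_rearr_le: "0 < l \<Longrightarrow> ennreal (superlevel f l) \<le> ennreal t \<Longrightarrow> decr_rearr f t \<le> ennreal l"
  unfolding decr_rearr_eq by (rule Inf_lower) blast

text \<open>\<open>f\<close> is real-valued, so the superlevel sets decrease to the empty set, and
  by continuity from above their measure drops below \<open>t\<close>.\<close>

lemma decr_rearr_finite:
  assumes t: "0 < t" shows "decr_rearr f t < \<infinity>"
proof -
  define A where "A = (\<lambda>k::nat. {x. real (Suc k) < \<bar>f x\<bar>})"
  have "(INF k. emeasure lborel (A k)) = emeasure lborel (\<Inter>k. A k)"
  proof (rule INF_emeasure_decseq)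
    show "range A \<subseteq> sets lborel" by (auto simp: A_def)
    show "decseq A" by (rule decseq_SucI) (auto simp: A_def)
    show "emeasure lborel (A k) \<noteq> \<infinity>" for k using fin[of "real (Suc k)"] by (simp add: A_def)
  qed
  also have "(\<Inter>k. A k) = {}"
  proof -
    have "\<exists>k. \<not> real (Suc k) < y" for y :: real
      using reals_Archimedean2[of y] by (metis less_trans not_less_iff_gr_or_eq of_nat_less_iff lessI)
    then show ?thesis unfolding A_def by blast
  qed
  finally have "(INF k. emeasure lborel (A k)) < ennreal t" using t by simp
  then obtain k where "emeasure lborel (A k) < ennreal t" by (auto simp: INF_less_iff)
  moreover have "emeasure lborel (A k) = ennreal (superlevel f (real (Suc k)))"
    unfolding A_def by (rule emeasure_superlevel[OF f fin]) simp_all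
  ultimately have "decr_rearr f t \<le> ennreal (real (Suc k))" by (intro decr_rearr_le) auto
  then show ?thesis by (auto simp: less_top[symmetric] top_unique)
qed

lemma superlevel_le_of_decr_rearr_less:
  assumes l: "decr_rearr f t < ennreal l" and t: "0 \<le> t" shows "superlevel f l \<le> t"
proof -
  obtain l' where l': "0 < l'" "ennreal (superlevel f l') \<le> ennreal t" "ennreal l' < ennreal l"
    using l unfolding decr_rearr_eq Inf_less_iff by blast
  then have "superlevel f l \<le> superlevel f l'"
    by (intro superlevel_antimono[OF f fin]) (auto simp: ennreal_less_iff)
  then show ?thesis using l' t by (simp add: ennreal_le_iff)
qed

text \<open>Both sides are equal to \<open>(\<integral> \<mu>(\<lambda>) d\<lambda>) / t\<close> over \<open>\<lambda> > f\<^sup>*(t)\<close>, \<open>\<mu>\<close> being the distribution function; only one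
  inequality is needed.\<close>

lemma hardy_minus_decr_rearr_le:
  assumes t: "0 < t"
  shows "hardy_rearr f t - decr_rearr f t
    \<le> (\<integral>\<^sup>+ l\<in>{l. decr_rearr f t < ennreal l}. ennreal (superlevel f l) \<partial>lborel) * ennreal (1 / t)"
proof -
  define R where "R = decr_rearr f t"
  obtain \<rho> where \<rho>: "R = ennreal \<rho>" "0 \<le> \<rho>" using decr_rearr_finite[OF t] unfolding R_def by (cases "decr_rearr f t") auto
  define J where "J = (\<integral>\<^sup>+ l\<in>{\<rho><..}. ennreal (superlevel f l) \<partial>lborel)"
  have set_eq: "{l. R < ennreal l} = {\<rho><..}" unfolding \<rho> using \<rho>(2) by (auto simp: ennreal_less_iff)
  \<comment> \<open>The layers above \<open>\<rho>\<close>: integrated over \<open>l\<close>,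
    \<open>H s l\<close> majorizes the excess of \<open>decr_rearr f s\<close> over
    \<open>R\<close>; integrated over \<open>s\<close>, it is at most
    \<open>superlevel f l\<close>.\<close>
  define H where "H = (\<lambda>s l. indicator {\<rho><..} l * indicator {s. s < superlevel f l} s :: ennreal)"
  have Hm[measurable]: "case_prod H \<in> borel_measurable (borel \<Otimes>\<^sub>M borel)" unfolding H_def by measurable
  have pt: "decr_rearr f s \<le> R + (\<integral>\<^sup>+ l. H s l \<partial>lborel)" if s: "0 \<le> s" for s
  proof -
    have sub: "{l. \<rho> < l \<and> ennreal l < decr_rearr f s} \<subseteq> {l. \<rho> < l \<and> s < superlevel f l}"
    proof safe
      fix l assume l: "\<rho> < l" "ennreal l < decr_rearr f s"
      show "s < superlevel f l"
      proof (rule ccontr)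
        assume "\<not> s < superlevel f l"
        then have "decr_rearr f s \<le> ennreal l" using l \<rho> by (intro decr_rearr_le ennreal_leI) auto
        then show False using l by simp
      qed
    qed
    have "decr_rearr f s \<le> R + emeasure lborel {l. \<rho> < l \<and> ennreal l < decr_rearr f s}"
    proof (cases "decr_rearr f s")
      case (real d)
      then have "{l. \<rho> < l \<and> ennreal l < decr_rearr f s} = {\<rho><..<d}" using \<rho> by (auto simp: ennreal_less_iff)
      moreover have "ennreal d \<le> ennreal \<rho> + ennreal (d - \<rho>)" if "\<rho> \<le> d"
        using that \<rho> by (simp add: ennreal_plus[symmetric] del: ennreal_plus)
      moreover have "ennreal d \<le> ennreal \<rho>" if "d \<le> \<rho>" using that by (rule ennreal_leI)
      ultimately show ?thesis using real \<rho> by (cases "\<rho> \<le> d") (auto simp: add_increasing2)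
    next
      \<comment> \<open>This can occur at \<open>s = 0\<close> only, where the rearrangement is the
        essential supremum.\<close>
      case top
      then have "{l. \<rho> < l \<and> ennreal l < decr_rearr f s} = {\<rho><..}" by auto
      moreover have "emeasure lborel {\<rho><..} = \<infinity>"
      proof (rule ccontr)
        assume "emeasure lborel {\<rho><..} \<noteq> \<infinity>"
        then obtain b where b: "emeasure lborel {\<rho><..} = ennreal b" "0 \<le> b" by (cases "emeasure lborel {\<rho><..}") auto
        have "emeasure lborel {\<rho><..\<rho> + (b + 1)} \<le> emeasure lborel {\<rho><..}" by (intro emeasure_mono) auto
        then show False using b by (simp add: ennreal_le_iff)
      qed
      ultimately show ?thesis by simp
    qed
    also have "\<dots> \<le> R + emeasure lborel {l. \<rho> < l \<and> s < superlevel f l}"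
      by (intro add_left_mono emeasure_mono sub) (use f in measurable)
    also have "emeasure lborel {l. \<rho> < l \<and> s < superlevel f l} = (\<integral>\<^sup>+ l. indicator {l. \<rho> < l \<and> s < superlevel f l} l \<partial>lborel)"
      by (rule nn_integral_indicator[symmetric]) (use f in measurable)
    also have "\<dots> = (\<integral>\<^sup>+ l. H s l \<partial>lborel)"
      by (intro nn_integral_cong) (auto simp: H_def indicator_def)
    finally show ?thesis .
  qed
  have "(\<integral>\<^sup>+ s\<in>{0..t}. decr_rearr f s \<partial>lborel) \<le> (\<integral>\<^sup>+ s. R * indicator {0..t} s + (\<integral>\<^sup>+ l. H s l \<partial>lborel) * indicator {0..t} s \<partial>lborel)"
    using pt by (intro nn_integral_mono) (auto split: split_indicator)
  also have "\<dots> = R * ennreal t + (\<integral>\<^sup>+ s. \<integral>\<^sup>+ l. H s l * indicator {0..t} s \<partial>lborel \<partial>lborel)"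
  proof (subst nn_integral_add)
    show "(\<integral>\<^sup>+ s. R * indicator {0..t} s \<partial>lborel) + (\<integral>\<^sup>+ s. (\<integral>\<^sup>+ l. H s l \<partial>lborel) * indicator {0..t} s \<partial>lborel)
       = R * ennreal t + (\<integral>\<^sup>+ s. \<integral>\<^sup>+ l. H s l * indicator {0..t} s \<partial>lborel \<partial>lborel)"
      using t by (subst nn_integral_cmult_indicator) (auto simp: nn_integral_multc[symmetric])
  qed measurable
  also have "(\<integral>\<^sup>+ s. \<integral>\<^sup>+ l. H s l * indicator {0..t} s \<partial>lborel \<partial>lborel) = (\<integral>\<^sup>+ l. \<integral>\<^sup>+ s. H s l * indicator {0..t} s \<partial>lborel \<partial>lborel)"
    by (rule lborel_pair.Fubini'[symmetric]) measurable
  also have "\<dots> \<le> J"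
    unfolding J_def
  proof (rule nn_integral_mono)
    fix l
    have "(\<integral>\<^sup>+ s. H s l * indicator {0..t} s \<partial>lborel) \<le> (\<integral>\<^sup>+ s. indicator {\<rho><..} l * indicator {0..superlevel f l} s \<partial>lborel)"
      by (intro nn_integral_mono) (auto simp: H_def split: split_indicator)
    also have "\<dots> = indicator {\<rho><..} l * ennreal (superlevel f l)"
      by (subst nn_integral_cmult_indicator) (auto simp: superlevel_def)
    finally show "(\<integral>\<^sup>+ s. H s l * indicator {0..t} s \<partial>lborel) \<le> ennreal (superlevel f l) * indicator {\<rho><..} l"
      by (simp add: mult.commute)
  qed
  finally have "(\<integral>\<^sup>+ s\<in>{0..t}. decr_rearr f s \<partial>lborel) \<le> R * ennreal t + J" by simp
  then have "hardy_rearr f t \<le> (R * ennreal t + J) / ennreal t"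
    unfolding hardy_rearr_def by (rule divide_right_mono_ennreal)
  also have "\<dots> = (R * ennreal t + J) * ennreal (1 / t)"
    using t by (simp add: divide_ennreal_def inverse_ennreal inverse_eq_divide)
  also have "\<dots> = R + J * ennreal (1 / t)"
    using t by (simp add: distrib_right mult.assoc ennreal_mult[symmetric])
  finally have "hardy_rearr f t - R \<le> J * ennreal (1 / t)"
    using \<rho> by (simp add: ennreal_minus_le_iff)
  then show ?thesis unfolding R_def[symmetric] set_eq J_def .
qed

end

text \<open>By \<open>iso\<close> the difference \<open>hardy_rearr f t - decr_rearr f t\<close> is
  at most a multiple of the average, over {s \<le> t}, of s^(1/n) G. As s transports Lebesgue
  measure to at most Lebesgue measure, the one-dimensional proof of Hardy's inequality carries over
  with its sharp constant.\<close>

theorem hardy_rearr_inequality: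
  fixes f :: "real ^ 'n \<Rightarrow> real" and G :: "real ^ 'n \<Rightarrow> real"
  assumes f[measurable]: "f \<in> borel_measurable borel"
    and fin: "\<And>l. 0 < l \<Longrightarrow> emeasure lborel {x. l < \<bar>f x\<bar>} < \<infinity>"
    and G[measurable]: "G \<in> borel_measurable borel" and Gpos: "\<And>x. 0 \<le> G x"
    and n: "2 \<le> n" and c: "0 < c" and p: "1 \<le> p"
    and iso: "\<And>\<psi>. \<psi> \<in> borel_measurable borel \<Longrightarrow>
      (\<integral>\<^sup>+ l\<in>{0<..}. \<psi> l * ennreal (c * superlevel f l powr (1 - 1 / n)) \<partial>lborel)
     \<le> (\<integral>\<^sup>+ x. \<psi> \<bar>f x\<bar> * indicator {0<..} \<bar>f x\<bar> * ennreal (G x) \<partial>lborel)"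
  shows "(\<integral>\<^sup>+ t\<in>{0<..}. ennpowr (hardy_rearr f t - decr_rearr f t) p / ennreal (t powr (p / n)) \<partial>lborel)
    \<le> ennreal ((c * (1 - (1 / p - 1 / n))) powr (- p)) * (\<integral>\<^sup>+ x. ennreal (G x powr p) \<partial>lborel)"
proof -
  define \<beta> where "\<beta> = 1 / p - 1 / n"
  define K where "K = 1 - \<beta>"
  have \<beta>: "\<beta> < 1"
  proof -
    have "1 / p \<le> 1" "0 < 1 / n" using p n by auto
    then show ?thesis unfolding \<beta>_def by linarith
  qed
  then have K: "0 < K" by (simp add: K_def)
  have pn: "p / n = 1 - p * \<beta>" using p n by (simp add: \<beta>_def right_diff_distrib)
  define s where "s = (\<lambda>x. superlevel f \<bar>f x\<bar>)"
  define S where "S = {x. regular_level f \<bar>f x\<bar> \<and> 0 < s x}"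
  have s0: "0 \<le> s x" for x by (simp add: s_def superlevel_def)
  have [measurable]: "s \<in> borel_measurable borel" unfolding s_def by measurable
  have [measurable]: "S \<in> sets borel" unfolding S_def by measurable
  define St where "St = (\<lambda>t. {x. x \<in> S \<and> s x \<le> t})"
  have [measurable]: "St t \<in> sets borel" for t unfolding St_def by measurable
  have step1: "hardy_rearr f t - decr_rearr f t
      \<le> (\<integral>\<^sup>+ x. ennreal (s x powr (1 / n) * G x * indicator (St t) x) \<partial>lborel) * ennreal (1 / (c * t))" if t: "0 < t" for t
  proof -
    define R where "R = decr_rearr f t"
    define J where "J = (\<integral>\<^sup>+ l\<in>{l. R < ennreal l}. ennreal (superlevel f l) \<partial>lborel)"
    \<comment> \<open>Restricting to regular levels changes only a null set of levels on the left,
      but removes the plateaus from the integral over \<open>x\<close> on the right.\<close>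
    define \<psi> where "\<psi> = (\<lambda>l. ennreal (superlevel f l powr (1 / n)) * indicator {l. R < ennreal l \<and> regular_level f l} l)"
    have [measurable]: "\<psi> \<in> borel_measurable borel" unfolding \<psi>_def by measurable
    have "ennreal c * J = (\<integral>\<^sup>+ l\<in>{l. R < ennreal l}. ennreal (c * superlevel f l) \<partial>lborel)"
      unfolding J_def using c
      by (subst nn_integral_cmult[symmetric]) (auto intro!: nn_integral_cong simp: ennreal_mult superlevel_def mult.assoc)
    also have "\<dots> \<le> (\<integral>\<^sup>+ l\<in>{0<..}. \<psi> l * ennreal (c * superlevel f l powr (1 - 1 / n)) \<partial>lborel)"
    proof (rule nn_integral_mono_AE, use AE_regular_level[OF f] in eventually_elim)
      case (elim l)
      show ?case
      proof (cases "R < ennreal l")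
        case True
        then have l: "0 < l" by (metis ennreal_less_zero_iff le_less_trans zero_le)
        have "superlevel f l powr (1 / n) * (c * superlevel f l powr (1 - 1 / n)) = c * superlevel f l"
        proof (cases "superlevel f l = 0")
          case False
          then have "0 < superlevel f l" by (simp add: superlevel_def order_less_le)
          then show ?thesis by (simp add: powr_add[symmetric] mult.left_commute)
        qed simp
        moreover have "\<psi> l * ennreal (c * superlevel f l powr (1 - 1 / n))
            = ennreal (superlevel f l powr (1 / n) * (c * superlevel f l powr (1 - 1 / n)))"
          using True elim l c by (simp add: \<psi>_def ennreal_mult'')
        ultimately have "\<psi> l * ennreal (c * superlevel f l powr (1 - 1 / n)) = ennreal (c * superlevel f l)"
          by (simp only:)
        then show ?thesis using True l by simp
      qed simp
    qed
    also have "\<dots> \<le> (\<integral>\<^sup>+ x. \<psi> \<bar>f x\<bar> * indicator {0<..} \<bar>f x\<bar> * ennreal (G x) \<partial>lborel)"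
      by (rule iso) measurable
    also have "\<dots> \<le> (\<integral>\<^sup>+ x. ennreal (s x powr (1 / n) * G x * indicator (St t) x) \<partial>lborel)"
    proof (rule nn_integral_mono)
      fix x
      show "\<psi> \<bar>f x\<bar> * indicator {0<..} \<bar>f x\<bar> * ennreal (G x) \<le> ennreal (s x powr (1 / n) * G x * indicator (St t) x)"
      \<comment> \<open>If \<open>s x = 0\<close>, then \<open>\<psi>\<close> vanishes at the level
        |f x|, because \<open>0 powr (1 / n) = 0\<close>.\<close>
      proof (cases "R < ennreal \<bar>f x\<bar> \<and> regular_level f \<bar>f x\<bar> \<and> s x \<noteq> 0")
        case True
        then have "s x \<le> t" unfolding s_def R_def using t by (intro superlevel_le_of_decr_rearr_less[OF f fin]) auto
        then have "x \<in> St t" using True s0[of x] by (auto simp: St_def S_def)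
        then show ?thesis using True Gpos[of x]
          by (simp add: \<psi>_def s_def ennreal_mult split: split_indicator)
      next
        case False
        then have "\<psi> \<bar>f x\<bar> = 0" by (auto simp: \<psi>_def s_def)
        then show ?thesis by simp
      qed
    qed
    finally have "ennreal c * J * ennreal (1 / (c * t))
        \<le> (\<integral>\<^sup>+ x. ennreal (s x powr (1 / n) * G x * indicator (St t) x) \<partial>lborel) * ennreal (1 / (c * t))"
      by (rule mult_right_mono) simp
    moreover have "ennreal c * J * ennreal (1 / (c * t)) = J * ennreal (1 / t)"
    proof -
      have "ennreal c * ennreal (1 / (c * t)) = ennreal (1 / t)"
        using c t by (simp add: ennreal_mult''[symmetric])
      then show ?thesis by (metis mult.assoc mult.commute)
    qed
    ultimately show ?thesis
      using hardy_minus_decr_rearr_le[OF f fin t] unfolding J_def R_def by simp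
  qed
  text \<open>The Hoelder exponent \<open>-\<beta>\<close> of the weight is the one which is optimal for Hardy's inequality.\<close>
  have step2: "ennpowr (hardy_rearr f t - decr_rearr f t) p / ennreal (t powr (p / n))
     \<le> ennreal (c powr (- p) * K powr (1 - p) * t powr (\<beta> - 2))
        * (\<integral>\<^sup>+ x. ennreal (s x powr K * G x powr p * indicator (St t) x) \<partial>lborel)" if t: "0 < t" for t
  proof -
    define w where "w = (\<lambda>x. s x powr (- \<beta>) * indicator (St t) x)"
    \<comment> \<open>The power of \<open>s\<close> is forced by 1/p - \<beta> = 1/n; it also turns
      \<open>F x powr p * w x\<close> into the weight s^K times G^p, with K = 1 - \<beta>.\<close>
    define F where "F = (\<lambda>x. s x powr (1 / p) * G x)"
    have [measurable]: "w \<in> borel_measurable borel" "F \<in> borel_measurable borel" unfolding w_def F_def by measurable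
    have Fw: "F x * w x = s x powr (1 / n) * G x * indicator (St t) x" for x
      unfolding F_def w_def by (auto simp: \<beta>_def powr_add[symmetric] mult_ac split: split_indicator)
    have Fpw: "F x powr p * w x = s x powr K * G x powr p * indicator (St t) x" for x
    proof (cases "x \<in> St t")
      case True
      then have "0 < s x" by (auto simp: St_def S_def)
      then show ?thesis using True Gpos[of x] p
        by (simp add: F_def w_def powr_mult powr_powr K_def powr_diff powr_minus field_simps)
    qed (simp add: w_def)
    have W: "(\<integral>\<^sup>+ x. ennreal (w x) \<partial>lborel) \<le> ennreal (t powr K / K)"
    proof -
      have "(\<integral>\<^sup>+ x. ennreal (w x) \<partial>lborel) = (\<integral>\<^sup>+ x. (ennreal (s x powr (- \<beta>)) * indicator {0..t} (s x)) * indicator S x \<partial>lborel)"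
        by (intro nn_integral_cong) (auto simp: w_def St_def s0 split: split_indicator)
      also have "\<dots> \<le> (\<integral>\<^sup>+ r\<in>{0..t}. ennreal (r powr (- \<beta>)) \<partial>lborel)"
        unfolding S_def s_def
        by (rule nn_integral_superlevel_le[OF f fin, where h="\<lambda>r. ennreal (r powr (- \<beta>)) * indicator {0..t} r"]) auto
      also have "\<dots> = ennreal (t powr K / K)"
        using \<beta> t by (subst nn_integral_powr_from_0) (auto simp: K_def)
      finally show ?thesis .
    qed
    then have "(\<integral>\<^sup>+ x. ennreal (w x) \<partial>lborel) \<noteq> \<infinity>" by (auto simp: top_unique)
    then obtain W0 where W0: "(\<integral>\<^sup>+ x. ennreal (w x) \<partial>lborel) = ennreal W0" "0 \<le> W0"
      by (cases "\<integral>\<^sup>+ x. ennreal (w x) \<partial>lborel") auto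
    have W0_le: "W0 \<le> t powr K / K" using W W0 K by (simp add: ennreal_le_iff)
    define I where "I = (\<integral>\<^sup>+ x. ennreal (s x powr K * G x powr p * indicator (St t) x) \<partial>lborel)"
    have "ennpowr (\<integral>\<^sup>+ x. ennreal (F x * w x) \<partial>lborel) p \<le> ennreal (W0 powr (p - 1)) * (\<integral>\<^sup>+ x. ennreal (F x powr p * w x) \<partial>lborel)"
      by (rule jensen_ennpowr) (use p W0 Gpos in \<open>auto simp: F_def w_def\<close>)
    also have "\<dots> \<le> ennreal ((t powr K / K) powr (p - 1)) * I"
      unfolding Fpw I_def[symmetric] using p W0 W0_le by (intro mult_right_mono ennreal_leI powr_mono2) auto
    finally have j: "ennpowr (\<integral>\<^sup>+ x. ennreal (s x powr (1 / n) * G x * indicator (St t) x) \<partial>lborel) p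
        \<le> ennreal ((t powr K / K) powr (p - 1)) * I" unfolding Fw .
    have "ennpowr (hardy_rearr f t - decr_rearr f t) p
       \<le> ennpowr ((\<integral>\<^sup>+ x. ennreal (s x powr (1 / n) * G x * indicator (St t) x) \<partial>lborel) * ennreal (1 / (c * t))) p"
      using p by (intro ennpowr_mono step1 t) auto
    also have "\<dots> = ennpowr (\<integral>\<^sup>+ x. ennreal (s x powr (1 / n) * G x * indicator (St t) x) \<partial>lborel) p * ennreal ((1 / (c * t)) powr p)"
      using c t by (intro ennpowr_mult_ennreal) simp
    also have "\<dots> \<le> ennreal ((t powr K / K) powr (p - 1)) * I * ennreal ((1 / (c * t)) powr p)"
      by (intro mult_right_mono j) simp
    finally have "ennpowr (hardy_rearr f t - decr_rearr f t) p / ennreal (t powr (p / n))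
        \<le> ennreal ((t powr K / K) powr (p - 1)) * I * ennreal ((1 / (c * t)) powr p) / ennreal (t powr (p / n))"
      by (rule divide_right_mono_ennreal)
    also have "\<dots> = ennreal ((t powr K / K) powr (p - 1) * (1 / (c * t)) powr p * t powr (- (p / n))) * I"
    proof -
      have "inverse (ennreal (t powr (p / n))) = ennreal (t powr (- (p / n)))"
        using t by (simp add: inverse_ennreal powr_minus)
      then show ?thesis by (simp add: divide_ennreal_def ennreal_mult'' mult_ac)
    qed
    also have "(t powr K / K) powr (p - 1) * (1 / (c * t)) powr p * t powr (- (p / n))
        = c powr (- p) * K powr (1 - p) * t powr (\<beta> - 2)"
    proof -
      \<comment> \<open>The powers of \<open>t\<close>: \<open>K * (p - 1)\<close> from the mass of
        the weight, \<open>- p\<close> from the averaging factor 1/t, and the last one from the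
        weight in the norm.\<close>
      have e: "K * (p - 1) + (- p) + (- (p / n)) = \<beta> - 2" unfolding pn K_def by (simp add: algebra_simps)
      have "(t powr K / K) powr (p - 1) = t powr (K * (p - 1)) * K powr (1 - p)"
        using t K by (simp add: powr_divide powr_powr powr_diff field_simps)
      moreover have "(1 / (c * t)) powr p = c powr (- p) * t powr (- p)"
        using t c by (simp add: powr_divide powr_mult powr_minus field_simps)
      ultimately show ?thesis unfolding e[symmetric] powr_add by (simp add: mult_ac)
    qed
    finally show ?thesis unfolding I_def .
  qed
  define C where "C = c powr (- p) * K powr (1 - p)"
  have C: "0 \<le> C" by (simp add: C_def)
  \<comment> \<open>\<open>indicator {s x..} t\<close> is the condition \<open>s x \<le> t\<close>
    from \<open>St t\<close>, read as a condition on \<open>t\<close> for the exchange of the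
    integrals.\<close>
  define H where "H = (\<lambda>t x. ennreal (C * s x powr K * G x powr p) * indicator S x * (ennreal (t powr (\<beta> - 2)) * indicator {s x..} t))"
  have Hm[measurable]: "case_prod H \<in> borel_measurable (borel \<Otimes>\<^sub>M borel)"
    unfolding H_def atLeast_def by measurable
  have "(\<integral>\<^sup>+ t\<in>{0<..}. ennpowr (hardy_rearr f t - decr_rearr f t) p / ennreal (t powr (p / n)) \<partial>lborel)
    \<le> (\<integral>\<^sup>+ t. \<integral>\<^sup>+ x. H t x \<partial>lborel \<partial>lborel)"
  proof (rule nn_integral_mono)
    fix t :: real
    show "ennpowr (hardy_rearr f t - decr_rearr f t) p / ennreal (t powr (p / n)) * indicator {0<..} t \<le> (\<integral>\<^sup>+ x. H t x \<partial>lborel)"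
    proof (cases "0 < t")
      case True
      have "(\<integral>\<^sup>+ x. H t x \<partial>lborel) = ennreal (C * t powr (\<beta> - 2)) * (\<integral>\<^sup>+ x. ennreal (s x powr K * G x powr p * indicator (St t) x) \<partial>lborel)"
      proof (subst nn_integral_cmult[symmetric])
        show "(\<integral>\<^sup>+ x. H t x \<partial>lborel) = (\<integral>\<^sup>+ x. ennreal (C * t powr (\<beta> - 2)) * ennreal (s x powr K * G x powr p * indicator (St t) x) \<partial>lborel)"
          by (intro nn_integral_cong) (auto simp: H_def St_def ennreal_mult[symmetric] C mult_ac split: split_indicator)
      qed measurable
      then show ?thesis using step2[OF True] True by (simp add: C_def)
    qed simp
  qed
  also have "\<dots> = (\<integral>\<^sup>+ x. \<integral>\<^sup>+ t. H t x \<partial>lborel \<partial>lborel)"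
    by (rule lborel_pair.Fubini'[symmetric]) measurable
  also have "\<dots> \<le> (\<integral>\<^sup>+ x. ennreal (C / K) * ennreal (G x powr p) \<partial>lborel)"
  proof (rule nn_integral_mono)
    fix x
    show "(\<integral>\<^sup>+ t. H t x \<partial>lborel) \<le> ennreal (C / K) * ennreal (G x powr p)"
    proof (cases "x \<in> S")
      case True
      then have sx: "0 < s x" by (simp add: S_def)
      have "(\<integral>\<^sup>+ t. H t x \<partial>lborel) = ennreal (C * s x powr K * G x powr p) * (\<integral>\<^sup>+ t\<in>{s x..}. ennreal (t powr (\<beta> - 2)) \<partial>lborel)"
        using True unfolding H_def by (subst nn_integral_cmult) auto
      also have "(\<integral>\<^sup>+ t\<in>{s x..}. ennreal (t powr (\<beta> - 2)) \<partial>lborel) = ennreal (s x powr (- K) / K)"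
        using \<beta> sx by (subst nn_integral_powr_to_inf) (auto simp: K_def)
      also have "ennreal (C * s x powr K * G x powr p) * ennreal (s x powr (- K) / K) = ennreal (C / K) * ennreal (G x powr p)"
        using C K sx by (simp add: ennreal_mult[symmetric] powr_minus field_simps)
      finally show ?thesis by simp
    qed (simp add: H_def)
  qed
  also have "\<dots> = ennreal (C / K) * (\<integral>\<^sup>+ x. ennreal (G x powr p) \<partial>lborel)"
    by (rule nn_integral_cmult) measurable
  \<comment> \<open>\<open>K powr (1 - p)\<close> stems from Hoelder's inequality, the last 1/K from
    the integral of \<open>t powr (\<beta> - 2)\<close> over \<open>{s x..}\<close>.\<close>
  also have "C / K = (c * K) powr (- p)"
    using K c by (simp add: C_def powr_mult powr_diff powr_minus field_simps)
  finally show ?thesis unfolding K_def \<beta>_def .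
qed

section \<open>Reduction to Borel representatives\<close>

lemma lebesgue_ex_borel_real:
  fixes f :: "'a::euclidean_space \<Rightarrow> real"
  assumes "f \<in> borel_measurable lebesgue"
  obtains f' where "f' \<in> borel_measurable borel" "AE x in lborel. f x = f' x"
  using completion_ex_borel_measurable_real[OF assms] by auto

lemma lebesgue_ex_borel_vec:
  fixes g :: "real ^ 'n \<Rightarrow> real ^ 'n"
  assumes g[measurable]: "g \<in> borel_measurable lebesgue"
  obtains g' where "g' \<in> borel_measurable borel" "AE x in lborel. g x = g' x"
proof -
  have "\<exists>h. h \<in> borel_measurable borel \<and> (AE x in lborel. g x $ i = h x)" for i
  proof -
    have "(\<lambda>x. g x $ i) \<in> borel_measurable lebesgue"
      by (rule measurable_compose[OF g]) (intro borel_measurable_continuous_onI continuous_intros)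
    then show ?thesis using lebesgue_ex_borel_real by metis
  qed
  then obtain h where h: "\<And>i. h i \<in> borel_measurable borel" "\<And>i. AE x in lborel. g x $ i = h i x" by metis
  define g' where "g' = (\<lambda>x. \<chi> i. h i x)"
  have "g' \<in> borel_measurable borel"
  proof (rule borel_measurable_euclidean_space[THEN iffD2], rule ballI)
    fix b :: "real ^ 'n" assume "b \<in> Basis"
    then obtain i where b: "b = axis i 1" by (auto simp: Basis_vec_def)
    have "(\<lambda>x. g' x \<bullet> b) = h i" unfolding b g'_def by (simp add: inner_axis)
    then show "(\<lambda>x. g' x \<bullet> b) \<in> borel_measurable borel" using h(1)[of i] by (simp only:)
  qed
  moreover have "AE x in lborel. \<forall>i\<in>UNIV. g x $ i = h i x"
    using AE_finite_allI[where S="UNIV :: 'n set" and M=lborel and Q="\<lambda>i x. g x $ i = h i x", OF finite_class.finite_UNIV h(2)] .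
  then have "AE x in lborel. g x = g' x" by eventually_elim (simp add: g'_def vec_eq_iff)
  ultimately show ?thesis by (rule that)
qed

text \<open>For a weak gradient that is not assumed to lie in \<open>Lp_space p\<close>,
  measurability has to come from local integrability, through truncations to growing balls.\<close>

lemma locally_integrable_measurable:
  fixes g :: "real ^ 'n \<Rightarrow> 'b::euclidean_space"
  assumes "locally_integrable g" shows "g \<in> borel_measurable lebesgue"
proof (rule borel_measurable_LIMSEQ_metric)
  show "(\<lambda>x. indicator (cball 0 (real k)) x *\<^sub>R g x) \<in> borel_measurable lebesgue" for k
  proof -
    have "set_integrable lebesgue (cball 0 (real k)) g" using assms compact_cball by (simp add: locally_integrable_def)
    then show ?thesis unfolding set_integrable_def by (rule borel_measurable_integrable)
  qed
  fix x :: "real ^ 'n"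
  obtain N where "norm x < real N" using reals_Archimedean2 by blast
  then have "indicator (cball 0 (real k)) x *\<^sub>R g x = g x" if "N \<le> k" for k
    using that by simp
  then have "\<forall>\<^sub>F k in sequentially. indicator (cball 0 (real k)) x *\<^sub>R g x = g x"
    by (rule eventually_sequentiallyI)
  then show "(\<lambda>k. indicator (cball 0 (real k)) x *\<^sub>R g x) \<longlonglongrightarrow> g x" by (rule tendsto_eventually)
qed

lemma Lp_norm_eq:
  "Lp_norm p f = ennpowr (\<integral>\<^sup>+ x. ennreal (norm (f x) powr p) \<partial>lborel) (1 / p)"
  unfolding Lp_norm_def by (simp add: ennpowr_def nn_integral_completion)

lemma ennpowr_finite_iff: "ennpowr X a < \<infinity> \<longleftrightarrow> X < \<infinity>"
  by (auto simp: ennpowr_def less_top)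

lemma rearr_cong_AE:
  fixes f f' :: "real ^ 'n \<Rightarrow> real"
  assumes f: "f \<in> borel_measurable lebesgue" and f': "f' \<in> borel_measurable borel"
    and eq: "AE x in lborel. f x = f' x"
  shows "decr_rearr f = decr_rearr f'" "hardy_rearr f = hardy_rearr f'"
proof -
  have "f' \<in> borel_measurable lebesgue" using f' by (simp add: measurable_completion)
  note [measurable] = f this
  have "emeasure lebesgue {x. l < \<bar>f x\<bar>} = emeasure lebesgue {x. l < \<bar>f' x\<bar>}" for l
  proof (rule emeasure_eq_AE)
    show "AE x in lebesgue. x \<in> {x. l < \<bar>f x\<bar>} \<longleftrightarrow> x \<in> {x. l < \<bar>f' x\<bar>}"
      using AE_completion[OF eq] by eventually_elim simp
    have "{x \<in> space lebesgue. l < \<bar>f x\<bar>} \<in> sets lebesgue" "{x \<in> space lebesgue. l < \<bar>f' x\<bar>} \<in> sets lebesgue"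
      by measurable
    then show "{x. l < \<bar>f x\<bar>} \<in> sets lebesgue" "{x. l < \<bar>f' x\<bar>} \<in> sets lebesgue" by simp_all
  qed
  then show *: "decr_rearr f = decr_rearr f'" unfolding decr_rearr_def by auto
  then show "hardy_rearr f = hardy_rearr f'" unfolding hardy_rearr_def by auto
qed

lemma weak_gradient_borel:
  fixes f f' :: "real ^ 'n \<Rightarrow> real" and g g' :: "real ^ 'n \<Rightarrow> real ^ 'n"
  assumes w: "has_weak_gradient f g"
    and f: "f \<in> borel_measurable lebesgue" and f'[measurable]: "f' \<in> borel_measurable borel" and ff: "AE x in lborel. f x = f' x"
    and g: "g \<in> borel_measurable lebesgue" and g'[measurable]: "g' \<in> borel_measurable borel" and gg: "AE x in lborel. g x = g' x"
    and t: "test_function \<phi>"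
  shows "(\<integral> x. f' x * partial_deriv i \<phi> x \<partial>lborel) = - (\<integral> x. g' x $ i * \<phi> x \<partial>lborel)"
proof -
  have "Ck 0 \<phi>" "Ck 1 \<phi>" using t unfolding test_function_def by blast+
  then have "continuous_on UNIV \<phi>" "continuous_on UNIV (partial_deriv i \<phi>)" by auto
  then have m[measurable]: "\<phi> \<in> borel_measurable borel" "partial_deriv i \<phi> \<in> borel_measurable borel"
    by (auto intro: borel_measurable_continuous_onI)
  have vi[measurable]: "(\<lambda>y :: real ^ 'n. y $ i) \<in> borel_measurable borel"
    by (intro borel_measurable_continuous_onI continuous_intros)
  have lm: "h \<in> borel_measurable lebesgue" if "h \<in> borel_measurable borel" for h :: "real ^ 'n \<Rightarrow> real"
    using that by (simp add: measurable_completion)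
  have cg: "(\<integral> x. h x \<partial>lebesgue) = (\<integral> x. h' x \<partial>lborel)"
    if "h \<in> borel_measurable lebesgue" "h' \<in> borel_measurable borel" "AE x in lborel. h x = h' x" for h h' :: "real ^ 'n \<Rightarrow> real"
  proof -
    have "(\<integral> x. h x \<partial>lebesgue) = (\<integral> x. h' x \<partial>lebesgue)"
      by (rule integral_cong_AE[OF that(1) lm[OF that(2)] AE_completion[OF that(3)]])
    also have "\<dots> = (\<integral> x. h' x \<partial>lborel)" using that by (intro integral_completion) simp
    finally show ?thesis .
  qed
  have "(\<integral> x. f' x * partial_deriv i \<phi> x \<partial>lborel) = (\<integral> x. f x * partial_deriv i \<phi> x \<partial>lebesgue)"
  proof (rule cg[symmetric])
    show "(\<lambda>x. f x * partial_deriv i \<phi> x) \<in> borel_measurable lebesgue"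
      by (intro borel_measurable_times f lm m)
    show "AE x in lborel. f x * partial_deriv i \<phi> x = f' x * partial_deriv i \<phi> x"
      using ff by eventually_elim simp
  qed measurable
  also have "\<dots> = - (\<integral> x. g x $ i * \<phi> x \<partial>lebesgue)" using w t unfolding has_weak_gradient_def by blast
  also have "(\<integral> x. g x $ i * \<phi> x \<partial>lebesgue) = (\<integral> x. g' x $ i * \<phi> x \<partial>lborel)"
  proof (rule cg)
    show "(\<lambda>x. g x $ i * \<phi> x) \<in> borel_measurable lebesgue"
      by (intro borel_measurable_times lm m measurable_compose[OF g vi])
    show "AE x in lborel. g x $ i * \<phi> x = g' x $ i * \<phi> x" using gg by eventually_elim simp
  qed measurable
  finally show ?thesis .
qed

lemma sobolev_norm_inf_p_le:
  fixes f :: "real ^ 'n \<Rightarrow> real" and g :: "real ^ 'n \<Rightarrow> real ^ 'n"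
  assumes n: "CARD('n) \<ge> 2" and p: "1 \<le> p" and f: "f \<in> Lp_space p" and g: "has_weak_gradient f g"
  shows "ennreal (real CARD('n) * omega TYPE('n) powr (1 / real CARD('n)) * (1 - (1 / p - 1 / real CARD('n))))
      * norm_inf_p p f \<le> Lp_norm p g"
proof (cases "Lp_norm p g = \<infinity>")
  case False
  define c where "c = real CARD('n) * omega TYPE('n) powr (1 / real CARD('n))"
  \<comment> \<open>\<open>omega\<close> uses the completed measure, \<open>iso_const\<close> the
    Borel one; they agree on the ball.\<close>
  have om: "omega TYPE('n) = measure lborel (ball (0 :: real ^ 'n) 1)"
    unfolding omega_def measure_def by (subst emeasure_lebesgue_borel) auto
  have c_eq: "c = iso_const TYPE(real ^ 'n)" unfolding c_def om iso_const_def by simp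
  have "emeasure lborel (ball (0 :: real ^ 'n) 1) = ennreal (unit_ball_vol (real DIM(real ^ 'n)))"
    using emeasure_ball[of 1 "0 :: real ^ 'n"] by simp
  then have "0 < omega TYPE('n)" unfolding om measure_def by simp
  then have c: "0 < c" by (simp add: c_def)
  define k where "k = 1 - (1 / p - 1 / real CARD('n))"
  have k: "0 < k"
  proof -
    have "1 / p \<le> 1" "0 < 1 / real CARD('n)" using p n by auto
    then show ?thesis unfolding k_def by linarith
  qed
  have fm: "f \<in> borel_measurable lebesgue" using f by (simp add: Lp_space_def)
  have gm: "g \<in> borel_measurable lebesgue" using g unfolding has_weak_gradient_def by (intro locally_integrable_measurable) blast
  obtain f' where f'[measurable]: "f' \<in> borel_measurable borel" and ff: "AE x in lborel. f x = f' x"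
    using lebesgue_ex_borel_real[OF fm] .
  obtain g' where g'[measurable]: "g' \<in> borel_measurable borel" and gg: "AE x in lborel. g x = g' x"
    using lebesgue_ex_borel_vec[OF gm] .
  have If: "(\<integral>\<^sup>+ x. ennreal (norm (f x) powr p) \<partial>lborel) = (\<integral>\<^sup>+ x. ennreal (norm (f' x) powr p) \<partial>lborel)"
    by (rule nn_integral_cong_AE) (use ff in eventually_elim, simp)
  have Ig: "(\<integral>\<^sup>+ x. ennreal (norm (g x) powr p) \<partial>lborel) = (\<integral>\<^sup>+ x. ennreal (norm (g' x) powr p) \<partial>lborel)"
    by (rule nn_integral_cong_AE) (use gg in eventually_elim, simp)
  have fp: "(\<integral>\<^sup>+ x. ennreal (norm (f' x) powr p) \<partial>lborel) < \<infinity>"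
  proof -
    have "Lp_norm p f < \<infinity>" using f by (simp add: Lp_space_def)
    then show ?thesis unfolding Lp_norm_eq ennpowr_finite_iff If .
  qed
  define B where "B = (\<integral>\<^sup>+ x. ennreal (norm (g' x) powr p) \<partial>lborel)"
  have Lg: "Lp_norm p g = ennpowr B (1 / p)" unfolding Lp_norm_eq Ig B_def ..
  then have Bfin: "B < \<infinity>" using False ennpowr_finite_iff[of B "1 / p"] by (simp add: less_top)
  define A where "A = (\<integral>\<^sup>+ t\<in>{0<..}. ennpowr (hardy_rearr f t - decr_rearr f t) p / ennreal (t powr (p / real CARD('n))) \<partial>lborel)"
  have "A \<le> ennreal ((c * k) powr (- p)) * B"
    unfolding A_def B_def rearr_cong_AE[OF fm f' ff] k_def
  proof (rule hardy_rearr_inequality[OF f'])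
    show "emeasure lborel {x. l < \<bar>f' x\<bar>} < \<infinity>" if "0 < l" for l
      using Lp_level_set_finite[OF f' that p fp] by simp
    fix \<psi> :: "real \<Rightarrow> ennreal" assume \<psi>: "\<psi> \<in> borel_measurable borel"
    show "(\<integral>\<^sup>+ l\<in>{0<..}. \<psi> l * ennreal (c * superlevel f' l powr (1 - 1 / real CARD('n))) \<partial>lborel)
        \<le> (\<integral>\<^sup>+ x. \<psi> \<bar>f' x\<bar> * indicator {0<..} \<bar>f' x\<bar> * ennreal (norm (g' x)) \<partial>lborel)"
      using sobolev_level_sets_le_gradient[OF f' g' p fp Bfin[unfolded B_def] weak_gradient_borel[OF g fm f' ff gm g' gg] \<psi>]
      unfolding c_eq superlevel_def by simp
  qed (use n c p in auto)
  then have "ennpowr A (1 / p) \<le> ennpowr (B * ennreal ((c * k) powr (- p))) (1 / p)"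
    using p by (intro ennpowr_mono) (simp_all add: mult.commute)
  also have "\<dots> = ennpowr B (1 / p) * ennreal (1 / (c * k))"
  proof -
    have "((c * k) powr (- p)) powr (1 / p) = 1 / (c * k)"
      unfolding powr_powr using c k p by (simp add: powr_minus_divide)
    then show ?thesis using c k by (subst ennpowr_mult_ennreal) (simp_all only: zero_less_mult_iff powr_gt_zero, simp_all)
  qed
  finally have "ennreal (c * k) * ennpowr A (1 / p) \<le> ennreal (c * k) * (ennpowr B (1 / p) * ennreal (1 / (c * k)))"
    by (rule mult_left_mono) simp
  also have "\<dots> = ennpowr B (1 / p) * (ennreal (c * k) * ennreal (1 / (c * k)))" by (simp only: mult_ac)
  also have "ennreal (c * k) * ennreal (1 / (c * k)) = 1"
    using c k by (simp add: ennreal_mult''[symmetric])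
  finally show ?thesis unfolding Lg norm_inf_p_def A_def[symmetric] c_def k_def by simp
qed simp

text \<open>An extended real \<open>q\<close> covers the case p = n, where 1/q = 0 and the factor 1
  - 1/q becomes 1. Only 1/q enters the inequality, and by hypothesis it is a real number.\<close>

theorem corollary2p1:
  fixes f :: "real ^ 'n \<Rightarrow> real" and g :: "real ^ 'n \<Rightarrow> real ^ 'n"
    and p :: real and q :: ereal
  assumes n: "CARD('n) \<ge> 2"
    and p: "1 \<le> p"
    and q: "1 / q = ereal (1 / p - 1 / real CARD('n))"
    and f: "f \<in> sobolev_W1 p"
    and g: "has_weak_gradient f g"
  shows "Lp_norm p g \<ge>
           ennreal (real CARD('n) * omega TYPE('n) powr (1 / real CARD('n))
                      * real_of_ereal (1 - 1 / q)) * norm_inf_p p f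
       \<and> (p = real CARD('n) \<longrightarrow>
           Lp_norm (real CARD('n)) g \<ge>
             ennreal (real CARD('n) * omega TYPE('n) powr (1 / real CARD('n)))
               * norm_inf_p (real CARD('n)) f)"
proof -
  have fp: "f \<in> Lp_space p" using f by (simp add: sobolev_W1_def)
  have "real_of_ereal (1 - 1 / q) = 1 - (1 / p - 1 / real CARD('n))"
    unfolding q by (simp add: one_ereal_def)
  then show ?thesis using sobolev_norm_inf_p_le[OF n p fp g] by auto
qed

end
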